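(* Let $\mu$ be a non-zero, nonnegative, symmetric Radon measure on $\mathbb{R}\setminus\{0\}$ with $\mu(\{x\})=0$ for all $x\neq 0$ and $$\int_{\mathbb{R}}\min(|z|,z^2)\,d\mu(z)<+\infty .$$ Let $f\in C^1(\mathbb{R})$ satisfy $f(0)=f(1)=0$, $f'(1)<0$ and be monostable: $f>0$ in $(0,1)$. Assume further that there exist $\kappa>0$ and a positive function $w\in C^2(\mathbb{R})\cap L^\infty(\mathbb{R})\cap\mathrm{Dom}(\mathcal{D}_\mu)$ such that $$\mathcal{D}_\mu[w]+\kappa w'+f(w)<0\ \text{ on }\mathbb{R},\qquad \lim_{x\to-\infty}w(x)\ge1,\qquad \inf_{x\in\mathbb{R}}w(x)<1 .$$ Then there exists $0<c^\star\le\kappa$ such that for every $c\ge c^\star$ there exists $u\in L^\infty(\mathbb{R})\cap C^1(\mathbb{R})$, positive and monotone decreasing, such that $$\mathcal{D}_\mu[u]+cu'+f(u)=0 \text{ on }\mathbb{R},\qquad \lim_{x\to-\infty}u(x)=1,\qquad \lim_{x\to+\infty}u(x)=0 .$$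
   Context: $\mathcal{D}_\mu[u](x):=\lim_{\delta\to0^+}\int_{\{|z|\ge\delta\}}[u(x+z)-u(x)]\,d\mu(z)$, and $\mathrm{Dom}(\mathcal{D}_\mu)$ is the set of functions $u:\mathbb{R}\to\mathbb{R}$ such that $\mathcal{D}_\mu[u](x)$ exists and is finite for all $x\in\mathbb{R}$. Symmetric means $\mu(-A)=\mu(A)$. *)

theory Defs
  imports "HOL-Analysis.Analysis"
begin

(* Radon measure on the subspace X: Borel, finite on compact sets, inner regular. *)
definition radon_measure_on :: "'a::topological_space set \<Rightarrow> 'a measure \<Rightarrow> bool" where
  "radon_measure_on X \<mu> \<longleftrightarrow>
     sets \<mu> = sets (restrict_space borel X) \<and>
     (\<forall>K. compact K \<and> K \<subseteq> X \<and> K \<in> sets \<mu> \<longrightarrow> emeasure \<mu> K < \<infinity>) \<and>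
     (\<forall>A\<in>sets \<mu>. emeasure \<mu> A = (SUP K\<in>{K \<in> sets \<mu>. compact K \<and> K \<subseteq> A}. emeasure \<mu> K))"

definition symmetric_measure :: "real measure \<Rightarrow> bool" where
  "symmetric_measure \<mu> \<longleftrightarrow> (\<forall>A\<in>sets \<mu>. emeasure \<mu> (uminus ` A) = emeasure \<mu> A)"

definition truncated_jump :: "real measure \<Rightarrow> (real \<Rightarrow> real) \<Rightarrow> real \<Rightarrow> real \<Rightarrow> real" where
  "truncated_jump \<mu> u x \<delta> = (LINT z:{z. \<bar>z\<bar> \<ge> \<delta>}|\<mu>. (u (x + z) - u x))"

definition jump_op :: "real measure \<Rightarrow> (real \<Rightarrow> real) \<Rightarrow> real \<Rightarrow> real" where
  "jump_op \<mu> u x = Lim (at_right 0) (truncated_jump \<mu> u x)"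

(* Integrability is required explicitly because the library's integral of a
   non-integrable function is 0.  If some truncated integral is undefined or infinite,
   so are all those with smaller \<delta>, hence a finite limit forces integrability
   for every \<delta> > 0. *)
definition jump_dom :: "real measure \<Rightarrow> (real \<Rightarrow> real) set" where
  "jump_dom \<mu> = {u. \<forall>x.
     (\<forall>\<delta>>0. set_integrable \<mu> {z. \<bar>z\<bar> \<ge> \<delta>} (\<lambda>z. u (x + z) - u x)) \<and>
     (\<exists>L. (truncated_jump \<mu> u x \<longlongrightarrow> L) (at_right 0))}"

definition Linfty :: "(real \<Rightarrow> real) set" where
  "Linfty = {u \<in> borel_measurable lebesgue. \<exists>C. AE x in lebesgue. \<bar>u x\<bar> \<le> C}"

definition C1 :: "(real \<Rightarrow> real) set" where
  "C1 = {u. u C1_differentiable_on UNIV}"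

definition C2 :: "(real \<Rightarrow> real) set" where
  "C2 = {u \<in> C1. deriv u \<in> C1}"

end

theory Submission
  imports Defs "HOL-Probability.Probability"
begin


text \<open>The wave is built for every speed \<open>c \<ge> \<kappa>\<close>, so \<open>\<kappa>\<close> itself serves as \<open>c_star\<close>.

  Replace \<open>\<mu>\<close> by its finite part on \<open>\<bar>z\<bar> \<ge> \<delta>\<close> and \<open>u'\<close> by an upwind difference quotient. The explicit
  Euler step \<open>Q\<close> of the resulting equation is then order preserving, and Weinberger's recursion
  \<open>u \<mapsto> max (k 1_{x < -a}) (1_{x < R} Q u)\<close> increases from \<open>0\<close> to a decreasing fixed point. It stays below a
  slight multiple \<open>(1 + \<eta>) w\<close> of the given supersolution, which is at least \<open>1\<close> far to the left and is
  still a supersolution there because \<open>f' 1 < 0\<close>; since the iterates decrease, a supersolution for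
  \<open>\<kappa>\<close> also serves for \<open>c \<ge> \<kappa>\<close>. Translating the fixed points so that they cross a level between \<open>inf w\<close>
  and \<open>1\<close> at the origin and letting \<open>\<delta>, k \<rightarrow> 0\<close>, \<open>R \<rightarrow> \<infinity>\<close>, Helly's theorem yields a decreasing \<open>v\<close> whose
  mollifications satisfy the wave equation exactly.

  Regularity comes from energy estimates. The jump operator is symmetric and the derivative
  antisymmetric, so testing the equation with \<open>v'\<close> and its derivative with \<open>v''\<close> bounds both in \<open>L\<^sup>2\<close>
  uniformly in the mollification. As the operators \<open>J S\<close> restricted to jumps in \<open>S\<close> commute and are
  negative, \<open>J S v'\<close> is bounded in \<open>L\<^sup>2\<close> too, and small jumps contribute uniformly little in the
  supremum norm. This gives \<open>v \<in> C1\<close> and the convergence of the principal value at every point, although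
  \<open>v''\<close> need not be bounded.\<close>

subsection \<open>Averages and difference quotients\<close>

text \<open>Mollification is iterated averaging over \<open>{x..x + e}\<close>: the derivative of an
  average is the difference quotient \<open>dq e\<close>, so derivatives, averages and jump
  operators commute by algebra. Three averages make a monotone function \<open>C^2\<close>, which
  gives the full jump operator an absolutely convergent integral; a fourth lets the bounds on the
  differentiated equation apply to the function that is sent to the limit. Averages look to the
  right, so right-continuous Helly limits are recovered at every point.

  The reaction does not commute with averaging. The energy bound on the mollified derivative is
  therefore carried over to difference quotients of \<open>v\<close> itself before the
  differentiated equation is estimated. It is uniform because the total variation of
  \<open>v\<close> is at most 1 and because \<open>c > 0\<close>.

  Sup-norm control of the small jumps is an interpolation: averaging over a length \<open>l\<close>
  costs \<open>sqrt l\<close> by Hoelder continuity and buys a second derivative of size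
  \<open>1 / sqrt l\<close>. Fixing \<open>l\<close> before the truncation radius makes both errors
  small.\<close>

definition bounded_borel :: "(real \<Rightarrow> real) \<Rightarrow> bool" where
  "bounded_borel u \<longleftrightarrow> u \<in> borel_measurable borel \<and> (\<exists>C. \<forall>x. \<bar>u x\<bar> \<le> C)"

lemma bounded_borelI:
  "u \<in> borel_measurable borel \<Longrightarrow> (\<And>x. \<bar>u x\<bar> \<le> C) \<Longrightarrow> bounded_borel u"
  by (auto simp: bounded_borel_def)

lemma bounded_borel_measurable: "bounded_borel u \<Longrightarrow> u \<in> borel_measurable borel"
  by (auto simp: bounded_borel_def)

lemma bounded_borelE:
  assumes "bounded_borel u"
  obtains C where "C \<ge> 0" "\<And>x. \<bar>u x\<bar> \<le> C"
  using assms unfolding bounded_borel_def by (meson abs_ge_zero order_trans)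

lemma bounded_borel_const: "bounded_borel (\<lambda>x. c)"
  by (rule bounded_borelI[of _ "\<bar>c\<bar>"]) auto

lemma bounded_borel_affine:
  assumes "bounded_borel u" shows "bounded_borel (\<lambda>x. u (a + b * x))"
  using assms by (auto simp: bounded_borel_def)

lemma bounded_borel_shift:
  assumes "bounded_borel u" shows "bounded_borel (\<lambda>x. u (x + a))"
  using assms by (auto simp: bounded_borel_def)

lemma bounded_borel_shift_diff:
  assumes "bounded_borel u" shows "bounded_borel (\<lambda>x. u (x - a))"
  using assms by (auto simp: bounded_borel_def)

lemma bounded_borel_add:
  assumes "bounded_borel u" "bounded_borel v" shows "bounded_borel (\<lambda>x. u x + v x)"
proof -
  have [measurable]: "u \<in> borel_measurable borel" "v \<in> borel_measurable borel"
    using assms by (auto simp: bounded_borel_measurable)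
  obtain C where C: "\<And>x. \<bar>u x\<bar> \<le> C" using bounded_borelE[OF assms(1)] by blast
  obtain D where D: "\<And>x. \<bar>v x\<bar> \<le> D" using bounded_borelE[OF assms(2)] by blast
  show ?thesis
    by (rule bounded_borelI[of _ "C + D"])
      (auto intro!: order_trans[OF abs_triangle_ineq] add_mono C D)
qed

lemma bounded_borel_mult:
  assumes "bounded_borel u" "bounded_borel v" shows "bounded_borel (\<lambda>x. u x * v x)"
proof -
  have [measurable]: "u \<in> borel_measurable borel" "v \<in> borel_measurable borel"
    using assms by (auto simp: bounded_borel_measurable)
  obtain C where C: "C \<ge> 0" "\<And>x. \<bar>u x\<bar> \<le> C" using bounded_borelE[OF assms(1)] by blast
  obtain D where D: "\<And>x. \<bar>v x\<bar> \<le> D" using bounded_borelE[OF assms(2)] by blast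
  show ?thesis
    by (rule bounded_borelI[of _ "C * D"]) (auto simp: abs_mult intro!: mult_mono C D)
qed

lemma bounded_borel_cmult: "bounded_borel u \<Longrightarrow> bounded_borel (\<lambda>x. c * u x)"
  by (intro bounded_borel_mult bounded_borel_const)

lemma bounded_borel_minus: "bounded_borel u \<Longrightarrow> bounded_borel (\<lambda>x. - u x)"
  using bounded_borel_cmult[of u "-1"] by simp

lemma bounded_borel_diff:
  "bounded_borel u \<Longrightarrow> bounded_borel v \<Longrightarrow> bounded_borel (\<lambda>x. u x - v x)"
  using bounded_borel_add[of u "\<lambda>x. - v x"] bounded_borel_minus[of v] by simp

lemma bounded_borel_divide: "bounded_borel u \<Longrightarrow> bounded_borel (\<lambda>x. u x / c)"
  using bounded_borel_cmult[of u "1/c"] by simp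

lemma bounded_borel_power2: "bounded_borel u \<Longrightarrow> bounded_borel (\<lambda>x. (u x)\<^sup>2)"
  by (simp add: power2_eq_square bounded_borel_mult)

lemmas bounded_borel_intros = bounded_borel_const bounded_borel_shift bounded_borel_shift_diff
  bounded_borel_add bounded_borel_mult bounded_borel_minus bounded_borel_diff bounded_borel_divide
  bounded_borel_power2 bounded_borel_affine

lemma bounded_borel_comp:
  assumes "bounded_borel u" "continuous_on UNIV f"
  shows "bounded_borel (\<lambda>x. f (u x))"
proof -
  obtain C where C: "C \<ge> 0" "\<And>x. \<bar>u x\<bar> \<le> C" using bounded_borelE[OF assms(1)] by blast
  have "compact (f ` {-C..C})"
    using assms(2) by (intro compact_continuous_image) (auto intro: continuous_on_subset)
  then obtain D where D: "\<And>s. s \<in> {-C..C} \<Longrightarrow> \<bar>f s\<bar> \<le> D"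
    using compact_imp_bounded bounded_iff by (metis image_eqI real_norm_def)
  have [measurable]: "u \<in> borel_measurable borel" "f \<in> borel_measurable borel"
    using assms by (auto simp: bounded_borel_measurable borel_measurable_continuous_onI)
  show ?thesis
  proof (rule bounded_borelI[of _ D])
    show "\<bar>f (u x)\<bar> \<le> D" for x
      using C(2)[of x] by (intro D) (auto simp: abs_le_iff)
  qed measurable
qed

lemma integrable_bounded_borel:
  assumes "finite_measure M" "sets M = sets borel" "bounded_borel u"
  shows "integrable M u"
proof -
  interpret finite_measure M by fact
  obtain C where "\<And>x. \<bar>u x\<bar> \<le> C" using bounded_borelE[OF assms(3)] by blast
  with assms show ?thesis
    by (intro integrable_const_bound[of _ C]) 
      (auto simp: bounded_borel_measurable cong: measurable_cong_sets)
qed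

lemma integrable_mult_bounded_borel:
  assumes "integrable lborel b" "bounded_borel u"
  shows "integrable lborel (\<lambda>x. b x * u x :: real)"
proof -
  obtain C where C: "C \<ge> 0" "\<And>x. \<bar>u x\<bar> \<le> C" using bounded_borelE[OF assms(2)] by blast
  have [measurable]: "u \<in> borel_measurable borel" "b \<in> borel_measurable borel"
    using assms by (auto simp: bounded_borel_measurable)
  show ?thesis
  proof (rule Bochner_Integration.integrable_bound)
    show "integrable lborel (\<lambda>x. C * b x)" using assms by auto
    show "AE x in lborel. norm (b x * u x) \<le> norm (C * b x)"
    proof (rule AE_I2)
      fix x
      have "\<bar>b x\<bar> * \<bar>u x\<bar> \<le> \<bar>b x\<bar> * C" by (intro mult_left_mono C) simp
      then show "norm (b x * u x) \<le> norm (C * b x)" using C(1) by (simp add: abs_mult mult.commute)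
    qed
  qed measurable
qed

lemma bounded_borel_antimono:
  fixes u :: "real \<Rightarrow> real"
  assumes "antimono u" "\<And>x. 0 \<le> u x" "\<And>x. u x \<le> 1"
  shows "bounded_borel u"
proof -
  have "(\<lambda>x. - u x) \<in> borel_measurable borel"
    using assms(1) by (intro borel_measurable_mono) (auto simp: mono_def antimono_def)
  then have "(\<lambda>x. - (- u x)) \<in> borel_measurable borel" by (rule borel_measurable_uminus)
  then have "u \<in> borel_measurable borel" by simp
  then show ?thesis using assms by (intro bounded_borelI[of _ 1]) (auto simp: abs_of_nonneg)
qed

section \<open>Translations under Lebesgue integrals and limits at infinity\<close>

lemma integrable_shift:
  fixes g :: "real \<Rightarrow> real"
  assumes "integrable lborel g" shows "integrable lborel (\<lambda>x. g (x + a))"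
  using lborel_integrable_real_affine[OF assms, of 1 a] by (simp add: add.commute)

lemma integral_shift:
  fixes g :: "real \<Rightarrow> real"
  shows "(\<integral>x. g (x + a) \<partial>lborel) = (\<integral>x. g x \<partial>lborel)"
  using lborel_integral_real_affine[of 1 g a] by (simp add: add.commute)

lemma nn_integral_shift:
  fixes g :: "real \<Rightarrow> ennreal"
  assumes [measurable]: "g \<in> borel_measurable borel"
  shows "(\<integral>\<^sup>+x. g (x + a) \<partial>lborel) = (\<integral>\<^sup>+x. g x \<partial>lborel)"
  using nn_integral_real_affine[of g 1 a] by (simp add: add.commute)

lemma filterlim_shift:
  fixes z :: real
  shows "filterlim (\<lambda>x. x + z) at_bot at_bot" "filterlim (\<lambda>x. x + z) at_top at_top"
  unfolding filterlim_at_bot eventually_at_bot_linorder filterlim_at_top eventually_at_top_linorder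
  by (metis add_le_cancel_right diff_add_cancel)+

lemma filterlim_real_shift:
  fixes z :: real
  shows "filterlim (\<lambda>n. - real n + z) at_bot sequentially" "filterlim (\<lambda>n. real n + z) at_top sequentially"
  using filterlim_compose[OF filterlim_shift(1) filterlim_compose[OF filterlim_uminus_at_bot_at_top filterlim_real_sequentially]]
    filterlim_compose[OF filterlim_shift(2) filterlim_real_sequentially] by simp_all

section \<open>Averages as expectations over the unit interval\<close>

definition unif01 :: "real measure" where
  "unif01 = density lborel (indicator {0..1})"

lemma sets_unif01[simp, measurable_cong]: "sets unif01 = sets borel"
  and space_unif01[simp]: "space unif01 = UNIV"
  by (simp_all add: unif01_def)

lemma prob_space_unif01: "prob_space unif01"
  by (rule prob_spaceI) (simp add: unif01_def emeasure_density)

interpretation unif01: prob_space unif01 by (rule prob_space_unif01)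

lemma AE_unif01: "AE t in unif01. t \<in> {0..1}"
  unfolding unif01_def by (subst AE_density) (auto simp: indicator_def)

lemma integral_unif01:
  fixes g :: "real \<Rightarrow> real"
  assumes [measurable]: "g \<in> borel_measurable borel"
  shows "(\<integral>t. g t \<partial>unif01) = (\<integral>t. g t * indicator {0..1} t \<partial>lborel)"
proof -
  have "unif01 = density lborel (\<lambda>t. ennreal (indicator {0..1} t))"
    unfolding unif01_def by (intro density_cong) (auto simp: indicator_def)
  moreover have "(\<integral>t. g t \<partial>density lborel (\<lambda>t. ennreal (indicator {0..1} t)))
      = (\<integral>t. indicator {0..1} t *\<^sub>R g t \<partial>lborel)"
    by (rule integral_density) auto
  ultimately show ?thesis by (simp add: mult.commute)
qed

text \<open>As an expectation over a uniform \<open>t\<close>, the average inherits Jensen's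
  inequality and Fubini, and \<open>h\<close> may be zero or negative; negative widths occur in
  \<open>dd_eq_avg\<close>.\<close>

definition avg :: "real \<Rightarrow> (real \<Rightarrow> real) \<Rightarrow> real \<Rightarrow> real" where
  "avg h u x = (\<integral>t. u (x + h * t) \<partial>unif01)"

definition dq :: "real \<Rightarrow> (real \<Rightarrow> real) \<Rightarrow> real \<Rightarrow> real" where
  "dq h u x = (u (x + h) - u x) / h"

lemma integrable_unif01:
  assumes "bounded_borel u" shows "integrable unif01 (\<lambda>t. u (x + h * t))"
  by (rule integrable_bounded_borel)
    (auto intro!: bounded_borel_intros assms unif01.finite_measure_axioms)

lemma avg_lower:
  assumes "bounded_borel u" "\<And>y. a \<le> u y" shows "a \<le> avg h u x"
  unfolding avg_def by (rule unif01.integral_ge_const[OF integrable_unif01[OF assms(1)]]) (simp add: assms)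

lemma avg_upper:
  assumes "bounded_borel u" "\<And>y. u y \<le> a" shows "avg h u x \<le> a"
  unfolding avg_def by (rule unif01.integral_le_const[OF integrable_unif01[OF assms(1)]]) (simp add: assms)

lemma avg_abs_le:
  assumes "bounded_borel u" "\<And>y. \<bar>u y\<bar> \<le> C" shows "\<bar>avg h u x\<bar> \<le> C"
  using avg_lower[OF assms(1), of "-C"] avg_upper[OF assms(1), of C] assms(2)
  by (simp add: abs_le_iff) (metis minus_le_iff)

lemma avg_bounds_interval:
  assumes "bounded_borel u" "\<And>y. x \<le> y \<Longrightarrow> y \<le> x + h \<Longrightarrow> a \<le> u y \<and> u y \<le> b" "0 \<le> h"
  shows "a \<le> avg h u x" "avg h u x \<le> b"
proof -
  have "AE t in unif01. a \<le> u (x + h * t) \<and> u (x + h * t) \<le> b"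
    using AE_unif01
  proof eventually_elim
    case (elim t)
    then have "0 \<le> h * t" "h * t \<le> h" using assms(3) by (auto intro: mult_left_le)
    then show ?case using assms(2)[of "x + h * t"] by auto
  qed
  then show "a \<le> avg h u x" "avg h u x \<le> b"
    unfolding avg_def
    by (auto intro!: unif01.integral_ge_const unif01.integral_le_const integrable_unif01 assms)
qed

lemma avg_add:
  assumes "bounded_borel u" "bounded_borel v"
  shows "avg h (\<lambda>x. u x + v x) x = avg h u x + avg h v x"
  unfolding avg_def using assms by (intro Bochner_Integration.integral_add integrable_unif01)

lemma avg_diff:
  assumes "bounded_borel u" "bounded_borel v"
  shows "avg h (\<lambda>x. u x - v x) x = avg h u x - avg h v x"
  unfolding avg_def using assms by (intro Bochner_Integration.integral_diff integrable_unif01)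

lemma avg_cmult: "avg h (\<lambda>x. c * u x) x = c * avg h u x"
  unfolding avg_def by simp

lemma avg_divide: "avg h (\<lambda>x. u x / c) x = avg h u x / c"
  unfolding avg_def by simp

lemma avg_const: "avg h (\<lambda>x. c) x = c"
  unfolding avg_def using unif01.prob_space by simp

lemma avg_shift: "avg h (\<lambda>x. u (x + a)) x = avg h u (x + a)"
  unfolding avg_def by (simp add: algebra_simps)

lemma avg_shift_diff: "avg h (\<lambda>x. u (x - a)) x = avg h u (x - a)"
  using avg_shift[of h u "-a"] by simp

lemma borel_measurable_avg:
  assumes [measurable]: "u \<in> borel_measurable borel" shows "avg h u \<in> borel_measurable borel"
  unfolding avg_def by measurable

lemma bounded_borel_avg: "bounded_borel u \<Longrightarrow> bounded_borel (avg h u)"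
  by (rule bounded_borelE, assumption)
    (rule bounded_borelI, auto intro!: avg_abs_le borel_measurable_avg simp: bounded_borel_measurable)

lemma bounded_borel_dq: "bounded_borel u \<Longrightarrow> bounded_borel (dq h u)"
  unfolding dq_def[abs_def] by (intro bounded_borel_intros)

lemma avg_dq:
  assumes "bounded_borel u" shows "avg h (dq e u) = dq e (avg h u)"
proof
  fix x show "avg h (dq e u) x = dq e (avg h u) x"
    unfolding dq_def[abs_def] 
    by (subst avg_divide, subst avg_diff) (auto intro!: bounded_borel_intros assms simp: avg_shift)
qed

lemma dq_eq_avg_deriv:
  assumes "\<And>x. (r has_real_derivative r' x) (at x)" "continuous_on UNIV r'" "z \<noteq> 0"
  shows "dq z r x = avg z r' x"
proof -
  have [measurable]: "r' \<in> borel_measurable borel" using assms(2) by (rule borel_measurable_continuous_onI)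
  have iso: "isCont r' y" for y using assms(2) by (simp add: continuous_on_eq_continuous_at)
  have "avg z r' x = (\<integral>t. r' (x + z * t) * indicator {0..1} t \<partial>lborel)"
    unfolding avg_def by (rule integral_unif01) measurable
  also have "\<dots> = r (x + z * 1) / z - r (x + z * 0) / z"
  proof (rule integral_FTC_Icc_real)
    fix t :: real
    show "((\<lambda>t. r (x + z * t) / z) has_real_derivative r' (x + z * t)) (at t)"
      using assms(3) by (auto intro!: derivative_eq_intros DERIV_chain2[OF assms(1)])
    show "isCont (\<lambda>t. r' (x + z * t)) t"
      by (intro continuous_intros isCont_o2[OF _ iso])
  qed simp
  finally show ?thesis by (simp add: dq_def diff_divide_distrib)
qed

lemma continuous_has_antiderivative:
  assumes "continuous_on UNIV (u :: real \<Rightarrow> real)"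
  obtains P where "\<And>x. (P has_real_derivative u x) (at x)"
proof -
  have "\<exists>F. \<forall>x::real. (-\<infinity>::ereal) < ereal x \<longrightarrow> ereal x < \<infinity> \<longrightarrow> (F has_vector_derivative u x) (at x)"
    using assms by (intro einterval_antiderivative) (auto simp: continuous_on_eq_continuous_at)
  then show ?thesis using that by (auto simp: has_real_derivative_iff_has_vector_derivative)
qed

text \<open>The average is the difference quotient of an antiderivative \<open>P\<close>, and
  differentiation turns \<open>P\<close> back into \<open>u\<close>. Each average thus gains one
  derivative, at the price of a factor \<open>1 / h\<close>.\<close>

lemma has_real_derivative_avg:
  assumes "continuous_on UNIV u" "h \<noteq> 0"
  shows "(avg h u has_real_derivative dq h u x) (at x)"
proof -
  obtain P where P: "\<And>x. (P has_real_derivative u x) (at x)"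
    using continuous_has_antiderivative[OF assms(1)] by blast
  have "avg h u = (\<lambda>x. (P (x + h) - P x) / h)"
    using dq_eq_avg_deriv[OF P assms] by (auto simp: dq_def)
  moreover have "((\<lambda>x. (P (x + h) - P x) / h) has_real_derivative dq h u x) (at x)"
    unfolding dq_def using assms(2)
    by (auto intro!: derivative_eq_intros P DERIV_chain2[OF P])
  ultimately show ?thesis by simp
qed

lemma countable_discontinuities_antimono:
  fixes u :: "real \<Rightarrow> real"
  assumes "antimono u" shows "countable {y. \<not> isCont u y}"
proof -
  have "mono (\<lambda>x. - u x)" using assms by (simp add: mono_def antimono_def)
  then have "countable {a. \<not> isCont (\<lambda>x. - u x) a}" by (rule mono_ctble_discont)
  moreover have "isCont (\<lambda>x. - u x) a \<Longrightarrow> isCont u a" for a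
    using continuous_minus[of "at a" "\<lambda>x. - u x"] by simp
  ultimately show ?thesis by (auto elim!: countable_subset[rotated])
qed

text \<open>Pulled back along \<open>t \<mapsto> x + h * t\<close>, the countable set
  \<open>D\<close> becomes a null set of \<open>t\<close>. Convergence at continuity points, which
  is what Helly's theorem provides, thereby turns into convergence of averages at every
  point.\<close>

lemma avg_tendsto:
  assumes b: "\<And>n. bounded_borel (u n)" "\<And>n x. \<bar>u n x\<bar> \<le> C" "bounded_borel w"
    and lim: "\<And>y. y \<notin> D \<Longrightarrow> (\<lambda>n. u n y) \<longlonglongrightarrow> w y" and "countable D" "h \<noteq> 0"
  shows "(\<lambda>n. avg h (u n) x) \<longlonglongrightarrow> avg h w x"
proof -
  have [measurable]: "u n \<in> borel_measurable borel" "w \<in> borel_measurable borel" for n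
    using b by (auto intro: bounded_borel_measurable)
  have "countable ((\<lambda>y. (y - x) / h) ` D)" using \<open>countable D\<close> by simp
  then have "AE t in lborel. t \<notin> (\<lambda>y. (y - x) / h) ` D"
    by (rule AE_not_in[OF countable_imp_null_set_lborel])
  then have "AE t in unif01. t \<notin> (\<lambda>y. (y - x) / h) ` D"
    unfolding unif01_def by (subst AE_density) auto
  then have ae: "AE t in unif01. (\<lambda>n. u n (x + h * t)) \<longlonglongrightarrow> w (x + h * t)"
  proof eventually_elim
    case (elim t)
    then have "x + h * t \<notin> D" using \<open>h \<noteq> 0\<close> by (auto simp: image_iff field_simps)
    then show ?case by (rule lim)
  qed
  show ?thesis unfolding avg_def
  proof (rule integral_dominated_convergence[where w="\<lambda>_. C"])
    show "AE t in unif01. norm (u n (x + h * t)) \<le> C" for n using b(2) by simp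
    show "AE t in unif01. (\<lambda>n. u n (x + h * t)) \<longlonglongrightarrow> w (x + h * t)" by (fact ae)
    show "integrable unif01 (\<lambda>_. C)" by simp
  qed measurable
qed

text \<open>Continuity at \<open>a\<close> is convergence of averages of translates, and translates
  of a monotone function converge off its countably many discontinuities.\<close>

lemma continuous_on_avg_antimono:
  assumes "antimono u" "bounded_borel u" "h \<noteq> 0"
  shows "continuous_on UNIV (avg h u)"
  unfolding continuous_on_sequentially
proof safe
  fix X :: "nat \<Rightarrow> real" and a assume X: "X \<longlonglongrightarrow> a"
  obtain C where C: "\<And>x. \<bar>u x\<bar> \<le> C" using bounded_borelE[OF assms(2)] by blast
  have "(\<lambda>n. avg h (\<lambda>y. u (y + (X n - a))) a) \<longlonglongrightarrow> avg h u a"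
  proof (rule avg_tendsto[where C=C, OF bounded_borel_shift[OF assms(2)] C assms(2) _
        countable_discontinuities_antimono[OF assms(1)] assms(3)])
    fix y assume "y \<notin> {y. \<not> isCont u y}"
    moreover have "(\<lambda>n. y + (X n - a)) \<longlonglongrightarrow> y + (a - a)" by (intro tendsto_intros X)
    ultimately show "(\<lambda>n. u (y + (X n - a))) \<longlonglongrightarrow> u y"
      by (intro isCont_tendsto_compose[of y u]) auto
  qed
  then show "(avg h u \<circ> X) \<longlonglongrightarrow> avg h u a" by (simp add: avg_shift comp_def)
qed

text \<open>Jensen's inequality, in the form that a variance is nonnegative, followed by Tonelli and
  translation invariance. With extended nonnegative integrals, square integrability of the average
  becomes a consequence.\<close>

lemma nn_integral_avg_square_le:
  assumes "bounded_borel u"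
  shows "(\<integral>\<^sup>+x. ennreal ((avg h u x)\<^sup>2) \<partial>lborel) \<le> (\<integral>\<^sup>+x. ennreal ((u x)\<^sup>2) \<partial>lborel)"
proof -
  have [measurable]: "u \<in> borel_measurable borel" using assms by (rule bounded_borel_measurable)
  have "(avg h u x)\<^sup>2 \<le> (\<integral>t. (u (x + h * t))\<^sup>2 \<partial>unif01)" for x
    using unif01.variance_positive[of "\<lambda>t. u (x + h * t)"]
    by (subst (asm) unif01.variance_eq)
      (auto simp: avg_def intro!: integrable_unif01 assms bounded_borel_intros
        integrable_unif01[of "\<lambda>y. (u y)\<^sup>2"])
  then have "(\<integral>\<^sup>+x. ennreal ((avg h u x)\<^sup>2) \<partial>lborel) \<le> (\<integral>\<^sup>+x. ennreal (\<integral>t. (u (x + h * t))\<^sup>2 \<partial>unif01) \<partial>lborel)"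
    by (intro nn_integral_mono ennreal_leI) auto
  also have "\<dots> = (\<integral>\<^sup>+x. (\<integral>\<^sup>+t. ennreal ((u (x + h * t))\<^sup>2) \<partial>unif01) \<partial>lborel)"
    by (intro nn_integral_cong nn_integral_eq_integral[symmetric])
      (auto intro!: assms bounded_borel_intros integrable_unif01[of "\<lambda>y. (u y)\<^sup>2"])
  also have "\<dots> = (\<integral>\<^sup>+t. (\<integral>\<^sup>+x. ennreal ((u (x + h * t))\<^sup>2) \<partial>lborel) \<partial>unif01)"
  proof -
    interpret pair_sigma_finite unif01 lborel
      by (intro pair_sigma_finite.intro unif01.sigma_finite_measure_axioms lborel.sigma_finite_measure_axioms)
    show ?thesis by (rule Fubini') measurable
  qed
  also have "\<dots> = (\<integral>\<^sup>+t. (\<integral>\<^sup>+x. ennreal ((u x)\<^sup>2) \<partial>lborel) \<partial>unif01)"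
    by (rule nn_integral_cong) (rule nn_integral_shift[of "\<lambda>y. ennreal ((u y)\<^sup>2)"], measurable)
  also have "\<dots> = (\<integral>\<^sup>+x. ennreal ((u x)\<^sup>2) \<partial>lborel)"
    using unif01.emeasure_space_1 by simp
  finally show ?thesis .
qed

lemma nn_integral_avg_abs_le:
  assumes "bounded_borel u"
  shows "(\<integral>\<^sup>+x. ennreal \<bar>avg h u x\<bar> \<partial>lborel) \<le> (\<integral>\<^sup>+x. ennreal \<bar>u x\<bar> \<partial>lborel)"
proof -
  have [measurable]: "u \<in> borel_measurable borel" using assms by (rule bounded_borel_measurable)
  have "(\<integral>\<^sup>+x. ennreal \<bar>avg h u x\<bar> \<partial>lborel) \<le> (\<integral>\<^sup>+x. (\<integral>\<^sup>+t. ennreal \<bar>u (x + h * t)\<bar> \<partial>unif01) \<partial>lborel)"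
    unfolding avg_def
    using integral_norm_bound_ennreal[OF integrable_unif01[OF assms]]
    by (intro nn_integral_mono) (simp only: real_norm_def)
  also have "\<dots> = (\<integral>\<^sup>+t. (\<integral>\<^sup>+x. ennreal \<bar>u (x + h * t)\<bar> \<partial>lborel) \<partial>unif01)"
  proof -
    interpret pair_sigma_finite unif01 lborel
      by (intro pair_sigma_finite.intro unif01.sigma_finite_measure_axioms lborel.sigma_finite_measure_axioms)
    show ?thesis by (rule Fubini') measurable
  qed
  also have "\<dots> = (\<integral>\<^sup>+t. (\<integral>\<^sup>+x. ennreal \<bar>u x\<bar> \<partial>lborel) \<partial>unif01)"
    by (rule nn_integral_cong) (rule nn_integral_shift[of "\<lambda>y. ennreal \<bar>u y\<bar>"], measurable)
  also have "\<dots> = (\<integral>\<^sup>+x. ennreal \<bar>u x\<bar> \<partial>lborel)"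
    using unif01.emeasure_space_1 by simp
  finally show ?thesis .
qed

lemma integrable_avg:
  assumes "bounded_borel u" "integrable lborel u"
  shows "integrable lborel (avg h u)" "(\<integral>x. \<bar>avg h u x\<bar> \<partial>lborel) \<le> (\<integral>x. \<bar>u x\<bar> \<partial>lborel)"
proof -
  have [measurable]: "avg h u \<in> borel_measurable borel"
    using assms by (intro borel_measurable_avg bounded_borel_measurable)
  have fin: "(\<integral>\<^sup>+x. ennreal \<bar>u x\<bar> \<partial>lborel) = ennreal (\<integral>x. \<bar>u x\<bar> \<partial>lborel)"
    using assms(2) by (intro nn_integral_eq_integral) auto
  have le: "(\<integral>\<^sup>+x. ennreal \<bar>avg h u x\<bar> \<partial>lborel) \<le> ennreal (\<integral>x. \<bar>u x\<bar> \<partial>lborel)"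
    using nn_integral_avg_abs_le[OF assms(1)] fin by simp
  show 1: "integrable lborel (avg h u)"
    using le by (intro integrableI_bounded) (auto intro: le_less_trans)
  have "ennreal (\<integral>x. \<bar>avg h u x\<bar> \<partial>lborel) \<le> ennreal (\<integral>x. \<bar>u x\<bar> \<partial>lborel)"
    using le 1 by (subst (asm) nn_integral_eq_integral) auto
  then show "(\<integral>x. \<bar>avg h u x\<bar> \<partial>lborel) \<le> (\<integral>x. \<bar>u x\<bar> \<partial>lborel)"
    by (simp add: ennreal_le_iff)
qed

lemma integral_avg_square_le:
  assumes "bounded_borel u" "integrable lborel (\<lambda>x. (u x)\<^sup>2)"
  shows "integrable lborel (\<lambda>x. (avg h u x)\<^sup>2)"
    "(\<integral>x. (avg h u x)\<^sup>2 \<partial>lborel) \<le> (\<integral>x. (u x)\<^sup>2 \<partial>lborel)"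
proof -
  have [measurable]: "avg h u \<in> borel_measurable borel"
    using assms by (intro borel_measurable_avg bounded_borel_measurable)
  have fin: "(\<integral>\<^sup>+x. ennreal ((u x)\<^sup>2) \<partial>lborel) = ennreal (\<integral>x. (u x)\<^sup>2 \<partial>lborel)"
    using assms(2) by (intro nn_integral_eq_integral) auto
  have le: "(\<integral>\<^sup>+x. ennreal ((avg h u x)\<^sup>2) \<partial>lborel) \<le> ennreal (\<integral>x. (u x)\<^sup>2 \<partial>lborel)"
    using nn_integral_avg_square_le[OF assms(1)] fin by simp
  show 1: "integrable lborel (\<lambda>x. (avg h u x)\<^sup>2)"
    using le by (intro integrableI_bounded) (auto intro: le_less_trans)
  have "ennreal (\<integral>x. (avg h u x)\<^sup>2 \<partial>lborel) \<le> ennreal (\<integral>x. (u x)\<^sup>2 \<partial>lborel)"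
    using le 1 by (subst (asm) nn_integral_eq_integral) auto
  then show "(\<integral>x. (avg h u x)\<^sup>2 \<partial>lborel) \<le> (\<integral>x. (u x)\<^sup>2 \<partial>lborel)"
    by (simp add: ennreal_le_iff)
qed

lemma integral_deriv_eq_0:
  fixes F :: "real \<Rightarrow> real"
  assumes "\<And>x. (F has_real_derivative F' x) (at x)" "continuous_on UNIV F'"
    "integrable lborel F'" "(F \<longlongrightarrow> l) at_bot" "(F \<longlongrightarrow> l) at_top"
  shows "(\<integral>x. F' x \<partial>lborel) = 0"
proof -
  have "(LBINT x=-\<infinity>..\<infinity>. F' x) = l - l"
  proof (rule interval_integral_FTC_integrable[where F=F])
    show "((F \<circ> real_of_ereal) \<longlongrightarrow> l) (at_right (- \<infinity>))"
      using assms(4) by (simp add: ereal_tendsto_simps)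
    show "((F \<circ> real_of_ereal) \<longlongrightarrow> l) (at_left \<infinity>)"
      using assms(5) by (simp add: ereal_tendsto_simps)
    show "set_integrable lborel (einterval (- \<infinity>) \<infinity>) F'"
      using assms(3) by (simp add: set_integrable_def)
  qed (use assms in \<open>auto simp: has_real_derivative_iff_has_vector_derivative continuous_on_eq_continuous_at\<close>)
  then show ?thesis
    by (simp add: interval_lebesgue_integral_def set_lebesgue_integral_def)
qed

text \<open>Cauchy-Schwarz: the increment is \<open>z\<close> times an average of \<open>r'\<close>
  over a segment of length \<open>\<bar>z\<bar>\<close>, and the square of that average is at most
  the square integral divided by \<open>\<bar>z\<bar>\<close>.\<close>

lemma holder_of_deriv_square_integrable:
  assumes r: "\<And>x. (r has_real_derivative r' x) (at x)" "continuous_on UNIV r'" "bounded_borel r'"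
    and r2: "integrable lborel (\<lambda>x. (r' x)\<^sup>2)" "(\<integral>x. (r' x)\<^sup>2 \<partial>lborel) \<le> C\<^sup>2" and "C \<ge> 0"
  shows "\<bar>r x - r y\<bar> \<le> C * sqrt \<bar>x - y\<bar>"
proof (cases "x = y")
  case False
  define z where "z = x - y"
  have z: "z \<noteq> 0" using False by (simp add: z_def)
  have [measurable]: "r' \<in> borel_measurable borel" using r(3) by (rule bounded_borel_measurable)
  have "(avg z r' y)\<^sup>2 \<le> (\<integral>t. (r' (y + z * t))\<^sup>2 \<partial>unif01)"
    using unif01.variance_positive[of "\<lambda>t. r' (y + z * t)"]
    by (subst (asm) unif01.variance_eq)
      (auto simp: avg_def intro!: integrable_unif01 r bounded_borel_intros
        integrable_unif01[of "\<lambda>y. (r' y)\<^sup>2"])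
  also have "\<dots> = (\<integral>t. (r' (y + z * t))\<^sup>2 * indicator {0..1} t \<partial>lborel)"
    by (rule integral_unif01) measurable
  also have "\<dots> \<le> (\<integral>t. (r' (y + z * t))\<^sup>2 \<partial>lborel)"
    using lborel_integrable_real_affine[OF r2(1) z, of y]
    by (intro integral_mono integrable_real_mult_indicator) (auto simp: indicator_def)
  also have "\<dots> = (\<integral>x. (r' x)\<^sup>2 \<partial>lborel) / \<bar>z\<bar>"
    using lborel_integral_real_affine[OF z, of "\<lambda>x. (r' x)\<^sup>2" y] z by (simp add: field_simps)
  also have "\<dots> \<le> C\<^sup>2 / \<bar>z\<bar>" using r2 by (intro divide_right_mono) auto
  finally have a: "(avg z r' y)\<^sup>2 \<le> C\<^sup>2 / \<bar>z\<bar>" .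
  have "r x - r y = z * avg z r' y"
    using dq_eq_avg_deriv[OF r(1,2) z, of y] z by (simp add: dq_def z_def field_simps)
  then have "(r x - r y)\<^sup>2 \<le> z\<^sup>2 * (C\<^sup>2 / \<bar>z\<bar>)"
    using mult_left_mono[OF a, of "z\<^sup>2"] by (simp add: power_mult_distrib)
  also have "\<dots> = (C * sqrt \<bar>z\<bar>)\<^sup>2"
    using z by (simp add: power_mult_distrib) (simp add: power2_eq_square abs_if)
  finally show ?thesis
    using \<open>C \<ge> 0\<close> by (simp add: z_def abs_le_square_iff[symmetric])
qed auto


subsection \<open>Second differences and the jump operator\<close>

text \<open>Pairing the jumps \<open>z\<close> and \<open>- z\<close> cancels the first-order term,
  so for bounded second derivatives a principal value becomes an absolutely convergent
  integral.\<close>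

definition dd :: "(real \<Rightarrow> real) \<Rightarrow> real \<Rightarrow> real \<Rightarrow> real" where
  "dd q z x = q (x + z) + q (x - z) - 2 * q x"

abbreviation far :: "real \<Rightarrow> real set" where "far \<delta> \<equiv> {z. \<bar>z\<bar> \<ge> \<delta>}"

abbreviation near :: "real \<Rightarrow> real set" where "near \<delta> \<equiv> {z. \<bar>z\<bar> < \<delta>}"

text \<open>The weight of Levy measures. It matches the size of second differences of a bounded
  function with bounded second derivative, and lies below the weight
  \<open>min \<bar>z\<bar> (z^2)\<close> of the hypothesis.\<close>

definition kern :: "real \<Rightarrow> real" where "kern z = min 1 (z\<^sup>2)"

lemma kern_nonneg[simp]: "0 \<le> kern z" and kern_le_1: "kern z \<le> 1" and kern_le_square: "kern z \<le> z\<^sup>2"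
  by (auto simp: kern_def)

lemma borel_measurable_kern[measurable]: "kern \<in> borel_measurable borel"
  unfolding kern_def by measurable

lemma kern_ge: "\<delta> > 0 \<Longrightarrow> \<bar>z\<bar> \<ge> \<delta> \<Longrightarrow> min 1 (\<delta>\<^sup>2) \<le> kern z"
  using power_mono[of \<delta> "\<bar>z\<bar>" 2] by (auto simp: kern_def)

lemma borel_measurable_dd[measurable]:
  assumes [measurable]: "q \<in> borel_measurable borel"
  shows "dd q z \<in> borel_measurable borel" "(\<lambda>z. dd q z x) \<in> borel_measurable borel"
    "(\<lambda>(x, z). dd q z x) \<in> borel_measurable (borel \<Otimes>\<^sub>M borel)"
  unfolding dd_def[abs_def] by measurable

lemma bounded_borel_dd: "bounded_borel q \<Longrightarrow> bounded_borel (dd q z)"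
  unfolding dd_def[abs_def] by (intro bounded_borel_intros)

lemma dd_abs_le: "(\<And>x. \<bar>q x\<bar> \<le> C) \<Longrightarrow> \<bar>dd q z x\<bar> \<le> 4 * C"
  unfolding dd_def by (smt (verit, ccfv_SIG))

text \<open>A second difference is a difference quotient of a difference quotient based at
  \<open>x - z\<close>, and each quotient averages a derivative. Unlike a mean value point, this
  form can be integrated in \<open>x\<close>.\<close>

lemma dd_eq_avg:
  assumes q: "\<And>x. (q has_real_derivative q' x) (at x)"
    and q': "\<And>x. (q' has_real_derivative q'' x) (at x)" "continuous_on UNIV q''"
  shows "dd q z x = z\<^sup>2 * avg z (avg z q'') (x - z)"
proof (cases "z = 0")
  case False
  have c': "continuous_on UNIV q'"
    using q'(1) by (intro DERIV_continuous_on) (auto intro: has_field_derivative_at_within)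
  have 1: "avg z q'' = dq z q'" using dq_eq_avg_deriv[OF q' False] by auto
  have der: "(dq z q has_real_derivative dq z q' y) (at y)" for y
    unfolding dq_def using False
    by (auto intro!: derivative_eq_intros q DERIV_chain2[OF q])
  have cdq: "continuous_on UNIV (dq z q')"
    unfolding dq_def[abs_def] using False
    by (intro continuous_intros continuous_on_compose2[OF c']) auto
  have "avg z (avg z q'') (x - z) = dq z (dq z q) (x - z)"
    unfolding 1 by (rule dq_eq_avg_deriv[OF der cdq False, symmetric])
  also have "\<dots> = dd q z x / z\<^sup>2"
    by (simp add: dq_def dd_def power2_eq_square diff_divide_distrib add_divide_distrib)
  finally show ?thesis using False by simp
qed (simp add: dd_def)

lemma dd_avg:
  assumes "bounded_borel q" shows "avg h (dd q z) x = dd (avg h q) z x"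
proof -
  have "avg h (dd q z) x = avg h (\<lambda>x. q (x + z)) x + avg h (\<lambda>x. q (x - z)) x - avg h (\<lambda>x. 2 * q x) x"
    unfolding dd_def[abs_def]
    by (subst avg_diff, intro bounded_borel_intros assms, intro bounded_borel_intros assms,
      subst avg_add, auto intro!: bounded_borel_intros assms)
  then show ?thesis by (simp add: dd_def avg_shift avg_shift_diff avg_cmult)
qed

text \<open>Second differences are symmetric and differentiation is antisymmetric, so the pairing
  vanishes. The derivative of \<open>F\<close> turns into \<open>q' x * dd q z x\<close> once one
  term is translated by \<open>z\<close>; subtracting the square lets \<open>F\<close> vanish at
  both ends even when the limits \<open>l1\<close> and \<open>l2\<close> of \<open>q\<close>
  differ.\<close>

lemma dd_deriv_orthogonal:
  assumes q: "\<And>x. (q has_real_derivative q' x) (at x)" "continuous_on UNIV q'"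
    and b: "bounded_borel q" "bounded_borel q'" "integrable lborel q'"
    and lim: "(q \<longlongrightarrow> l1) at_bot" "(q \<longlongrightarrow> l2) at_top"
  shows "(\<integral>x. q' x * dd q z x \<partial>lborel) = 0"
proof -
  define F where "F = (\<lambda>x. q x * q (x + z) - (q x)\<^sup>2)"
  define F' where "F' = (\<lambda>x. q' x * q (x + z) + q' (x + z) * q x - 2 * (q' x * q x))"
  have cq: "continuous_on UNIV q"
    using q(1) by (intro DERIV_continuous_on) (auto intro: has_field_derivative_at_within)
  have 1: "integrable lborel (\<lambda>x. q' x * q (x + z))" and 2: "integrable lborel (\<lambda>x. q' (x + z) * q x)"
    and 3: "integrable lborel (\<lambda>x. q' x * q x)" and 4: "integrable lborel (\<lambda>x. q' x * q (x - z))"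
    by (auto intro!: integrable_mult_bounded_borel bounded_borel_intros b integrable_shift)
  have lz: "((\<lambda>x. q (x + z)) \<longlongrightarrow> l1) at_bot" "((\<lambda>x. q (x + z)) \<longlongrightarrow> l2) at_top"
    by (rule filterlim_compose[OF lim(1) filterlim_shift(1)] filterlim_compose[OF lim(2) filterlim_shift(2)])+
  have "(\<integral>x. F' x \<partial>lborel) = 0"
  proof (rule integral_deriv_eq_0[where F=F and l=0])
    show "(F has_real_derivative F' x) (at x)" for x
      unfolding F_def F'_def
      by (auto intro!: derivative_eq_intros q DERIV_chain2[OF q(1)] simp: power2_eq_square algebra_simps)
    show "continuous_on UNIV F'"
      unfolding F'_def by (intro continuous_intros q cq continuous_on_compose2[OF q(2)] continuous_on_compose2[OF cq]) auto
    show "integrable lborel F'" unfolding F'_def using 1 2 3 by auto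
    have "(F \<longlongrightarrow> l1 * l1 - l1\<^sup>2) at_bot" unfolding F_def by (intro tendsto_intros lim lz)
    then show "(F \<longlongrightarrow> 0) at_bot" by (simp add: power2_eq_square)
    have "(F \<longlongrightarrow> l2 * l2 - l2\<^sup>2) at_top" unfolding F_def by (intro tendsto_intros lim lz)
    then show "(F \<longlongrightarrow> 0) at_top" by (simp add: power2_eq_square)
  qed
  then have "(\<integral>x. q' x * q (x + z) \<partial>lborel) + (\<integral>x. q' (x + z) * q x \<partial>lborel) - 2 * (\<integral>x. q' x * q x \<partial>lborel) = 0"
    unfolding F'_def using 1 2 3 by simp
  moreover have "(\<integral>x. q' (x + z) * q x \<partial>lborel) = (\<integral>x. q' x * q (x - z) \<partial>lborel)"
    using integral_shift[of "\<lambda>x. q' x * q (x - z)" z] by simp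
  moreover have "(\<integral>x. q' x * dd q z x \<partial>lborel) = (\<integral>x. q' x * q (x + z) + q' x * q (x - z) - 2 * (q' x * q x) \<partial>lborel)"
    by (simp add: dd_def algebra_simps)
  ultimately show ?thesis using 1 4 3 by simp
qed

text \<open>On the Fourier side \<open>dd\<close> multiplies by \<open>2 * cos (z * t) - 2\<close>,
  which is nonpositive, so two such factors form a nonnegative quadratic form. Without transforms:
  expanding in the autocorrelation \<open>c\<close> of \<open>p\<close> identifies the integral with
  the squared norm of the mixed difference \<open>r\<close>.\<close>

lemma integral_dd_mult_dd_nonneg:
  assumes b: "bounded_borel p" "integrable lborel p"
  shows "0 \<le> (\<integral>x. dd p y x * dd p z x \<partial>lborel)"
proof -
  define c where "c s = (\<integral>x. p x * p (x + s) \<partial>lborel)" for s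
  have i: "integrable lborel (\<lambda>x. p (x + s) * p (x + t))" for s t
    by (auto intro!: integrable_mult_bounded_borel bounded_borel_intros b integrable_shift)
  have c: "(\<integral>x. p (x + s) * p (x + t) \<partial>lborel) = c (t - s)" for s t
    using integral_shift[of "\<lambda>x. p x * p (x + (t - s))" s] by (simp add: c_def algebra_simps)
  have c_sym: "c (- s) = c s" for s
    using c[of s 0] c[of 0 s] by (simp add: mult.commute)
  have cc: "c (y - z) = c (z - y)" "c (- y - z) = c (y + z)" "c (- z - y) = c (y + z)"
    "c (z + y) = c (y + z)" "c (- z + y) = c (z - y)" "c (- y + z) = c (z - y)"
  proof -
    have "- y - z = - (y + z)" "- z - y = - (y + z)" "- z + y = - (z - y)" "- y + z = z - y" "y - z = - (z - y)" "z + y = y + z"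
      by simp_all
    then show "c (y - z) = c (z - y)" "c (- y - z) = c (y + z)" "c (- z - y) = c (y + z)"
      "c (z + y) = c (y + z)" "c (- z + y) = c (z - y)" "c (- y + z) = c (z - y)"
      by (simp_all only: c_sym)
  qed
  define r where "r x = p (x + (y + z)) - p (x + y) - p (x + z) + p (x + 0)" for x
  have "(\<integral>x. dd p y x * dd p z x \<partial>lborel) = (\<integral>x. 
      p (x + y) * p (x + z) + p (x + y) * p (x + - z) - 2 * (p (x + y) * p (x + 0))
      + p (x + - y) * p (x + z) + p (x + - y) * p (x + - z) - 2 * (p (x + - y) * p (x + 0))
      - 2 * (p (x + 0) * p (x + z)) - 2 * (p (x + 0) * p (x + - z)) + 4 * (p (x + 0) * p (x + 0)) \<partial>lborel)"
    by (intro Bochner_Integration.integral_cong) (auto simp: dd_def algebra_simps)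
  also have "\<dots> = 2 * c (z - y) + 2 * c (y + z) - 4 * c y - 4 * c z + 4 * c 0"
    by (simp add: i c cc c_sym del: add_0_right minus_add_distrib add_uminus_conv_diff)
  also have "\<dots> = (\<integral>x. 
      p (x + (y + z)) * p (x + (y + z)) + p (x + y) * p (x + y) + p (x + z) * p (x + z) + p (x + 0) * p (x + 0)
      - 2 * (p (x + y) * p (x + (y + z))) - 2 * (p (x + z) * p (x + (y + z))) + 2 * (p (x + 0) * p (x + (y + z)))
      + 2 * (p (x + y) * p (x + z)) - 2 * (p (x + 0) * p (x + y)) - 2 * (p (x + 0) * p (x + z)) \<partial>lborel)"
    by (simp add: i c cc c_sym del: add_0_right minus_add_distrib)
  also have "\<dots> = (\<integral>x. (r x)\<^sup>2 \<partial>lborel)"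
    by (intro Bochner_Integration.integral_cong) (auto simp: r_def power2_eq_square algebra_simps)
  also have "\<dots> \<ge> 0" by simp
  finally show ?thesis .
qed

section \<open>Jump operators restricted to a set of jumps\<close>

locale jump_measure =
  fixes N :: "real measure"
  assumes sets_N[simp, measurable_cong]: "sets N = sets borel"
    and emeasure_N_0: "emeasure N {0} = 0"
    and nn_integral_kern: "(\<integral>\<^sup>+z. ennreal (kern z) \<partial>N) < \<infinity>"
begin

lemma space_N[simp]: "space N = UNIV"
  using sets_eq_imp_space_eq[OF sets_N] by simp

lemma integrable_kern: "integrable N kern"
  using nn_integral_kern by (intro integrableI_bounded) (auto simp: )

lemma AE_N_nonzero: "AE z in N. z \<noteq> 0"
  using emeasure_N_0 by (intro AE_I[of _ _ "{0}"]) auto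

lemma emeasure_far:
  assumes "\<delta> > 0" shows "emeasure N (far \<delta>) < \<infinity>"
proof -
  define e where "e = min 1 (\<delta>\<^sup>2)"
  have e: "e > 0" using assms by (simp add: e_def)
  have "ennreal e * emeasure N (far \<delta>) = (\<integral>\<^sup>+z. ennreal e * indicator (far \<delta>) z \<partial>N)"
    by (subst nn_integral_cmult_indicator) auto
  also have "\<dots> \<le> (\<integral>\<^sup>+z. ennreal (kern z) \<partial>N)"
    using kern_ge[OF assms] by (intro nn_integral_mono) (auto simp: indicator_def e_def intro!: ennreal_leI)
  also have "\<dots> < \<infinity>" by (rule nn_integral_kern)
  finally show ?thesis using e by (auto simp: ennreal_mult_less_top)
qed

lemma sigma_finite_N: "sigma_finite_measure N"
proof
  define A where "A = insert {0} (range (\<lambda>n. (far (inverse (real (Suc n))))))"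
  have "\<Union>A = UNIV"
  proof -
    have "\<exists>n. inverse (real (Suc n)) \<le> \<bar>z\<bar>" if "z \<noteq> 0" for z :: real
      using reals_Archimedean[of "\<bar>z\<bar>"] that by (meson less_imp_le zero_less_abs_iff)
    then show ?thesis by (auto simp: A_def)
  qed
  moreover have "\<forall>a\<in>A. emeasure N a \<noteq> \<infinity>"
    using emeasure_far emeasure_N_0 by (auto simp: A_def less_top[symmetric] simp del: of_nat_Suc)
  moreover have "A \<subseteq> sets N" by (auto simp: A_def)
  ultimately show "\<exists>A. countable A \<and> A \<subseteq> sets N \<and> \<Union> A = space N \<and> (\<forall>a\<in>A. emeasure N a \<noteq> \<infinity>)"
    by (intro exI[of _ A]) (auto simp: A_def)
qed

text \<open>For symmetric \<open>N\<close> this is the integral of plain increments over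
  \<open>far \<delta>\<close>, see \<open>symmetric_truncation\<close>. The set of jumps is a
  parameter because near and far jumps are estimated separately.\<close>

definition J :: "real set \<Rightarrow> (real \<Rightarrow> real) \<Rightarrow> real \<Rightarrow> real" where
  "J S q x = (\<integral>z. indicator S z * dd q z x \<partial>N) / 2"

text \<open>Domination by \<open>kern\<close>, uniform in the base point: the standing hypothesis
  under which \<open>J S q\<close> converges absolutely, is bounded and admits Fubini. For far jumps
  it follows from boundedness of \<open>q\<close>, in general from a bounded second
  derivative.\<close>

definition ddb :: "real set \<Rightarrow> real \<Rightarrow> (real \<Rightarrow> real) \<Rightarrow> bool" where
  "ddb S C q \<longleftrightarrow> S \<in> sets borel \<and> bounded_borel q \<and> 0 \<le> C \<and> (\<forall>z\<in>S. \<forall>x. \<bar>dd q z x\<bar> \<le> C * kern z)"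

lemma ddb_bounded_borel: "ddb S C q \<Longrightarrow> bounded_borel q"
  by (simp add: ddb_def)

lemma ddbD: "ddb S C q \<Longrightarrow> \<bar>indicator S z * dd q z x\<bar> \<le> C * kern z"
  by (auto simp: ddb_def indicator_def)

lemma ddb_subset: "ddb S C q \<Longrightarrow> T \<subseteq> S \<Longrightarrow> T \<in> sets borel \<Longrightarrow> ddb T C q"
  by (auto simp: ddb_def)

lemma ddb_far:
  assumes "bounded_borel q" "\<And>x. \<bar>q x\<bar> \<le> B" "\<delta> > 0"
  shows "ddb (far \<delta>) (4 * B / min 1 (\<delta>\<^sup>2)) q"
proof -
  have B: "B \<ge> 0" using assms(2)[of 0] by linarith
  have m: "min 1 (\<delta>\<^sup>2) > 0" using assms(3) by simp
  have "\<bar>dd q z x\<bar> \<le> 4 * B / min 1 (\<delta>\<^sup>2) * kern z" if "\<bar>z\<bar> \<ge> \<delta>" for x z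
  proof -
    have "4 * B = 4 * B / min 1 (\<delta>\<^sup>2) * min 1 (\<delta>\<^sup>2)"
      using m by (simp del: min_less_iff_conj)
    also have "\<dots> \<le> 4 * B / min 1 (\<delta>\<^sup>2) * kern z"
      using B m by (intro mult_left_mono kern_ge assms that) (auto intro!: divide_nonneg_nonneg)
    finally show ?thesis using dd_abs_le[of q, OF assms(2)] by (rule order_trans[rotated])
  qed
  moreover have "(far \<delta>) \<in> sets borel" by measurable
  ultimately show ?thesis using assms B by (auto simp: ddb_def intro!: divide_nonneg_nonneg)
qed

lemma ddb_C2:
  assumes q: "\<And>x. (q has_real_derivative q' x) (at x)"
    and q': "\<And>x. (q' has_real_derivative q'' x) (at x)" "continuous_on UNIV q''"
    and b: "bounded_borel q" "\<And>x. \<bar>q x\<bar> \<le> B" "\<And>x. \<bar>q'' x\<bar> \<le> B2" and S: "S \<in> sets borel"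
  shows "ddb S (4 * B + B2) q"
proof -
  have B: "B \<ge> 0" "B2 \<ge> 0" using b(2)[of 0] b(3)[of 0] by linarith+
  have bb: "bounded_borel q''" using q'(2) b(3) by (intro bounded_borelI borel_measurable_continuous_onI)
  have "\<bar>dd q z x\<bar> \<le> (4 * B + B2) * kern z" for z x
  proof -
    have "\<bar>avg z (avg z q'') (x - z)\<bar> \<le> B2"
      by (intro avg_abs_le bounded_borel_avg bb b)
    then have "\<bar>dd q z x\<bar> \<le> z\<^sup>2 * B2"
      unfolding dd_eq_avg[OF q q'] by (auto simp: abs_mult intro!: mult_left_mono)
    moreover have "\<bar>dd q z x\<bar> \<le> 4 * B" by (rule dd_abs_le[OF b(2)])
    moreover have "z\<^sup>2 * B2 \<le> (4 * B + B2) * z\<^sup>2" "4 * B \<le> (4 * B + B2) * 1"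
      using B mult_nonneg_nonneg[of B "z\<^sup>2"] by (simp_all add: algebra_simps)
    ultimately show ?thesis
      by (auto simp: kern_def min_def)
  qed
  then show ?thesis using B b S by (auto simp: ddb_def)
qed

lemma integrable_J:
  assumes "ddb S C q" shows "integrable N (\<lambda>z. indicator S z * dd q z x)"
proof (rule Bochner_Integration.integrable_bound)
  show "integrable N (\<lambda>z. C * kern z)" using integrable_kern by simp
  have [measurable]: "S \<in> sets borel" "q \<in> borel_measurable borel"
    using assms by (auto simp: ddb_def bounded_borel_measurable)
  show "(\<lambda>z. indicator S z * dd q z x) \<in> borel_measurable N" by measurable
  show "AE z in N. norm (indicator S z * dd q z x) \<le> norm (C * kern z)"
    using order_trans[OF ddbD[OF assms] abs_ge_self] by auto
qed

lemma J_abs_le: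
  assumes "ddb S C q" shows "\<bar>J S q x\<bar> \<le> C / 2 * (\<integral>z. indicator S z * kern z \<partial>N)"
proof -
  have [measurable]: "S \<in> sets borel" using assms by (simp add: ddb_def)
  have "\<bar>\<integral>z. indicator S z * dd q z x \<partial>N\<bar> \<le> (\<integral>z. C * (indicator S z * kern z) \<partial>N)"
  proof (rule order_trans[OF integral_abs_bound], rule integral_mono)
    show "integrable N (\<lambda>z. \<bar>indicator S z * dd q z x\<bar>)" using integrable_J[OF assms] by simp
    show "integrable N (\<lambda>z. C * (indicator S z * kern z))"
      using integrable_real_mult_indicator[of S N kern] integrable_kern
      by (auto simp: mult.commute)
    show "\<bar>indicator S z * dd q z x\<bar> \<le> C * (indicator S z * kern z)" for z
      using ddbD[OF assms, of z x] by (auto simp: indicator_def)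
  qed
  then show ?thesis by (simp add: J_def)
qed

lemma borel_measurable_J[measurable]:
  assumes [measurable]: "q \<in> borel_measurable borel" "S \<in> sets borel"
  shows "J S q \<in> borel_measurable borel"
proof -
  interpret sigma_finite_measure N by (rule sigma_finite_N)
  show ?thesis unfolding J_def[abs_def] dd_def by measurable
qed

lemma bounded_borel_J: "ddb S C q \<Longrightarrow> bounded_borel (J S q)"
  by (rule bounded_borelI[OF borel_measurable_J J_abs_le])
    (auto simp: ddb_def bounded_borel_measurable)

lemma J_Un:
  assumes "ddb (S \<union> T) C q" "S \<inter> T = {}" "S \<in> sets borel" "T \<in> sets borel"
  shows "J (S \<union> T) q x = J S q x + J T q x"
proof -
  have "(\<integral>z. indicator (S \<union> T) z * dd q z x \<partial>N) = (\<integral>z. indicator S z * dd q z x + indicator T z * dd q z x \<partial>N)"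
    using assms(2) by (intro Bochner_Integration.integral_cong) (auto simp: indicator_def)
  also have "\<dots> = (\<integral>z. indicator S z * dd q z x \<partial>N) + (\<integral>z. indicator T z * dd q z x \<partial>N)"
    using assms by (intro Bochner_Integration.integral_add integrable_J[of _ C]) (auto intro: ddb_subset)
  finally show ?thesis by (simp add: J_def)
qed

lemma J_shift: "J S (\<lambda>x. q (x + a)) x = J S q (x + a)"
  unfolding J_def dd_def by (simp add: algebra_simps)

lemma J_dq:
  assumes "ddb S C q" shows "J S (dq h q) x = dq h (J S q) x"
proof -
  have "J S (dq h q) x = (\<integral>z. (indicator S z * dd q z (x + h) - indicator S z * dd q z x) / h \<partial>N) / 2"
    unfolding J_def by (intro arg_cong2[where f="(/)"] Bochner_Integration.integral_cong)
      (auto simp: dq_def dd_def indicator_def algebra_simps diff_divide_distrib add_divide_distrib)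
  also have "\<dots> = dq h (J S q) x"
    using integrable_J[OF assms] by (simp add: J_def dq_def diff_divide_distrib)
  finally show ?thesis .
qed

lemma integrable_product_bound:
  assumes "sigma_finite_measure M" and [measurable]: "\<phi> \<in> borel_measurable M"
    and b: "integrable M b" and q: "ddb S C q"
  shows "integrable (M \<Otimes>\<^sub>M N) (\<lambda>(y, z). b y * (indicator S z * dd q z (\<phi> y)))"
proof -
  interpret M: sigma_finite_measure M by fact
  interpret N: sigma_finite_measure N by (rule sigma_finite_N)
  interpret P: pair_sigma_finite M N ..
  have [measurable]: "S \<in> sets borel" "q \<in> borel_measurable borel" "b \<in> borel_measurable M"
    using q b by (auto simp: ddb_def bounded_borel_measurable)
  have meas: "(\<lambda>(y, z). b y * (indicator S z * dd q z (\<phi> y))) \<in> borel_measurable (M \<Otimes>\<^sub>M N)"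
    unfolding dd_def by measurable
  have 1: "integrable (M \<Otimes>\<^sub>M N) (\<lambda>(y, z). \<bar>b y\<bar> * (C * kern z))"
  proof (rule P.Fubini_integrable)
    show "integrable M (\<lambda>x. \<integral>y. norm (case (x, y) of (y, z) \<Rightarrow> \<bar>b y\<bar> * (C * kern z)) \<partial>N)"
      using b by (simp add: abs_mult)
    show "AE x in M. integrable N (\<lambda>y. case (x, y) of (y, z) \<Rightarrow> \<bar>b y\<bar> * (C * kern z))"
      using integrable_kern by simp
  qed measurable
  show ?thesis
  proof (rule Bochner_Integration.integrable_bound[OF 1 meas], rule AE_I2)
    fix w assume "w \<in> space (M \<Otimes>\<^sub>M N)"
    obtain y z where w: "w = (y, z)" by (cases w)
    have "\<bar>b y\<bar> * \<bar>indicator S z * dd q z (\<phi> y)\<bar> \<le> \<bar>b y\<bar> * (C * kern z)"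
      by (intro mult_left_mono ddbD[OF q]) simp
    then show "norm (case w of (y, z) \<Rightarrow> b y * (indicator S z * dd q z (\<phi> y)))
        \<le> norm (case w of (y, z) \<Rightarrow> \<bar>b y\<bar> * (C * kern z))"
      unfolding w using abs_ge_self[of "\<bar>b y\<bar> * (C * kern z)"]
      by (simp only: prod.case real_norm_def abs_mult[of "b y"])
  qed
qed

text \<open>One use of Fubini for two purposes: Lebesgue measure with the identity gives
  \<open>L^2\<close> pairings, and \<open>unif01\<close> with \<open>t \<mapsto> x + h * t\<close>
  gives commutation with averages.\<close>

lemma integral_mult_J:
  assumes "sigma_finite_measure M" and [measurable]: "\<phi> \<in> borel_measurable M"
    and b: "integrable M b" and q: "ddb S C q"
  shows "(\<integral>y. b y * J S q (\<phi> y) \<partial>M) = (\<integral>z. indicator S z * (\<integral>y. b y * dd q z (\<phi> y) \<partial>M) \<partial>N) / 2"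
proof -
  interpret M: sigma_finite_measure M by fact
  interpret N: sigma_finite_measure N by (rule sigma_finite_N)
  interpret P: pair_sigma_finite M N ..
  have F: "(\<integral>z. (\<integral>y. b y * (indicator S z * dd q z (\<phi> y)) \<partial>M) \<partial>N)
      = (\<integral>y. (\<integral>z. b y * (indicator S z * dd q z (\<phi> y)) \<partial>N) \<partial>M)"
    by (rule P.Fubini_integral) (rule integrable_product_bound[OF assms])
  have "(\<integral>y. b y * J S q (\<phi> y) \<partial>M) = (\<integral>y. (\<integral>z. b y * (indicator S z * dd q z (\<phi> y)) \<partial>N) \<partial>M) / 2"
    by (simp add: J_def)
  also have "\<dots> = (\<integral>z. (\<integral>y. b y * (indicator S z * dd q z (\<phi> y)) \<partial>M) \<partial>N) / 2"
    by (simp only: F)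
  also have "\<dots> = (\<integral>z. (\<integral>y. indicator S z * (b y * dd q z (\<phi> y)) \<partial>M) \<partial>N) / 2"
    by (simp only: mult.left_commute)
  finally show ?thesis by (simp only: integral_mult_right_zero)
qed

lemma avg_J:
  assumes "ddb S C q" shows "avg h (J S q) x = J S (avg h q) x"
proof -
  have [measurable]: "(\<lambda>t. x + h * t) \<in> borel_measurable unif01" by measurable
  have "(\<integral>t. 1 * J S q (x + h * t) \<partial>unif01) = (\<integral>z. indicator S z * (\<integral>t. 1 * dd q z (x + h * t) \<partial>unif01) \<partial>N) / 2"
    by (rule integral_mult_J[OF unif01.sigma_finite_measure_axioms _ _ assms]) simp_all
  then have "avg h (J S q) x = (\<integral>z. indicator S z * avg h (dd q z) x \<partial>N) / 2"
    by (simp only: avg_def mult_1)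
  then show ?thesis
    by (simp only: dd_avg[OF ddb_bounded_borel[OF assms]] J_def)
qed

lemma ddb_avg:
  assumes "ddb S C q" shows "ddb S C (avg h q)"
proof -
  have b: "bounded_borel q" using assms by (rule ddb_bounded_borel)
  have "\<bar>dd (avg h q) z x\<bar> \<le> C * kern z" if "z \<in> S" for z x
    unfolding dd_avg[OF b, symmetric] 
    using assms that by (intro avg_abs_le bounded_borel_dd b) (simp add: ddb_def)
  then show ?thesis using assms bounded_borel_avg[OF b] by (simp add: ddb_def)
qed

text \<open>Dominated convergence. The bound refers to base points in \<open>K\<close>, so the lemma
  also covers the supersolution, whose second derivative is controlled on compact sets.\<close>

lemma continuous_on_J:
  assumes q: "continuous_on UNIV q" and S: "S \<in> sets borel"
    and "0 \<le> C" and K: "\<And>x z. x \<in> K \<Longrightarrow> z \<in> S \<Longrightarrow> \<bar>dd q z x\<bar> \<le> C * kern z"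
  shows "continuous_on K (J S q)"
  unfolding continuous_on_sequentially
proof safe
  fix X a assume X: "\<forall>n. X n \<in> K" "a \<in> K" "X \<longlonglongrightarrow> a"
  have [measurable]: "q \<in> borel_measurable borel" "S \<in> sets borel"
    using q S by (auto intro: borel_measurable_continuous_onI)
  have iso: "isCont q y" for y using q by (simp add: continuous_on_eq_continuous_at)
  have "(\<lambda>n. \<integral>z. indicator S z * dd q z (X n) \<partial>N) \<longlonglongrightarrow> (\<integral>z. indicator S z * dd q z a \<partial>N)"
  proof (rule integral_dominated_convergence)
    show "integrable N (\<lambda>z. C * kern z)" using integrable_kern by simp
    show "AE z in N. (\<lambda>n. indicator S z * dd q z (X n)) \<longlonglongrightarrow> indicator S z * dd q z a"
      unfolding dd_def
      by (intro AE_I2 tendsto_intros isCont_tendsto_compose[OF iso] X)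
    show "AE z in N. norm (indicator S z * dd q z (X n)) \<le> C * kern z" for n
    proof (rule AE_I2)
      fix z
      show "norm (indicator S z * dd q z (X n)) \<le> C * kern z"
        using K[of "X n" z] X(1) \<open>0 \<le> C\<close> by (auto simp: indicator_def)
    qed
  qed measurable
  then show "(J S q \<circ> X) \<longlonglongrightarrow> J S q a"
    unfolding J_def comp_def by (intro tendsto_intros) simp_all
qed

lemma J_deriv_orthogonal:
  assumes q: "\<And>x. (q has_real_derivative q' x) (at x)" "continuous_on UNIV q'"
    and b: "bounded_borel q'" "integrable lborel q'"
    and lim: "(q \<longlongrightarrow> l1) at_bot" "(q \<longlongrightarrow> l2) at_top"
    and d: "ddb S C q"
  shows "(\<integral>x. q' x * J S q x \<partial>lborel) = 0"
  using integral_mult_J[OF lborel.sigma_finite_measure_axioms _ b(2) d, of "\<lambda>x. x"]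
    dd_deriv_orthogonal[OF q ddb_bounded_borel[OF d] b lim] by simp

text \<open>Fubini in \<open>(z, x)\<close>: the \<open>L^1\<close> norms of the second differences
  are dominated by \<open>kern\<close> and hence integrable in \<open>z\<close>. This lets
  \<open>J S p\<close> be paired with any bounded function.\<close>

lemma integrable_J_lborel:
  assumes p: "bounded_borel p" "integrable lborel p" "ddb S C p"
    and L1: "\<And>z. (\<integral>x. \<bar>dd p z x\<bar> \<partial>lborel) \<le> D * kern z"
  shows "integrable lborel (J S p)"
proof -
  interpret N: sigma_finite_measure N by (rule sigma_finite_N)
  interpret P: pair_sigma_finite N lborel ..
  interpret Q: pair_sigma_finite lborel N ..
  have [measurable]: "S \<in> sets borel" "p \<in> borel_measurable borel"
    using p by (auto simp: ddb_def bounded_borel_measurable)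
  have i: "integrable lborel (dd p z)" for z
    unfolding dd_def[abs_def] using integrable_shift[OF p(2), of z] integrable_shift[OF p(2), of "-z"] p(2) by simp
  have 1: "integrable (N \<Otimes>\<^sub>M lborel) (\<lambda>(z, x). indicator S z * dd p z x)"
  proof (rule P.Fubini_integrable)
    show "(\<lambda>(z, x). indicator S z * dd p z x) \<in> borel_measurable (N \<Otimes>\<^sub>M lborel)"
      unfolding dd_def by measurable
    show "integrable N (\<lambda>z. \<integral>x. norm (case (z, x) of (z, x) \<Rightarrow> indicator S z * dd p z x) \<partial>lborel)"
    proof (rule Bochner_Integration.integrable_bound)
      show "integrable N (\<lambda>z. D * kern z)" using integrable_kern by simp
      show "(\<lambda>z. \<integral>x. norm (case (z, x) of (z, x) \<Rightarrow> indicator S z * dd p z x) \<partial>lborel) \<in> borel_measurable N"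
        unfolding dd_def by measurable
      show "AE z in N. norm (\<integral>x. norm (case (z, x) of (z, x) \<Rightarrow> indicator S z * dd p z x) \<partial>lborel) \<le> norm (D * kern z)"
      proof (rule AE_I2)
        fix z
        have "0 \<le> (\<integral>x. \<bar>dd p z x\<bar> \<partial>lborel)" by simp
        then show "norm (\<integral>x. norm (case (z, x) of (z, x) \<Rightarrow> indicator S z * dd p z x) \<partial>lborel) \<le> norm (D * kern z)"
          using L1[of z] by (auto simp: indicator_def intro: order_trans[OF _ abs_ge_self])
      qed
    qed
    show "AE z in N. integrable lborel (\<lambda>x. case (z, x) of (z, x) \<Rightarrow> indicator S z * dd p z x)"
      using i by simp
  qed
  have "integrable (lborel \<Otimes>\<^sub>M N) (\<lambda>(x, z). indicator S z * dd p z x)"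
    using P.integrable_product_swap[OF 1] by (simp add: case_prod_beta')
  from Q.integrable_fst'[OF this] show ?thesis unfolding J_def[abs_def] by simp
qed

text \<open>\<open>integral_dd_mult_dd_nonneg\<close> integrated over both jump sizes. It implies
  that discarding part of the jumps cannot increase the \<open>L^2\<close> norm of
  \<open>J\<close>.\<close>

lemma J_cross_nonneg:
  assumes p: "bounded_borel p" "integrable lborel p" "ddb S C p" "ddb T C p"
    and L1: "\<And>z. (\<integral>x. \<bar>dd p z x\<bar> \<partial>lborel) \<le> D * kern z"
  shows "0 \<le> (\<integral>x. J S p x * J T p x \<partial>lborel)"
proof -
  have i: "integrable lborel (dd p z)" for z
    unfolding dd_def[abs_def] using integrable_shift[OF p(2), of z] integrable_shift[OF p(2), of "-z"] p(2) by simp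
  have "(\<integral>x. dd p y x * J S p x \<partial>lborel) \<ge> 0" for y
  proof -
    have "0 \<le> (\<integral>z. indicator S z * (\<integral>x. dd p y x * dd p z x \<partial>lborel) \<partial>N)"
      by (rule Bochner_Integration.integral_nonneg) (simp add: integral_dd_mult_dd_nonneg[OF p(1,2)])
    then show ?thesis
      by (subst integral_mult_J[OF lborel.sigma_finite_measure_axioms _ i p(3), of "\<lambda>x. x"]) simp_all
  qed
  then have "(\<integral>z. indicator T z * (\<integral>x. J S p x * dd p z x \<partial>lborel) \<partial>N) \<ge> 0"
    by (intro Bochner_Integration.integral_nonneg) (simp add: mult.commute)
  then show ?thesis
    using integral_mult_J[OF lborel.sigma_finite_measure_axioms _ integrable_J_lborel[OF p(1,2,3) L1] p(4), of "\<lambda>x. x"]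
    by simp
qed

definition small_mass :: "real \<Rightarrow> real" where
  "small_mass \<delta> = (\<integral>z. indicator (near \<delta>) z * kern z \<partial>N)"

lemma small_mass_tendsto: "(small_mass \<longlongrightarrow> 0) (at_right 0)"
proof -
  have "(small_mass \<longlongrightarrow> (\<integral>z. 0 \<partial>N)) (at_right 0)"
    unfolding tendsto_at_iff_sequentially comp_def
  proof safe
    fix X :: "nat \<Rightarrow> real" assume X: "\<forall>i. X i \<in> {0<..} - {0}" "X \<longlonglongrightarrow> 0"
    show "(\<lambda>n. small_mass (X n)) \<longlonglongrightarrow> (\<integral>z. 0 \<partial>N)"
      unfolding small_mass_def
    proof (rule integral_dominated_convergence)
      show "integrable N kern" by (rule integrable_kern)
      show "AE z in N. (\<lambda>n. indicator (near (X n)) z * kern z) \<longlonglongrightarrow> 0"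
        using AE_N_nonzero
      proof eventually_elim
        case (elim z)
        then have "\<forall>\<^sub>F n in sequentially. X n < \<bar>z\<bar>" using X(2) by (intro order_tendstoD) auto
        then have "\<forall>\<^sub>F n in sequentially. indicator (near (X n)) z * kern z = 0"
          by eventually_elim simp
        then show ?case by (rule tendsto_eventually)
      qed
      show "AE z in N. norm (indicator (near (X n)) z * kern z) \<le> kern z" for n
        by (auto simp: indicator_def)
    qed measurable
  qed
  then show ?thesis by simp
qed

end

text \<open>The \<open>L^1\<close> counterpart of \<open>ddb_C2\<close>: the double average of
  \<open>q''\<close> handles jumps up to 1, the triangle inequality the longer ones.\<close>

lemma integral_abs_dd_le:
  assumes q: "\<And>x. (q has_real_derivative q' x) (at x)"
    and q': "\<And>x. (q' has_real_derivative q'' x) (at x)" "continuous_on UNIV q''"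
    and b: "bounded_borel q''" "integrable lborel q" "integrable lborel q''"
  shows "(\<integral>x. \<bar>dd q z x\<bar> \<partial>lborel) \<le> (4 * (\<integral>x. \<bar>q x\<bar> \<partial>lborel) + (\<integral>x. \<bar>q'' x\<bar> \<partial>lborel)) * kern z"
proof -
  define I where "I = (\<integral>x. \<bar>q x\<bar> \<partial>lborel)"
  define I2 where "I2 = (\<integral>x. \<bar>q'' x\<bar> \<partial>lborel)"
  have I: "I \<ge> 0" "I2 \<ge> 0" by (auto simp: I_def I2_def)
  have sh: "integrable lborel (\<lambda>x. q (x + z))" "integrable lborel (\<lambda>x. q (x - z))"
    using integrable_shift[OF b(2), of z] integrable_shift[OF b(2), of "-z"] by auto
  have "(\<integral>x. \<bar>dd q z x\<bar> \<partial>lborel) \<le> (\<integral>x. \<bar>q (x + z)\<bar> + \<bar>q (x + - z)\<bar> + 2 * \<bar>q x\<bar> \<partial>lborel)"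
    using sh b by (intro integral_mono) (auto simp: dd_def[abs_def])
  also have "\<dots> = 4 * I"
    using sh b integral_shift[of "\<lambda>x. \<bar>q x\<bar>" z] integral_shift[of "\<lambda>x. \<bar>q x\<bar>" "-z"] by (simp add: I_def)
  finally have 1: "(\<integral>x. \<bar>dd q z x\<bar> \<partial>lborel) \<le> 4 * I" .
  define a where "a = avg z (avg z q'')"
  have a: "integrable lborel a" "(\<integral>x. \<bar>a x\<bar> \<partial>lborel) \<le> I2"
    using integrable_avg[OF b(1,3)] integrable_avg[OF bounded_borel_avg[OF b(1)], of z z]
    by (auto simp: a_def I2_def intro: order_trans)
  have "(\<integral>x. \<bar>dd q z x\<bar> \<partial>lborel) = (\<integral>x. z\<^sup>2 * \<bar>a (x + - z)\<bar> \<partial>lborel)"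
    unfolding dd_eq_avg[OF q q'] by (simp add: a_def abs_mult)
  also have "\<dots> = z\<^sup>2 * (\<integral>x. \<bar>a x\<bar> \<partial>lborel)"
    using integral_shift[of "\<lambda>x. \<bar>a x\<bar>" "-z"] by simp
  also have "\<dots> \<le> z\<^sup>2 * I2" using a by (intro mult_left_mono) auto
  finally have 2: "(\<integral>x. \<bar>dd q z x\<bar> \<partial>lborel) \<le> z\<^sup>2 * I2" .
  have "(\<integral>x. \<bar>dd q z x\<bar> \<partial>lborel) \<le> (4 * I + I2) * kern z"
  proof (cases "z\<^sup>2 \<le> 1")
    case True
    then have "kern z = z\<^sup>2" by (simp add: kern_def)
    moreover have "0 \<le> I * z\<^sup>2" using I by simp
    ultimately show ?thesis using 2 by (simp add: algebra_simps)
  next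
    case False
    then have "kern z = 1" by (simp add: kern_def)
    then show ?thesis using 1 I by simp
  qed
  then show ?thesis by (simp add: I_def I2_def)
qed


subsection \<open>Mollified monotone profiles\<close>

lemma avg_antimono:
  assumes "antimono u" "bounded_borel u"
  shows "antimono (avg h u)"
proof (rule antimonoI)
  fix x y :: real assume "x \<le> y"
  then show "avg h u y \<le> avg h u x"
    unfolding avg_def using assms
    by (intro integral_mono integrable_unif01 antimonoD[OF assms(1)]) simp_all
qed

lemma avg_antimono_between:
  assumes "antimono u" "bounded_borel u" "0 \<le> h"
  shows "u (x + h) \<le> avg h u x" "avg h u x \<le> u x"
  by (rule avg_bounds_interval[where a="u (x + h)" and b="u x"]; simp add: assms antimonoD[OF assms(1)])+

lemma continuous_on_avg:
  assumes "continuous_on UNIV u" "h \<noteq> 0" shows "continuous_on UNIV (avg h u)"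
  by (rule DERIV_continuous_on[of UNIV _ "dq h u"])
    (auto intro: has_field_derivative_at_within has_real_derivative_avg[OF assms])

lemma continuous_on_dq:
  assumes "continuous_on UNIV u" shows "continuous_on UNIV (dq h u)"
proof (cases "h = 0")
  case True then show ?thesis by (simp add: dq_def[abs_def])
next
  case False then show ?thesis
    unfolding dq_def[abs_def] 
    by (intro continuous_intros continuous_on_compose2[OF assms] assms) auto
qed

text \<open>The first average provides continuity, the other two one derivative each. Moving
  \<open>dq e\<close> across an average exhibits the second derivative as a difference quotient of a
  continuous function.\<close>

lemma avg3_derivs:
  assumes "bounded_borel u" "continuous_on UNIV (avg e u)" "e \<noteq> 0"
  shows "(avg e (avg e (avg e u)) has_real_derivative avg e (avg e (dq e u)) x) (at x)"
    "(avg e (avg e (dq e u)) has_real_derivative avg e (dq e (dq e u)) x) (at x)"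
    "continuous_on UNIV (avg e (avg e (dq e u)))"
    "continuous_on UNIV (avg e (dq e (dq e u)))"
proof -
  note b = bounded_borel_avg bounded_borel_dq assms(1)
  have c1: "continuous_on UNIV (avg e (dq e u))"
    unfolding avg_dq[OF assms(1)] by (intro continuous_on_dq assms)
  show "continuous_on UNIV (avg e (avg e (dq e u)))" by (intro continuous_on_avg c1 assms)
  have "avg e (dq e (dq e u)) = dq e (avg e (dq e u))" by (intro avg_dq b)
  then show "continuous_on UNIV (avg e (dq e (dq e u)))" by (simp add: continuous_on_dq c1)
  have "avg e (avg e (dq e u)) = dq e (avg e (avg e u))" by (simp add: avg_dq b)
  then show "(avg e (avg e (avg e u)) has_real_derivative avg e (avg e (dq e u)) x) (at x)"
    using has_real_derivative_avg[of "avg e (avg e u)" e x] continuous_on_avg[OF assms(2,3)] assms by simp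
  have "avg e (dq e (dq e u)) = dq e (avg e (dq e u))" by (intro avg_dq b)
  then show "(avg e (avg e (dq e u)) has_real_derivative avg e (dq e (dq e u)) x) (at x)"
    using has_real_derivative_avg[OF c1 assms(3)] by simp
qed

lemma dq_abs_le: "(\<And>x. \<bar>u x\<bar> \<le> C) \<Longrightarrow> e > 0 \<Longrightarrow> \<bar>dq e u x\<bar> \<le> 2 * C / e"
proof -
  assume *: "\<And>x. \<bar>u x\<bar> \<le> C" "e > 0"
  have "\<bar>u (x + e) - u x\<bar> \<le> 2 * C" using *(1)[of x] *(1)[of "x + e"] by linarith
  then show ?thesis using *(2) by (simp add: dq_def abs_divide divide_right_mono)
qed

lemma integrable_dq: "integrable lborel u \<Longrightarrow> integrable lborel (dq e u)"
  unfolding dq_def[abs_def] by (intro integrable_divide Bochner_Integration.integrable_diff integrable_shift)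

text \<open>Over \<open>{- n..n}\<close> the integral of \<open>v x - v (x + e)\<close> telescopes
  to integrals over two intervals offset by \<open>e\<close>, hence is at most \<open>e\<close>;
  Fatou removes the cutoff. The resulting bound 1 is the total variation and does not depend on
  \<open>e\<close>.\<close>

lemma integrable_dq_antimono:
  assumes "antimono v" "\<And>x. 0 \<le> v x" "\<And>x. v x \<le> 1" "e > 0"
  shows "integrable lborel (dq e v)" "(\<integral>x. \<bar>dq e v x\<bar> \<partial>lborel) \<le> 1"
proof -
  have bv: "bounded_borel v" by (rule bounded_borel_antimono[OF assms(1-3)])
  have [measurable]: "v \<in> borel_measurable borel" using bv by (rule bounded_borel_measurable)
  have mv: "v (x + e) \<le> v x" for x using assms(4) by (intro antimonoD[OF assms(1)]) simp
  define g where "g x = v x - v (x + e)" for x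
  have g0: "g x \<ge> 0" for x using mv by (simp add: g_def)
  have le: "(\<integral>\<^sup>+x. ennreal (indicator {- real n..real n} x * g x) \<partial>lborel) \<le> ennreal e" for n
  proof -
    have ii: "integrable lborel (\<lambda>x. indicator {a..b} x * w x)" if "bounded_borel w" for a b :: real and w
    proof (rule integrable_mult_bounded_borel[OF _ that])
      show "integrable lborel (indicator {a..b} :: real \<Rightarrow> real)"
        by (rule integrable_real_indicator) (auto simp: emeasure_lborel_Icc_eq)
    qed
    have i1: "integrable lborel (\<lambda>x. indicator {- real n..real n} x * v x)" by (rule ii[OF bv])
    have i2: "integrable lborel (\<lambda>x. indicator {- real n + e..real n + e} x * v x)" by (rule ii[OF bv])
    have i3: "integrable lborel (\<lambda>x. indicator {- real n + e..real n + e} (x + e) * v (x + e))"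
      using integrable_shift[OF i2, of e] .
    have eq: "indicator {- real n..real n} x * g x =
        indicator {- real n..real n} x * v x - indicator {- real n + e..real n + e} (x + e) * v (x + e)" for x
      by (auto simp: g_def indicator_def)
    have "integrable lborel (\<lambda>x. indicator {- real n..real n} x * g x)"
      unfolding eq using i1 i3 by (intro Bochner_Integration.integrable_diff)
    then have "(\<integral>\<^sup>+x. ennreal (indicator {- real n..real n} x * g x) \<partial>lborel)
        = ennreal (\<integral>x. indicator {- real n..real n} x * g x \<partial>lborel)"
      using g0 by (intro nn_integral_eq_integral) auto
    also have "(\<integral>x. indicator {- real n..real n} x * g x \<partial>lborel)
        = (\<integral>x. indicator {- real n..real n} x * v x \<partial>lborel) - (\<integral>x. indicator {- real n + e..real n + e} x * v x \<partial>lborel)"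
      unfolding eq using i1 i3 integral_shift[of "\<lambda>x. indicator {- real n + e..real n + e} x * v x" e]
      by (subst Bochner_Integration.integral_diff) auto
    also have "\<dots> = (\<integral>x. indicator {- real n..real n} x * v x - indicator {- real n + e..real n + e} x * v x \<partial>lborel)"
      using i1 i2 by (intro Bochner_Integration.integral_diff[symmetric])
    also have "\<dots> \<le> (\<integral>x. indicator {- real n..- real n + e} x \<partial>lborel)"
    proof (intro integral_mono Bochner_Integration.integrable_diff i1 i2)
      show "integrable lborel (indicator {- real n..- real n + e} :: real \<Rightarrow> real)"
        by (rule integrable_real_indicator) (auto simp: emeasure_lborel_Icc_eq)
      fix x
      show "indicator {- real n..real n} x * v x - indicator {- real n + e..real n + e} x * v x
          \<le> indicator {- real n..- real n + e} x"
        using assms(2)[of x] assms(3)[of x] assms(4) by (auto simp: indicator_def)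
    qed
    also have "\<dots> = e" using assms by simp
    finally show ?thesis by (simp add: ennreal_leI)
  qed
  have "(\<integral>\<^sup>+x. ennreal (g x) \<partial>lborel) = (\<integral>\<^sup>+x. liminf (\<lambda>n. ennreal (indicator {- real n..real n} x * g x)) \<partial>lborel)"
  proof (intro nn_integral_cong)
    fix x :: real
    have "\<forall>\<^sub>F n in sequentially. \<bar>x\<bar> \<le> real n"
      using eventually_ge_at_top[of "nat \<lceil>\<bar>x\<bar>\<rceil>"] by eventually_elim linarith
    then have "\<forall>\<^sub>F n in sequentially. ennreal (indicator {- real n..real n} x * g x) = ennreal (g x)"
      by eventually_elim (auto simp: indicator_def)
    then have "(\<lambda>n. ennreal (indicator {- real n..real n} x * g x)) \<longlonglongrightarrow> ennreal (g x)"
      by (rule tendsto_eventually)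
    then show "ennreal (g x) = liminf (\<lambda>n. ennreal (indicator {- real n..real n} x * g x))"
      using lim_imp_Liminf[OF sequentially_bot] by metis
  qed
  also have "\<dots> \<le> liminf (\<lambda>n. \<integral>\<^sup>+x. ennreal (indicator {- real n..real n} x * g x) \<partial>lborel)"
    unfolding g_def by (rule nn_integral_liminf) measurable
  also have "\<dots> \<le> ennreal e"
    using le by (intro Liminf_le) auto
  finally have fin: "(\<integral>\<^sup>+x. ennreal (g x) \<partial>lborel) \<le> ennreal e" .
  have ig: "integrable lborel g"
    using fin g0 unfolding g_def by (intro integrableI_bounded) (auto intro: le_less_trans)
  have "ennreal (\<integral>x. g x \<partial>lborel) \<le> ennreal e"
    using fin g0 ig by (subst (asm) nn_integral_eq_integral) auto
  then have gle: "(\<integral>x. g x \<partial>lborel) \<le> e" using assms(4) by (simp add: ennreal_le_iff)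
  have dqg: "dq e v = (\<lambda>x. - g x / e)" by (auto simp: dq_def g_def field_simps)
  show "integrable lborel (dq e v)" unfolding dqg using ig by simp
  show "(\<integral>x. \<bar>dq e v x\<bar> \<partial>lborel) \<le> 1"
    unfolding dqg using g0 gle assms(4) by (simp add: field_simps)
qed

lemma avg_tendsto_shifts:
  assumes "bounded_borel u" "\<And>a. (\<lambda>n. u (X n + a)) \<longlonglongrightarrow> m" "e \<noteq> 0"
  shows "(\<lambda>n. avg e u (X n + a)) \<longlonglongrightarrow> m"
proof -
  obtain C where C: "\<And>x. \<bar>u x\<bar> \<le> C" using bounded_borelE[OF assms(1)] by blast
  have "(\<lambda>n. avg e (\<lambda>y. u (y + X n)) a) \<longlonglongrightarrow> avg e (\<lambda>_. m) a"
    by (rule avg_tendsto[where C=C and D="{}", OF bounded_borel_shift[OF assms(1)] C bounded_borel_const])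
      (use assms in \<open>auto simp: add.commute\<close>)
  then show ?thesis by (simp add: avg_shift avg_const add.commute)
qed

lemma at_right_interval_bound:
  fixes u :: "real \<Rightarrow> real"
  assumes "continuous (at_right x) u" "\<eta> > 0"
  obtains d where "d > 0" "\<And>y. x \<le> y \<Longrightarrow> y \<le> x + d \<Longrightarrow> \<bar>u y - u x\<bar> \<le> \<eta>"
proof -
  have "\<forall>\<^sub>F y in at_right x. dist (u y) (u x) < \<eta>"
    using assms by (intro tendstoD) (auto simp: continuous_within)
  then obtain b where b: "b > x" "\<And>y. x < y \<Longrightarrow> y < b \<Longrightarrow> dist (u y) (u x) < \<eta>"
    by (auto simp: eventually_at_right_field)
  show ?thesis
  proof (rule that[of "(b - x) / 2"])
    fix y assume "x \<le> y" "y \<le> x + (b - x) / 2"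
    moreover have "x + (b - x) / 2 < b" using b(1) by (simp add: field_simps)
    ultimately show "\<bar>u y - u x\<bar> \<le> \<eta>" using b(2)[of y] \<open>\<eta> > 0\<close>
      by (cases "x = y") (auto simp: dist_real_def)
  qed (use b in auto)
qed

lemma avg4_bounds:
  assumes u: "bounded_borel u" "\<And>y. x \<le> y \<Longrightarrow> y \<le> x + 4 * e \<Longrightarrow> a \<le> u y \<and> u y \<le> b" and e: "e \<ge> 0"
  shows "a \<le> avg e (avg e (avg e (avg e u))) x \<and> avg e (avg e (avg e (avg e u))) x \<le> b"
    and "a \<le> avg e (avg e (avg e u)) x \<and> avg e (avg e (avg e u)) x \<le> b"
proof -
  have 1: "a \<le> avg e u y \<and> avg e u y \<le> b" if "x \<le> y" "y \<le> x + 3 * e" for y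
    using avg_bounds_interval[OF u(1) _ e, where x=y and a=a and b=b] u(2) that e by auto
  have 2: "a \<le> avg e (avg e u) y \<and> avg e (avg e u) y \<le> b" if "x \<le> y" "y \<le> x + 2 * e" for y
    using avg_bounds_interval[OF bounded_borel_avg[OF u(1)] _ e, where x=y and a=a and b=b] 1 that e by auto
  have 3: "a \<le> avg e (avg e (avg e u)) y \<and> avg e (avg e (avg e u)) y \<le> b" if "x \<le> y" "y \<le> x + e" for y
    using avg_bounds_interval[OF bounded_borel_avg[OF bounded_borel_avg[OF u(1)]] _ e, where x=y and a=a and b=b] 2 that e by auto
  then show "a \<le> avg e (avg e (avg e u)) x \<and> avg e (avg e (avg e u)) x \<le> b" using e by auto
  show "a \<le> avg e (avg e (avg e (avg e u))) x \<and> avg e (avg e (avg e (avg e u))) x \<le> b"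
    using avg_bounds_interval[OF bounded_borel_avg[OF bounded_borel_avg[OF bounded_borel_avg[OF u(1)]]] _ e, where x=x and a=a and b=b] 3 by auto
qed

text \<open>The averages at \<open>x\<close> see values on \<open>{x..x + 4 * e}\<close> only, so
  right continuity is enough and no point has to be excluded, not even a jump.\<close>

lemma avg4_tendsto:
  assumes u: "bounded_borel u" "continuous (at_right x) u"
    and e: "e \<longlonglongrightarrow> 0" "\<And>n. e n > (0::real)"
  shows "(\<lambda>n. avg (e n) (avg (e n) (avg (e n) (avg (e n) u))) x) \<longlonglongrightarrow> u x"
    and "(\<lambda>n. avg (e n) (avg (e n) (avg (e n) u)) x) \<longlonglongrightarrow> u x"
proof -
  have key: "\<forall>\<^sub>F n in sequentially. 
      dist (avg (e n) (avg (e n) (avg (e n) (avg (e n) u))) x) (u x) < r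
      \<and> dist (avg (e n) (avg (e n) (avg (e n) u)) x) (u x) < r" if r: "r > 0" for r
  proof -
    obtain d where d: "d > 0" "\<And>y. x \<le> y \<Longrightarrow> y \<le> x + d \<Longrightarrow> \<bar>u y - u x\<bar> \<le> r / 2"
      using at_right_interval_bound[OF u(2), of "r/2"] r by auto
    have "\<forall>\<^sub>F n in sequentially. e n < d / 4" using e d by (intro order_tendstoD) auto
    then show ?thesis
    proof eventually_elim
      case (elim n)
      have "u x - r/2 \<le> u y \<and> u y \<le> u x + r/2" if "x \<le> y" "y \<le> x + 4 * e n" for y
        using d(2)[of y] that elim unfolding abs_le_iff by linarith
      from avg4_bounds[OF u(1), of x "e n", OF this less_imp_le[OF e(2)]] r show ?case
        by (auto simp: dist_real_def)
    qed
  qed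
  show "(\<lambda>n. avg (e n) (avg (e n) (avg (e n) (avg (e n) u))) x) \<longlonglongrightarrow> u x"
    by (rule tendstoI) (rule eventually_mono[OF key], auto)
  show "(\<lambda>n. avg (e n) (avg (e n) (avg (e n) u)) x) \<longlonglongrightarrow> u x"
    by (rule tendstoI) (rule eventually_mono[OF key], auto)
qed

text \<open>The common Hoelder bound makes difference quotients with step \<open>h\<close>
  approximate \<open>p n\<close> within \<open>C * sqrt \<bar>h\<bar>\<close>, uniformly in
  \<open>n\<close>. Convergence of the functions therefore forces their derivatives to be Cauchy,
  without passing to subsequences, and the same estimate survives in the limit.\<close>

lemma has_derivative_of_holder_limit:
  fixes X p :: "nat \<Rightarrow> real \<Rightarrow> real"
  assumes der: "\<And>n x. (X n has_real_derivative p n x) (at x)"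
    and hol: "\<And>n x y. \<bar>p n x - p n y\<bar> \<le> C * sqrt \<bar>x - y\<bar>"
    and lim: "\<And>x. (\<lambda>n. X n x) \<longlonglongrightarrow> v x"
  obtains v' where "\<And>x. (v has_real_derivative v' x) (at x)" "continuous_on UNIV v'"
    "\<And>x. (\<lambda>n. p n x) \<longlonglongrightarrow> v' x"
proof -
  have C: "C \<ge> 0" using hol[of 0 0 1] by simp
  have est: "\<bar>(X n (x + h) - X n x) / h - p n x\<bar> \<le> C * sqrt \<bar>h\<bar>" if "h \<noteq> 0" for n x h
  proof -
    obtain \<xi> where xi: "\<bar>\<xi> - x\<bar> \<le> \<bar>h\<bar>" "(X n (x + h) - X n x) / h = p n \<xi>"
    proof (cases "h > 0")
      case True
      obtain z where "x < z" "z < x + h" "X n (x + h) - X n x = (x + h - x) * p n z"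
        using MVT2[of x "x + h" "X n" "p n"] True der by auto
      then show ?thesis using True by (intro that[of z]) (auto simp: field_simps)
    next
      case False
      then have "h < 0" using \<open>h \<noteq> 0\<close> by simp
      obtain z where "x + h < z" "z < x" "X n x - X n (x + h) = (x - (x + h)) * p n z"
        using MVT2[of "x + h" x "X n" "p n"] \<open>h < 0\<close> der by auto
      then show ?thesis using \<open>h < 0\<close> by (intro that[of z]) (auto simp: field_simps)
    qed
    have "\<bar>p n \<xi> - p n x\<bar> \<le> C * sqrt \<bar>\<xi> - x\<bar>" by (rule hol)
    also have "\<dots> \<le> C * sqrt \<bar>h\<bar>" using xi C by (intro mult_left_mono) auto
    finally show ?thesis using xi by simp
  qed
  have "Cauchy (\<lambda>n. p n x)" for x
  proof (rule metric_CauchyI)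
    fix e :: real assume e: "e > 0"
    \<comment> \<open>Makes \<open>C * sqrt h\<close> at most \<open>e / 4\<close>: two such errors
      and a Cauchy gap below \<open>e / 4\<close> stay below \<open>e\<close>. The summand 1 covers
      \<open>C = 0\<close>.\<close>
    define h where "h = (e / (4 * (C + 1)))\<^sup>2"
    have h: "h > 0" using e C by (simp add: h_def)
    have sh: "C * sqrt \<bar>h\<bar> \<le> e / 4"
    proof -
      have "sqrt \<bar>h\<bar> = e / (4 * (C + 1))" using e C by (simp add: h_def)
      then have "C * sqrt \<bar>h\<bar> = (C / (C + 1)) * (e / 4)" by simp
      also have "\<dots> \<le> 1 * (e / 4)" using e C by (intro mult_right_mono) auto
      finally show ?thesis by simp
    qed
    have "(\<lambda>n. (X n (x + h) - X n x) / h) \<longlonglongrightarrow> (v (x + h) - v x) / h"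
      using h by (intro tendsto_intros lim) auto
    then have "Cauchy (\<lambda>n. (X n (x + h) - X n x) / h)" by (rule LIMSEQ_imp_Cauchy)
    then obtain M where M: "\<And>m n. m \<ge> M \<Longrightarrow> n \<ge> M \<Longrightarrow>
        dist ((X m (x + h) - X m x) / h) ((X n (x + h) - X n x) / h) < e / 4"
      using e unfolding Cauchy_def by (meson divide_pos_pos zero_less_numeral)
    show "\<exists>M. \<forall>m\<ge>M. \<forall>n\<ge>M. dist (p m x) (p n x) < e"
    proof (intro exI[of _ M] allI impI)
      fix m n assume "m \<ge> M" "n \<ge> M"
      from M[OF this] est[of h m x] est[of h n x] h sh
      show "dist (p m x) (p n x) < e" unfolding dist_real_def by (simp only: abs_le_iff abs_less_iff) linarith
    qed
  qed
  then have "\<exists>l. (\<lambda>n. p n x) \<longlonglongrightarrow> l" for x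
    using Cauchy_convergent convergent_def by blast
  then obtain v' where v': "\<And>x. (\<lambda>n. p n x) \<longlonglongrightarrow> v' x" by metis
  have est': "\<bar>(v (x + h) - v x) / h - v' x\<bar> \<le> C * sqrt \<bar>h\<bar>" if "h \<noteq> 0" for x h
  proof (rule LIMSEQ_le_const2)
    show "(\<lambda>n. \<bar>(X n (x + h) - X n x) / h - p n x\<bar>) \<longlonglongrightarrow> \<bar>(v (x + h) - v x) / h - v' x\<bar>"
      using that by (intro tendsto_intros lim v')
  qed (use est[OF that] in auto)
  have sq: "((\<lambda>h::real. C * sqrt \<bar>h\<bar>) \<longlongrightarrow> 0) (at 0)"
    by (auto intro!: tendsto_eq_intros)
  have hol': "\<bar>v' x - v' y\<bar> \<le> C * sqrt \<bar>x - y\<bar>" for x y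
    by (rule LIMSEQ_le_const2[OF tendsto_rabs[OF tendsto_diff[OF v'[of x] v'[of y]]]]) (simp add: hol)
  show ?thesis
  proof (rule that[OF _ _ v'])
    fix x show "(v has_real_derivative v' x) (at x)"
      unfolding DERIV_def
    proof (rule LIM_zero_cancel, rule Lim_null_comparison[OF _ sq])
      show "\<forall>\<^sub>F h in at 0. norm ((v (x + h) - v x) / h - v' x) \<le> C * sqrt \<bar>h\<bar>"
        using est' by (auto simp: eventually_at_filter)
    qed
  next
    show "continuous_on UNIV v'"
      unfolding continuous_on_eq_continuous_at[OF open_UNIV] 
    proof
      fix x :: real
      have "((\<lambda>y. C * sqrt \<bar>y - x\<bar>) \<longlongrightarrow> 0) (at x)" by (auto intro!: tendsto_eq_intros)
      then have "((\<lambda>y. v' y - v' x) \<longlongrightarrow> 0) (at x)"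
        by (rule Lim_null_comparison[rotated]) (simp add: hol')
      then show "isCont v' x"
        unfolding isCont_def by (rule LIM_zero_cancel)
    qed
  qed
qed


lemma antimono_limits:
  fixes v :: "real \<Rightarrow> real"
  assumes "antimono v" "\<And>x. 0 \<le> v x" "\<And>x. v x \<le> 1"
  obtains l1 l2 where "(v \<longlongrightarrow> l1) at_bot" "(v \<longlongrightarrow> l2) at_top"
    "\<And>x. v x \<le> l1" "\<And>x. l2 \<le> v x" "l1 \<le> 1" "0 \<le> l2"
proof -
  have bdd: "bdd_above (range v)" "bdd_below (range v)"
    using assms(2,3) by (auto intro!: bdd_aboveI[of _ 1] bdd_belowI[of _ 0])
  have 1: "v x \<le> (SUP x. v x)" and 2: "(INF x. v x) \<le> v x" for x
    using bdd by (auto intro: cSUP_upper cINF_lower)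
  have t1: "(v \<longlongrightarrow> (SUP x. v x)) at_bot"
  proof (rule increasing_tendsto)
    show "\<forall>\<^sub>F n in at_bot. v n \<le> (SUP x. v x)" using 1 by simp
    fix y assume "y < (SUP x. v x)"
    then obtain a where a: "y < v a" using bdd by (auto simp: less_cSUP_iff)
    show "\<forall>\<^sub>F n in at_bot. y < v n"
      using eventually_le_at_bot[of a] by eventually_elim (rule less_le_trans[OF a antimonoD[OF assms(1)]])
  qed
  have t2: "(v \<longlongrightarrow> (INF x. v x)) at_top"
  proof (rule decreasing_tendsto)
    show "\<forall>\<^sub>F n in at_top. (INF x. v x) \<le> v n" using 2 by simp
    fix y assume "(INF x. v x) < y"
    then obtain a where a: "v a < y" using bdd by (auto simp: cINF_less_iff)
    show "\<forall>\<^sub>F n in at_top. v n < y"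
      using eventually_ge_at_top[of a] by eventually_elim (rule le_less_trans[OF antimonoD[OF assms(1)] a])
  qed
  show ?thesis
    by (rule that[OF t1 t2 1 2]) (auto intro!: cSUP_least cINF_greatest assms)
qed

lemma avg3_antimono_tendsto:
  assumes "antimono v" "bounded_borel v" "e > 0"
  shows "(v \<longlongrightarrow> l) at_bot \<Longrightarrow> (avg e (avg e (avg e v)) \<longlongrightarrow> l) at_bot"
    and "(v \<longlongrightarrow> l) at_top \<Longrightarrow> (avg e (avg e (avg e v)) \<longlongrightarrow> l) at_top"
proof -
  have 1: "antimono (avg e v)" "antimono (avg e (avg e v))" "bounded_borel (avg e v)" "bounded_borel (avg e (avg e v))"
    using assms by (auto intro!: avg_antimono bounded_borel_avg)
  note b = avg_antimono_between[OF _ _ less_imp_le[OF assms(3)]]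
  have up: "avg e (avg e (avg e v)) x \<le> v x" for x
    using b(2)[OF 1(2,4), of x] b(2)[OF 1(1,3), of x] b(2)[OF assms(1,2), of x] by linarith
  have lo: "v (x + 3 * e) \<le> avg e (avg e (avg e v)) x" for x
    using b(1)[OF 1(2,4), of x] b(1)[OF 1(1,3), of "x + e"] b(1)[OF assms(1,2), of "x + e + e"]
    by (simp add: algebra_simps)
  show "(avg e (avg e (avg e v)) \<longlongrightarrow> l) at_bot" if "(v \<longlongrightarrow> l) at_bot"
  proof (rule tendsto_sandwich)
    show "((\<lambda>x. v (x + 3 * e)) \<longlongrightarrow> l) at_bot" by (rule filterlim_compose[OF that filterlim_shift(1)])
  qed (use up lo that in auto)
  show "(avg e (avg e (avg e v)) \<longlongrightarrow> l) at_top" if "(v \<longlongrightarrow> l) at_top"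
  proof (rule tendsto_sandwich)
    show "((\<lambda>x. v (x + 3 * e)) \<longlongrightarrow> l) at_top" by (rule filterlim_compose[OF that filterlim_shift(2)])
  qed (use up lo that in auto)
qed

context jump_measure
begin

lemma J_far_tendsto:
  assumes b: "\<And>n. bounded_borel (X n)" "\<And>n x. \<bar>X n x\<bar> \<le> 1" and "bounded_borel w"
    and lim: "\<And>x. (\<lambda>n. X n x) \<longlonglongrightarrow> w x" and \<delta>: "\<delta> > 0"
  shows "(\<lambda>n. J (far \<delta>) (X n) x) \<longlonglongrightarrow> J (far \<delta>) w x"
proof -
  define S where "S = (far \<delta>)"
  have [measurable]: "S \<in> sets borel" unfolding S_def by measurable
  have [measurable]: "X n \<in> borel_measurable borel" "w \<in> borel_measurable borel" for n
    using assms by (auto intro: bounded_borel_measurable)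
  have "(\<lambda>n. \<integral>z. indicator S z * dd (X n) z x \<partial>N) \<longlonglongrightarrow> (\<integral>z. indicator S z * dd w z x \<partial>N)"
  proof (rule integral_dominated_convergence)
    show "integrable N (\<lambda>z. 4 * 1 / min 1 (\<delta>\<^sup>2) * kern z)" using integrable_kern by simp
    show "AE z in N. norm (indicator S z * dd (X n) z x) \<le> 4 * 1 / min 1 (\<delta>\<^sup>2) * kern z" for n
      using ddbD[OF ddb_far[OF b(1) b(2) \<delta>]] by (auto simp: S_def)
    show "AE z in N. (\<lambda>n. indicator S z * dd (X n) z x) \<longlonglongrightarrow> indicator S z * dd w z x"
      unfolding dd_def by (intro AE_I2 tendsto_intros lim)
  qed measurable
  then show ?thesis unfolding J_def S_def by (intro tendsto_intros) auto
qed

end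

subsection \<open>Energy estimates\<close>

text \<open>The weak formulation: \<open>v\<close> is merely monotone and right-continuous, and the
  equation is imposed on its threefold averages of every width. The reaction is averaged after
  \<open>f\<close> is applied, as the limit passage delivers it.\<close>

locale mollified_front = jump_measure +
  fixes v f :: "real \<Rightarrow> real" and c L F :: real
  assumes antimono_v: "antimono v" and v_ge_0: "\<And>x. 0 \<le> v x" and v_le_1: "\<And>x. v x \<le> 1"
    and right_cont_v: "\<And>x. continuous (at_right x) v"
    and cont_f: "continuous_on UNIV f"
    and lip_f: "\<And>s t. s \<in> {0..1} \<Longrightarrow> t \<in> {0..1} \<Longrightarrow> \<bar>f s - f t\<bar> \<le> L * \<bar>s - t\<bar>"
    and bound_f: "\<And>s. s \<in> {0..1} \<Longrightarrow> \<bar>f s\<bar> \<le> F"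
    and L_nonneg: "0 \<le> L" and c_pos: "0 < c"
    and eq: "\<And>e x. e > 0 \<Longrightarrow> J UNIV (avg e (avg e (avg e v))) x + c * avg e (avg e (dq e v)) x
               + avg e (avg e (avg e (\<lambda>x. f (v x)))) x = 0"
begin

lemma F_nonneg: "0 \<le> F"
  using bound_f[of 0] by simp

lemma bounded_borel_v: "bounded_borel v"
  by (rule bounded_borel_antimono[OF antimono_v v_ge_0 v_le_1])

lemma bounded_borel_fv: "bounded_borel (\<lambda>x. f (v x))"
  by (rule bounded_borel_comp[OF bounded_borel_v cont_f])

lemma abs_v_le: "\<bar>v x\<bar> \<le> 1"
  using v_ge_0[of x] v_le_1[of x] by simp

lemma fv_le: "\<bar>f (v x)\<bar> \<le> F"
  by (rule bound_f) (simp add: v_ge_0 v_le_1)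

lemma continuous_avg_v: "e > 0 \<Longrightarrow> continuous_on UNIV (avg e v)"
  by (rule continuous_on_avg_antimono[OF antimono_v bounded_borel_v]) simp

lemmas bb = bounded_borel_avg bounded_borel_dq bounded_borel_v bounded_borel_fv

lemma ddb_avg3_v:
  assumes "e > 0" "S \<in> sets borel" shows "ddb S (4 * 1 + 2 * (2 * 1 / e) / e) (avg e (avg e (avg e v)))"
proof -
  have e: "e \<noteq> 0" using assms by simp
  note d = avg3_derivs[OF bounded_borel_v continuous_avg_v[OF assms(1)] e]
  show ?thesis
  proof (rule ddb_C2[OF d(1,2,4)])
    show "bounded_borel (avg e (avg e (avg e v)))" by (intro bb)
    show "\<bar>avg e (avg e (avg e v)) x\<bar> \<le> 1" for x by (intro avg_abs_le bb abs_v_le)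
    show "\<bar>avg e (dq e (dq e v)) x\<bar> \<le> 2 * (2 * 1 / e) / e" for x
      by (intro avg_abs_le dq_abs_le bb abs_v_le assms)
  qed fact
qed

text \<open>Testing with \<open>Z'\<close> removes the nonlocal term by orthogonality and leaves
  \<open>c\<close> times the square integral against \<open>F\<close> times the \<open>L^1\<close>
  norm of \<open>Z'\<close>. That norm is at most the total variation of \<open>v\<close>, so the
  bound is independent of \<open>e\<close>.\<close>

lemma derivative_square_bound:
  assumes e: "e > 0"
  shows "integrable lborel (\<lambda>x. (avg e (avg e (dq e v)) x)\<^sup>2)"
    "(\<integral>x. (avg e (avg e (dq e v)) x)\<^sup>2 \<partial>lborel) \<le> F / c"
proof -
  define Z where "Z = avg e (avg e (avg e v))"
  define Z' where "Z' = avg e (avg e (dq e v))"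
  define g where "g = avg e (avg e (avg e (\<lambda>x. f (v x))))"
  have e0: "e \<noteq> 0" using e by simp
  note d = avg3_derivs[OF bounded_borel_v continuous_avg_v[OF e] e0, folded Z_def Z'_def]
  have bZ: "bounded_borel Z" "bounded_borel Z'" "bounded_borel g" by (auto simp: Z_def Z'_def g_def intro!: bb)
  have iB: "integrable lborel (dq e v)" "(\<integral>x. \<bar>dq e v x\<bar> \<partial>lborel) \<le> 1"
    using integrable_dq_antimono[OF antimono_v v_ge_0 v_le_1 e] by auto
  have iA: "integrable lborel (avg e (dq e v))" "(\<integral>x. \<bar>avg e (dq e v) x\<bar> \<partial>lborel) \<le> 1"
    using integrable_avg[OF _ iB(1), of e] iB(2) bb by (auto intro: order_trans)
  have iZ': "integrable lborel Z'" "(\<integral>x. \<bar>Z' x\<bar> \<partial>lborel) \<le> 1"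
    unfolding Z'_def using integrable_avg[OF _ iA(1), of e] iA(2) bb by (auto intro: order_trans)
  have i2: "integrable lborel (\<lambda>x. Z' x * Z' x)" and ig: "integrable lborel (\<lambda>x. Z' x * g x)"
    by (auto intro!: integrable_mult_bounded_borel iZ' bZ)
  have ddZ: "ddb UNIV (4 * 1 + 2 * (2 * 1 / e) / e) Z" unfolding Z_def by (rule ddb_avg3_v[OF e]) simp
  obtain l1 l2 where l: "(v \<longlongrightarrow> l1) at_bot" "(v \<longlongrightarrow> l2) at_top"
    by (rule antimono_limits[OF antimono_v v_ge_0 v_le_1])
  have 0: "(\<integral>x. Z' x * J UNIV Z x \<partial>lborel) = 0"
    by (rule J_deriv_orthogonal[OF d(1,3) bZ(2) iZ'(1) _ _ ddZ, of l1 l2])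
      (auto simp: Z_def intro!: avg3_antimono_tendsto antimono_v bounded_borel_v e l)
  have eqZ: "J UNIV Z x = - c * Z' x - g x" for x
    using eq[OF e, of x] by (simp add: Z_def Z'_def g_def)
  have "(\<integral>x. Z' x * J UNIV Z x \<partial>lborel) = (\<integral>x. - c * (Z' x * Z' x) - Z' x * g x \<partial>lborel)"
    unfolding eqZ by (simp add: algebra_simps)
  also have "\<dots> = - c * (\<integral>x. Z' x * Z' x \<partial>lborel) - (\<integral>x. Z' x * g x \<partial>lborel)"
    using i2 ig by simp
  finally have "c * (\<integral>x. Z' x * Z' x \<partial>lborel) = - (\<integral>x. Z' x * g x \<partial>lborel)" using 0 by simp
  also have "\<dots> \<le> \<bar>\<integral>x. Z' x * g x \<partial>lborel\<bar>" by simp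
  also have "\<dots> \<le> (\<integral>x. \<bar>Z' x * g x\<bar> \<partial>lborel)" by (rule integral_abs_bound)
  also have "\<dots> \<le> (\<integral>x. F * \<bar>Z' x\<bar> \<partial>lborel)"
  proof (rule integral_mono)
    show "\<bar>Z' x * g x\<bar> \<le> F * \<bar>Z' x\<bar>" for x
    proof -
      have "\<bar>g x\<bar> \<le> F" unfolding g_def by (intro avg_abs_le bb fv_le)
      then have "\<bar>Z' x\<bar> * \<bar>g x\<bar> \<le> \<bar>Z' x\<bar> * F" by (rule mult_left_mono) simp
      then show ?thesis by (simp add: abs_mult mult.commute)
    qed
  qed (use ig iZ' in auto)
  also have "\<dots> \<le> F * 1" unfolding integral_mult_right_zero using iZ'(2) F_nonneg by (rule mult_left_mono)
  finally have "(\<integral>x. Z' x * Z' x \<partial>lborel) \<le> F / c"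
    using c_pos by (simp add: field_simps)
  then show "integrable lborel (\<lambda>x. (avg e (avg e (dq e v)) x)\<^sup>2)"
    "(\<integral>x. (avg e (avg e (dq e v)) x)\<^sup>2 \<partial>lborel) \<le> F / c"
    using i2 by (simp_all add: Z'_def power2_eq_square)
qed

text \<open>The reaction \<open>f (v x)\<close> contains the unmollified \<open>v\<close>, so the
  energy bound must reach \<open>v\<close> itself. The step \<open>h\<close> is fixed while the
  mollification width tends to 0: averaging does not increase \<open>L^2\<close> norms, and Fatou
  gives the limit.\<close>

lemma dq_square_bound:
  assumes h: "h > 0"
  shows "integrable lborel (\<lambda>x. (dq h v x)\<^sup>2)" "(\<integral>x. (dq h v x)\<^sup>2 \<partial>lborel) \<le> F / c"
proof -
  define e where "e n = inverse (real (Suc n))" for n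
  have e: "e n > 0" "e \<longlonglongrightarrow> 0" for n
    unfolding e_def using LIMSEQ_inverse_real_of_nat by auto
  define Z where "Z n = avg (e n) (avg (e n) (avg (e n) v))" for n
  have [measurable]: "v \<in> borel_measurable borel" "Z n \<in> borel_measurable borel" for n
    by (auto simp: Z_def intro!: bounded_borel_measurable bb)
  have Zlim: "(\<lambda>n. Z n x) \<longlonglongrightarrow> v x" for x
    unfolding Z_def by (rule avg4_tendsto(2)[OF bounded_borel_v right_cont_v e(2,1)])
  have bnd: "(\<integral>\<^sup>+x. ennreal ((dq h (Z n) x)\<^sup>2) \<partial>lborel) \<le> ennreal (F / c)" for n
  proof -
    have e0: "e n \<noteq> 0" using e(1)[of n] by simp
    note d = avg3_derivs[OF bounded_borel_v continuous_avg_v[OF e(1)] e0, folded Z_def]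
    note sq = derivative_square_bound[OF e(1), of n]
    have "dq h (Z n) = avg h (avg (e n) (avg (e n) (dq (e n) v)))"
      using dq_eq_avg_deriv[OF d(1,3)] h by auto
    then have "(\<integral>\<^sup>+x. ennreal ((dq h (Z n) x)\<^sup>2) \<partial>lborel) \<le> (\<integral>\<^sup>+x. ennreal ((avg (e n) (avg (e n) (dq (e n) v)) x)\<^sup>2) \<partial>lborel)"
      using nn_integral_avg_square_le[of "avg (e n) (avg (e n) (dq (e n) v))" h] by (simp add: bb)
    also have "\<dots> = ennreal (\<integral>x. (avg (e n) (avg (e n) (dq (e n) v)) x)\<^sup>2 \<partial>lborel)"
      by (rule nn_integral_eq_integral[OF sq(1)]) simp
    also have "\<dots> \<le> ennreal (F / c)" by (rule ennreal_leI[OF sq(2)])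
    finally show ?thesis .
  qed
  have "(\<integral>\<^sup>+x. ennreal ((dq h v x)\<^sup>2) \<partial>lborel) = (\<integral>\<^sup>+x. liminf (\<lambda>n. ennreal ((dq h (Z n) x)\<^sup>2)) \<partial>lborel)"
  proof (intro nn_integral_cong)
    fix x
    have "(\<lambda>n. ennreal ((dq h (Z n) x)\<^sup>2)) \<longlonglongrightarrow> ennreal ((dq h v x)\<^sup>2)"
      unfolding dq_def using h by (intro tendsto_intros tendsto_ennrealI Zlim) auto
    then show "ennreal ((dq h v x)\<^sup>2) = liminf (\<lambda>n. ennreal ((dq h (Z n) x)\<^sup>2))"
      using lim_imp_Liminf[OF sequentially_bot] by metis
  qed
  also have "\<dots> \<le> liminf (\<lambda>n. \<integral>\<^sup>+x. ennreal ((dq h (Z n) x)\<^sup>2) \<partial>lborel)"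
    unfolding dq_def by (rule nn_integral_liminf) measurable
  also have "\<dots> \<le> ennreal (F / c)" using bnd by (intro Liminf_le) auto
  finally have le: "(\<integral>\<^sup>+x. ennreal ((dq h v x)\<^sup>2) \<partial>lborel) \<le> ennreal (F / c)" .
  have [measurable]: "dq h v \<in> borel_measurable borel" by (intro bounded_borel_measurable bb)
  show 1: "integrable lborel (\<lambda>x. (dq h v x)\<^sup>2)"
    using le by (intro integrableI_bounded) (auto intro: le_less_trans)
  have "ennreal (\<integral>x. (dq h v x)\<^sup>2 \<partial>lborel) \<le> ennreal (F / c)"
    using le 1 by (subst (asm) nn_integral_eq_integral) auto
  then show "(\<integral>x. (dq h v x)\<^sup>2 \<partial>lborel) \<le> F / c"
    using F_nonneg c_pos by (simp add: ennreal_le_iff)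
qed

text \<open>The \<open>L^2\<close> bound for difference quotients of \<open>f (v x)\<close>:
  Lipschitz constant times the bound for those of \<open>v\<close>.\<close>

definition K :: real where "K = L * sqrt (F / c)"

lemma K_nonneg: "0 \<le> K"
  using L_nonneg F_nonneg c_pos by (simp add: K_def)

lemma source_square_bound:
  assumes e: "e > 0"
  defines "G \<equiv> avg e (avg e (avg e (dq e (\<lambda>x. f (v x)))))"
  shows "integrable lborel (\<lambda>x. (G x)\<^sup>2)" "(\<integral>x. (G x)\<^sup>2 \<partial>lborel) \<le> K\<^sup>2"
proof -
  define g where "g = dq e (\<lambda>x. f (v x))"
  have bg: "bounded_borel g" unfolding g_def by (intro bb)
  have [measurable]: "g \<in> borel_measurable borel" using bg by (rule bounded_borel_measurable)
  have le: "(g x)\<^sup>2 \<le> L\<^sup>2 * (dq e v x)\<^sup>2" for x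
  proof -
    have "\<bar>f (v (x + e)) - f (v x)\<bar> \<le> L * \<bar>v (x + e) - v x\<bar>"
      by (rule lip_f) (auto simp: v_ge_0 v_le_1)
    then have "\<bar>g x\<bar> \<le> L * \<bar>dq e v x\<bar>" using e by (simp add: g_def dq_def abs_divide divide_right_mono)
    then have "\<bar>g x\<bar>\<^sup>2 \<le> (L * \<bar>dq e v x\<bar>)\<^sup>2" by (rule power_mono) simp
    then show ?thesis by (simp add: power_mult_distrib)
  qed
  have ig: "integrable lborel (\<lambda>x. (g x)\<^sup>2)"
  proof (rule Bochner_Integration.integrable_bound)
    show "integrable lborel (\<lambda>x. L\<^sup>2 * (dq e v x)\<^sup>2)" using dq_square_bound(1)[OF e] by simp
  qed (use le in auto)
  have "(\<integral>x. (g x)\<^sup>2 \<partial>lborel) \<le> (\<integral>x. L\<^sup>2 * (dq e v x)\<^sup>2 \<partial>lborel)"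
    using le dq_square_bound(1)[OF e] by (intro integral_mono ig) auto
  also have "\<dots> = L\<^sup>2 * (\<integral>x. (dq e v x)\<^sup>2 \<partial>lborel)" by simp
  also have "\<dots> \<le> L\<^sup>2 * (F / c)" by (intro mult_left_mono dq_square_bound(2)[OF e]) simp
  also have "\<dots> = K\<^sup>2" using F_nonneg c_pos by (simp add: K_def power_mult_distrib)
  finally have g2: "(\<integral>x. (g x)\<^sup>2 \<partial>lborel) \<le> K\<^sup>2" .
  note s1 = integral_avg_square_le[OF bg ig, of e]
  note s2 = integral_avg_square_le[OF bounded_borel_avg[OF bg] s1(1), of e]
  note s3 = integral_avg_square_le[OF bounded_borel_avg[OF bounded_borel_avg[OF bg]] s2(1), of e]
  show "integrable lborel (\<lambda>x. (G x)\<^sup>2)" "(\<integral>x. (G x)\<^sup>2 \<partial>lborel) \<le> K\<^sup>2"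
    using s1 s2 s3 g2 unfolding G_def g_def[symmetric] by linarith+
qed

text \<open>The equation for \<open>p = X'\<close> reads \<open>J p + c p' = - G\<close>. Since \<open>J p\<close> and \<open>p'\<close> are orthogonal in
  \<open>L\<^sup>2\<close>, both are controlled by \<open>G\<close>; since the operators \<open>J S\<close> are commuting and of the same sign,
  so is \<open>J S p\<close> for every \<open>S\<close>.\<close>

lemma second_derivative_bounds:
  assumes e: "e > 0" and S: "S \<in> sets borel"
  defines "p \<equiv> avg e (avg e (avg e (dq e v)))" and "p' \<equiv> avg e (avg e (dq e (dq e v)))"
  shows "(p has_real_derivative p' x) (at x)" "continuous_on UNIV p'"
    "integrable lborel (\<lambda>x. (p' x)\<^sup>2)" "(\<integral>x. (p' x)\<^sup>2 \<partial>lborel) \<le> (K / c)\<^sup>2"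
    "integrable lborel (\<lambda>x. (J S p x)\<^sup>2)" "(\<integral>x. (J S p x)\<^sup>2 \<partial>lborel) \<le> K\<^sup>2"
    "\<exists>C. ddb UNIV C p"
proof -
  have e0: "e \<noteq> 0" using e by simp
  define B where "B = dq e v"
  define G where "G = avg e (avg e (avg e (dq e (\<lambda>x. f (v x)))))"
  define Z where "Z = avg e (avg e (avg e v))"
  define p'' where "p'' = avg e (dq e (dq e B))"
  have bB: "bounded_borel B" unfolding B_def by (intro bb)
  have cB: "continuous_on UNIV (avg e B)"
    unfolding B_def avg_dq[OF bounded_borel_v] by (intro continuous_on_dq continuous_avg_v e)
  note d = avg3_derivs[OF bB cB e0, folded p''_def, unfolded B_def, folded p_def p'_def]
  show "(p has_real_derivative p' x) (at x)" "continuous_on UNIV p'" using d by auto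
  have iB: "integrable lborel B"
    unfolding B_def using integrable_dq_antimono[OF antimono_v v_ge_0 v_le_1 e] by auto
  have ip: "integrable lborel p" "integrable lborel p'" "integrable lborel p''"
    unfolding p_def p'_def p''_def B_def[symmetric]
    by (auto intro!: integrable_avg(1) integrable_dq iB bB bounded_borel_avg bounded_borel_dq)
  have bp: "bounded_borel p" "bounded_borel p'" "bounded_borel p''" "bounded_borel G"
    unfolding p_def p'_def p''_def G_def B_def by (auto intro!: bb)
  obtain C0 where C0: "\<And>x. \<bar>p x\<bar> \<le> C0" using bounded_borelE[OF bp(1)] by blast
  obtain C2 where C2: "\<And>x. \<bar>p'' x\<bar> \<le> C2" using bounded_borelE[OF bp(3)] by blast
  define C where "C = 4 * C0 + C2"
  have dp: "ddb T C p" if "T \<in> sets borel" for T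
    unfolding C_def by (rule ddb_C2[OF d(1,2,4) bp(1) C0 C2 that])
  then show "\<exists>C. ddb UNIV C p" by (auto intro!: exI[of _ C])
  have p_eq: "p = dq e Z" unfolding p_def Z_def by (simp add: avg_dq bb)
  have ddZ: "ddb UNIV (4 * 1 + 2 * (2 * 1 / e) / e) Z" unfolding Z_def by (rule ddb_avg3_v[OF e]) simp
  have eqZ: "J UNIV Z x = - (c * avg e (avg e B) x + avg e (avg e (avg e (\<lambda>x. f (v x)))) x)" for x
    using eq[OF e, of x] by (simp add: Z_def B_def)
  \<comment> \<open>Since \<open>p = dq e Z\<close>, the equation for \<open>p\<close> is the
    difference quotient of the equation for \<open>Z\<close>, with \<open>dq e\<close> moved inside
    the averages.\<close>
  have eqp: "J UNIV p x = - G x - c * p' x" for x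
  proof -
    have "J UNIV p x = dq e (J UNIV Z) x" unfolding p_eq by (rule J_dq[OF ddZ])
    also have "\<dots> = - dq e (avg e (avg e (avg e (\<lambda>x. f (v x))))) x - c * dq e (avg e (avg e B)) x"
      by (simp add: dq_def eqZ diff_divide_distrib add_divide_distrib algebra_simps)
    also have "dq e (avg e (avg e B)) = p'" unfolding p'_def B_def by (simp add: avg_dq bb)
    also have "dq e (avg e (avg e (avg e (\<lambda>x. f (v x))))) = G" unfolding G_def by (simp add: avg_dq bb)
    finally show ?thesis .
  qed
  obtain l1 l2 where l: "(v \<longlongrightarrow> l1) at_bot" "(v \<longlongrightarrow> l2) at_top"
    by (rule antimono_limits[OF antimono_v v_ge_0 v_le_1])
  have Zl: "(Z \<longlongrightarrow> l1) at_bot" "(Z \<longlongrightarrow> l2) at_top"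
    unfolding Z_def by (auto intro!: avg3_antimono_tendsto antimono_v bounded_borel_v e l)
  have Zl': "((\<lambda>x. Z (x + e)) \<longlongrightarrow> l1) at_bot" "((\<lambda>x. Z (x + e)) \<longlongrightarrow> l2) at_top"
    by (rule filterlim_compose[OF Zl(1) filterlim_shift(1)] filterlim_compose[OF Zl(2) filterlim_shift(2)])+
  have "(p \<longlongrightarrow> (l1 - l1) / e) at_bot" "(p \<longlongrightarrow> (l2 - l2) / e) at_top"
    unfolding p_eq dq_def by (intro tendsto_intros Zl Zl' e0)+
  then have orth: "(\<integral>x. p' x * J UNIV p x \<partial>lborel) = 0"
    by (intro J_deriv_orthogonal[OF d(1,3) bp(2) ip(2) _ _ dp]) auto
  have L1: "(\<integral>x. \<bar>dd p z x\<bar> \<partial>lborel) \<le> (4 * (\<integral>x. \<bar>p x\<bar> \<partial>lborel) + (\<integral>x. \<bar>p'' x\<bar> \<partial>lborel)) * kern z" for z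
    by (rule integral_abs_dd_le[OF d(1,2,4) bp(3) ip(1,3)])
  have iJ: "integrable lborel (J T p)" and bJ: "bounded_borel (J T p)" if "T \<in> sets borel" for T
    using integrable_J_lborel[OF bp(1) ip(1) dp[OF that] L1] bounded_borel_J[OF dp[OF that]] by auto
  have i: "integrable lborel (\<lambda>x. p' x * p' x)" "integrable lborel (\<lambda>x. p' x * J UNIV p x)"
    "integrable lborel (\<lambda>x. J UNIV p x * J UNIV p x)"
    by (auto intro!: integrable_mult_bounded_borel ip bp iJ bJ)
  have "(\<integral>x. (G x)\<^sup>2 \<partial>lborel) = (\<integral>x. J UNIV p x * J UNIV p x + 2 * c * (p' x * J UNIV p x) + c\<^sup>2 * (p' x * p' x) \<partial>lborel)"
  proof (intro Bochner_Integration.integral_cong refl)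
    fix x have "G x = - (J UNIV p x + c * p' x)" by (simp add: eqp)
    then have "(G x)\<^sup>2 = (J UNIV p x + c * p' x)\<^sup>2" by (simp only: power2_minus)
    then show "(G x)\<^sup>2 = J UNIV p x * J UNIV p x + 2 * c * (p' x * J UNIV p x) + c\<^sup>2 * (p' x * p' x)"
      by (simp add: power2_eq_square algebra_simps)
  qed
  also have "\<dots> = (\<integral>x. J UNIV p x * J UNIV p x \<partial>lborel) + c\<^sup>2 * (\<integral>x. p' x * p' x \<partial>lborel)"
    using i orth by simp
  finally have sum: "(\<integral>x. J UNIV p x * J UNIV p x \<partial>lborel) + c\<^sup>2 * (\<integral>x. p' x * p' x \<partial>lborel) \<le> K\<^sup>2"
    using source_square_bound(2)[OF e] by (simp add: G_def)
  have nn: "0 \<le> (\<integral>x. J UNIV p x * J UNIV p x \<partial>lborel)" "0 \<le> c\<^sup>2 * (\<integral>x. p' x * p' x \<partial>lborel)" by auto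
  show "integrable lborel (\<lambda>x. (p' x)\<^sup>2)" using i(1) by (simp add: power2_eq_square)
  have "c\<^sup>2 * (\<integral>x. p' x * p' x \<partial>lborel) \<le> K\<^sup>2" using sum nn by linarith
  then show "(\<integral>x. (p' x)\<^sup>2 \<partial>lborel) \<le> (K / c)\<^sup>2"
    using c_pos by (simp add: power2_eq_square[of "p' _"] power_divide field_simps)
  have T: "- S \<in> sets borel" using S by auto
  have JJ: "integrable lborel (\<lambda>x. J T p x * J T' p x)" if "T \<in> sets borel" "T' \<in> sets borel" for T T'
    by (intro integrable_mult_bounded_borel iJ bJ that)
  show "integrable lborel (\<lambda>x. (J S p x)\<^sup>2)" using JJ[OF S S] by (simp add: power2_eq_square)
  \<comment> \<open>The cross term of the two parts is nonnegative, so the square integral of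
    \<open>J S p\<close> is bounded by that of \<open>J UNIV p\<close>.\<close>
  have split: "J UNIV p x = J S p x + J (- S) p x" for x
    using J_Un[of S "- S" C p x] dp S T by simp
  have "(\<integral>x. J UNIV p x * J UNIV p x \<partial>lborel) = (\<integral>x. J S p x * J S p x + 2 * (J S p x * J (- S) p x) + J (- S) p x * J (- S) p x \<partial>lborel)"
    unfolding split by (simp add: algebra_simps)
  also have "\<dots> = (\<integral>x. J S p x * J S p x \<partial>lborel) + 2 * (\<integral>x. J S p x * J (- S) p x \<partial>lborel) + (\<integral>x. J (- S) p x * J (- S) p x \<partial>lborel)"
    using JJ S T by simp
  also have "\<dots> \<ge> (\<integral>x. J S p x * J S p x \<partial>lborel)"
    using J_cross_nonneg[OF bp(1) ip(1) dp[OF S] dp[OF T] L1] by simp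
  finally show "(\<integral>x. (J S p x)\<^sup>2 \<partial>lborel) \<le> K\<^sup>2"
    using sum nn unfolding power2_eq_square[of "J S p _"] by linarith
qed


text \<open>Write \<open>H = J S X\<close> with \<open>S = near \<delta>\<close>. Its derivative
  \<open>J S p\<close> is bounded in \<open>L^2\<close>, so \<open>H\<close> is Hoelder and
  replacing it by \<open>avg l H\<close> costs \<open>K * sqrt l\<close>. That average equals
  \<open>J S (avg l X)\<close>, and the second derivative \<open>dq l p\<close> of
  \<open>avg l X\<close> is at most \<open>K / c / sqrt l\<close> because \<open>p\<close> is
  Hoelder. No constant depends on \<open>e\<close>.\<close>

lemma near_part_bound:
  assumes e: "e > 0" and \<delta>: "0 < \<delta>" "\<delta> \<le> 1" and l: "l > 0"
  defines "X \<equiv> avg e (avg e (avg e (avg e v)))"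
  shows "\<bar>J (near \<delta>) X x\<bar> \<le> K * sqrt l + K / c / sqrt l / 2 * small_mass \<delta>"
    "(X has_real_derivative avg e (avg e (avg e (dq e v))) x) (at x)"
    "\<bar>avg e (avg e (avg e (dq e v))) x - avg e (avg e (avg e (dq e v))) y\<bar> \<le> K / c * sqrt \<bar>x - y\<bar>"
proof -
  define S where "S = (near \<delta>)"
  have S: "S \<in> sets borel" unfolding S_def by measurable
  have e0: "e \<noteq> 0" using e by simp
  define Z where "Z = avg e (avg e (avg e v))"
  define p where "p = avg e (avg e (avg e (dq e v)))"
  define p' where "p' = avg e (avg e (dq e (dq e v)))"
  define H where "H = J S X"
  note sd = second_derivative_bounds[OF e S, folded p_def p'_def]
  have bX: "bounded_borel X" "bounded_borel p" "bounded_borel p'" "bounded_borel Z"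
    unfolding X_def p_def p'_def Z_def by (auto intro!: bb)
  have XZ: "X = avg e Z" by (simp add: X_def Z_def)
  have cZ: "continuous_on UNIV Z"
    unfolding Z_def by (intro continuous_on_avg continuous_avg_v e e0)
  have p_eq: "p = dq e Z" unfolding p_def Z_def by (simp add: avg_dq bb)
  have dX: "(X has_real_derivative p x) (at x)" for x
    unfolding XZ p_eq by (rule has_real_derivative_avg[OF cZ e0])
  then show "(X has_real_derivative avg e (avg e (avg e (dq e v))) x) (at x)" by (simp add: p_def)
  have cp: "continuous_on UNIV p" unfolding p_eq by (rule continuous_on_dq[OF cZ])
  have Kc: "0 \<le> K / c" using K_nonneg c_pos by simp
  have holp: "\<bar>p x - p y\<bar> \<le> K / c * sqrt \<bar>x - y\<bar>" for x y
    by (rule holder_of_deriv_square_integrable[OF sd(1,2) bX(3) sd(3,4) Kc])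
  then show "\<bar>avg e (avg e (avg e (dq e v))) x - avg e (avg e (avg e (dq e v))) y\<bar> \<le> K / c * sqrt \<bar>x - y\<bar>"
    by (simp add: p_def)
  define A where "A = 4 * 1 + 2 * (2 * 1 / e) / e"
  have ddZ: "ddb S A Z" unfolding Z_def A_def by (rule ddb_avg3_v[OF e S])
  have ddX: "ddb S A X" unfolding XZ by (rule ddb_avg[OF ddZ])
  have HZ: "H = avg e (J S Z)" unfolding H_def XZ using avg_J[OF ddZ] by auto
  have cJZ: "continuous_on UNIV (J S Z)"
    by (rule continuous_on_J[OF cZ S, of A]) (use ddZ in \<open>auto simp: ddb_def\<close>)
  have dH: "(H has_real_derivative J S p x) (at x)" for x
    using has_real_derivative_avg[OF cJZ e0] unfolding HZ p_eq J_dq[OF ddZ] .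
  obtain C where C: "ddb UNIV C p" using sd(7) by blast
  then have ddp: "ddb S C p" using S by (auto intro: ddb_subset)
  have cJp: "continuous_on UNIV (J S p)"
    by (rule continuous_on_J[OF cp S, of C]) (use ddp in \<open>auto simp: ddb_def\<close>)
  have holH: "\<bar>H x - H y\<bar> \<le> K * sqrt \<bar>x - y\<bar>" for x y
    by (rule holder_of_deriv_square_integrable[OF dH cJp bounded_borel_J[OF ddp] sd(5,6) K_nonneg])
  have bH: "bounded_borel H" unfolding H_def by (rule bounded_borel_J[OF ddX])
  have "H x - K * sqrt l \<le> H y \<and> H y \<le> H x + K * sqrt l" if "x \<le> y" "y \<le> x + l" for y
  proof -
    have "\<bar>H y - H x\<bar> \<le> K * sqrt \<bar>y - x\<bar>" by (rule holH)
    also have "\<dots> \<le> K * sqrt l" using that K_nonneg by (intro mult_left_mono) auto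
    finally show ?thesis unfolding abs_le_iff by linarith
  qed
  from avg_bounds_interval[where x=x, OF bH this less_imp_le[OF l]]
  have 1: "\<bar>H x - avg l H x\<bar> \<le> K * sqrt l" unfolding abs_le_iff by linarith
  have l0: "l \<noteq> 0" using l by simp
  have cX: "continuous_on UNIV X" unfolding XZ by (rule continuous_on_avg[OF cZ e0])
  have dlX: "(avg l X has_real_derivative avg l p x) (at x)" for x
    using has_real_derivative_avg[OF cX l0] dq_eq_avg_deriv[OF dX cp l0] by simp
  have dlp: "(avg l p has_real_derivative dq l p x) (at x)" for x
    by (rule has_real_derivative_avg[OF cp l0])
  have dqp: "\<bar>dq l p x\<bar> \<le> K / c / sqrt l" for x
  proof -
    have "\<bar>p (x + l) - p x\<bar> \<le> K / c * sqrt l" using holp[of "x + l" x] l by simp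
    then have "\<bar>p (x + l) - p x\<bar> / l \<le> K / c * sqrt l / l" using l by (intro divide_right_mono) auto
    then have "\<bar>dq l p x\<bar> \<le> K / c * sqrt l / l" using l by (simp add: dq_def abs_divide)
    also have "\<dots> = K / c / sqrt l" 
      using sqrt_divide_self_eq[OF less_imp_le[OF l]]
      by (simp only: times_divide_eq_right[symmetric]) (simp add: divide_inverse)
    finally show ?thesis .
  qed
  have "ddb S (K / c / sqrt l) (avg l X)"
    unfolding ddb_def
  proof (intro conjI ballI allI S)
    fix z x assume z: "z \<in> S"
    have "\<bar>z\<bar> \<le> 1" using z \<delta> by (simp add: S_def)
    then have kz: "kern z = z\<^sup>2" by (simp add: kern_def abs_square_le_1)
    have "\<bar>avg z (avg z (dq l p)) (x - z)\<bar> \<le> K / c / sqrt l"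
      by (intro avg_abs_le bounded_borel_avg bounded_borel_dq bX dqp)
    then have "z\<^sup>2 * \<bar>avg z (avg z (dq l p)) (x - z)\<bar> \<le> z\<^sup>2 * (K / c / sqrt l)" by (rule mult_left_mono) simp
    then show "\<bar>dd (avg l X) z x\<bar> \<le> K / c / sqrt l * kern z"
      unfolding dd_eq_avg[OF dlX dlp continuous_on_dq[OF cp]] kz by (simp add: abs_mult mult.commute)
  next
    show "0 \<le> K / c / sqrt l" using Kc l by (intro divide_nonneg_nonneg[OF Kc]) simp
  qed (rule bounded_borel_avg[OF bX(1)])
  from J_abs_le[OF this, of x] have "\<bar>avg l H x\<bar> \<le> K / c / sqrt l / 2 * small_mass \<delta>"
    by (simp only: H_def avg_J[OF ddX] small_mass_def) (simp only: S_def)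
  with 1 show "\<bar>J (near \<delta>) X x\<bar> \<le> K * sqrt l + K / c / sqrt l / 2 * small_mass \<delta>"
    unfolding H_def S_def by linarith
qed

theorem classical_solution:
  obtains v' where "\<And>x. (v has_real_derivative v' x) (at x)" "continuous_on UNIV v'"
    "\<And>x. ((\<lambda>\<delta>. J (far \<delta>) v x) \<longlongrightarrow> - (c * v' x + f (v x))) (at_right 0)"
proof -
  define e where "e n = inverse (real (Suc n))" for n
  have e: "e n > 0" "e \<longlonglongrightarrow> 0" for n
    unfolding e_def using LIMSEQ_inverse_real_of_nat by auto
  define X where "X n = avg (e n) (avg (e n) (avg (e n) (avg (e n) v)))" for n
  define p where "p n = avg (e n) (avg (e n) (avg (e n) (dq (e n) v)))" for n
  define g where "g n = avg (e n) (avg (e n) (avg (e n) (avg (e n) (\<lambda>x. f (v x)))))" for n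
  have np: "\<bar>J (near \<delta>) (X n) x\<bar> \<le> K * sqrt l + K / c / sqrt l / 2 * small_mass \<delta>"
    if "0 < \<delta>" "\<delta> \<le> 1" "0 < l" for n \<delta> l x
    unfolding X_def by (rule near_part_bound(1)[OF e(1) that])
  have dX: "(X n has_real_derivative p n x) (at x)" for n x
    unfolding X_def p_def by (rule near_part_bound(2)[OF e(1), of 1 1]) auto
  have hol: "\<bar>p n x - p n y\<bar> \<le> K / c * sqrt \<bar>x - y\<bar>" for n x y
    unfolding p_def by (rule near_part_bound(3)[OF e(1), of 1 1]) auto
  have Xlim: "(\<lambda>n. X n x) \<longlonglongrightarrow> v x" for x
    unfolding X_def by (rule avg4_tendsto(1)[OF bounded_borel_v right_cont_v e(2,1)])
  obtain v' where v': "\<And>x. (v has_real_derivative v' x) (at x)" "continuous_on UNIV v'"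
    "\<And>x. (\<lambda>n. p n x) \<longlonglongrightarrow> v' x"
    using has_derivative_of_holder_limit[OF dX hol Xlim] by blast
  have glim: "(\<lambda>n. g n x) \<longlonglongrightarrow> f (v x)" for x
  proof -
    have "isCont f (v x)" using cont_f by (simp add: continuous_on_eq_continuous_at)
    then have "continuous (at_right x) (\<lambda>x. f (v x))"
      by (intro continuous_within_compose3[OF _ right_cont_v])
    then show ?thesis unfolding g_def by (rule avg4_tendsto(1)[OF bounded_borel_fv _ e(2,1)])
  qed
  \<comment> \<open>One more average of the equation, because the uniform bounds concern the
    fourfold average \<open>X n\<close> and its derivative \<open>p n\<close>.\<close>
  have XJ: "J UNIV (X n) x + c * p n x + g n x = 0" for n x
  proof -
    define Z where "Z = avg (e n) (avg (e n) (avg (e n) v))"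
    have ddZ: "ddb UNIV (4 * 1 + 2 * (2 * 1 / e n) / e n) Z" unfolding Z_def by (rule ddb_avg3_v[OF e(1)]) simp
    have "0 = avg (e n) (\<lambda>x. J UNIV Z x + c * avg (e n) (avg (e n) (dq (e n) v)) x
               + avg (e n) (avg (e n) (avg (e n) (\<lambda>x. f (v x)))) x) x"
      unfolding Z_def eq[OF e(1)] by (simp add: avg_const)
    also have "\<dots> = avg (e n) (J UNIV Z) x + c * p n x + g n x"
      unfolding p_def g_def
      by (subst avg_add, intro bounded_borel_add bounded_borel_cmult bounded_borel_J[OF ddZ] bb, intro bb,
          subst avg_add, intro bounded_borel_J[OF ddZ], intro bounded_borel_cmult bb, simp add: avg_cmult)
    also have "avg (e n) (J UNIV Z) x = J UNIV (X n) x"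
      unfolding avg_J[OF ddZ] by (simp add: Z_def X_def)
    finally show ?thesis by simp
  qed
  have bX: "bounded_borel (X n)" "\<bar>X n x\<bar> \<le> 1" for n x
    unfolding X_def by (intro bb avg_abs_le abs_v_le)+
  \<comment> \<open>The limit \<open>n \<rightarrow> \<infinity>\<close> is taken at fixed
    \<open>\<delta>\<close> and \<open>l\<close>, where the far part converges by dominated
    convergence; the near part enters only through its bound, which is independent of
    \<open>n\<close>.\<close>
  have est: "\<bar>J (far \<delta>) v x - - (c * v' x + f (v x))\<bar> \<le> K * sqrt l + K / c / sqrt l / 2 * small_mass \<delta>"
    if that: "0 < \<delta>" "\<delta> \<le> 1" "0 < l" for \<delta> l x
  proof (rule LIMSEQ_le_const2)
    show "(\<lambda>n. \<bar>J (far \<delta>) (X n) x - - (c * p n x + g n x)\<bar>) \<longlonglongrightarrow> \<bar>J (far \<delta>) v x - - (c * v' x + f (v x))\<bar>"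
      by (intro tendsto_intros v'(3) glim J_far_tendsto bX bounded_borel_v Xlim that)
    have "\<bar>J (far \<delta>) (X n) x - - (c * p n x + g n x)\<bar> \<le> K * sqrt l + K / c / sqrt l / 2 * small_mass \<delta>" for n
    proof -
      have m: "(far \<delta>) \<in> sets borel" "(near \<delta>) \<in> sets borel" by measurable
      have u: "(far \<delta>) \<union> (near \<delta>) = UNIV" by auto
      have "ddb UNIV (4 * 1 + 2 * (2 * 1 / e n) / e n) (X n)"
        unfolding X_def by (rule ddb_avg, rule ddb_avg3_v[OF e(1)]) simp
      then have "J UNIV (X n) x = J (far \<delta>) (X n) x + J (near \<delta>) (X n) x"
        using J_Un[of "far \<delta>" "(near \<delta>)" _ "X n" x] m unfolding u by fastforce
      then show ?thesis using XJ[of n x] np[OF that, of n x] by linarith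
    qed
    then show "\<exists>N. \<forall>n\<ge>N. \<bar>J (far \<delta>) (X n) x - - (c * p n x + g n x)\<bar> \<le> K * sqrt l + K / c / sqrt l / 2 * small_mass \<delta>"
      by blast
  qed
  show ?thesis
  proof (rule that[OF v'(1,2)])
    fix x
    show "((\<lambda>\<delta>. J (far \<delta>) v x) \<longlongrightarrow> - (c * v' x + f (v x))) (at_right 0)"
    proof (rule tendstoI)
      fix r :: real assume r: "r > 0"
      \<comment> \<open>\<open>l\<close> comes before \<open>\<delta>\<close>: the second error
        carries the factor \<open>1 / sqrt l\<close>, which \<open>small_mass \<delta>\<close> then
        compensates.\<close>
      define l where "l = (r / (4 * (K + 1)))\<^sup>2"
      have l: "l > 0" "K * sqrt l < r / 2"
      proof -
        have "r / (4 * (K + 1)) > 0" using r K_nonneg by simp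
        then show "l > 0" unfolding l_def by (rule zero_less_power)
        have "sqrt l = r / (4 * (K + 1))" using r K_nonneg by (simp add: l_def)
        then have "K * sqrt l = (K / (K + 1)) * (r / 4)" by simp
        also have "\<dots> \<le> 1 * (r / 4)" using r K_nonneg by (intro mult_right_mono) auto
        finally show "K * sqrt l < r / 2" using r by simp
      qed
      have "((\<lambda>\<delta>. K / c / sqrt l / 2 * small_mass \<delta>) \<longlongrightarrow> K / c / sqrt l / 2 * 0) (at_right 0)"
        by (intro tendsto_intros small_mass_tendsto)
      then have "\<forall>\<^sub>F \<delta> in at_right 0. K / c / sqrt l / 2 * small_mass \<delta> < r / 2"
        using r by (intro order_tendstoD) auto
      moreover have "\<forall>\<^sub>F \<delta> in at_right 0. \<delta> \<in> {0<..<1::real}"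
        by (rule eventually_at_right_real) simp
      ultimately show "\<forall>\<^sub>F \<delta> in at_right 0. dist (J (far \<delta>) v x) (- (c * v' x + f (v x))) < r"
      proof eventually_elim
        case (elim \<delta>)
        then show ?case using est[of \<delta> l x] l unfolding dist_real_def by auto
      qed
    qed
  qed
qed

text \<open>Letting \<open>x \<rightarrow> \<plusminus>\<infinity>\<close> in the mollified equation, all terms but the reaction vanish.\<close>

lemma limit_is_zero_of_f:
  assumes lim: "\<And>a. (\<lambda>n. v (Y n + a)) \<longlonglongrightarrow> l"
  shows "f l = 0"
proof -
  \<comment> \<open>Width 1 is an arbitrary fixed choice; only the base points \<open>Y n\<close>
    move here.\<close>
  define Z where "Z = avg 1 (avg 1 (avg 1 v))"
  have bZ: "bounded_borel Z" unfolding Z_def by (intro bb)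
  have [measurable]: "Z \<in> borel_measurable borel" using bZ by (rule bounded_borel_measurable)
  have Zl: "(\<lambda>n. Z (Y n + a)) \<longlonglongrightarrow> l" for a
    unfolding Z_def by (intro avg_tendsto_shifts bb lim one_neq_zero)
  have Z2: "(\<lambda>n. avg 1 (avg 1 v) (Y n + a)) \<longlonglongrightarrow> l" for a
    by (intro avg_tendsto_shifts bb lim one_neq_zero)
  have ddZ: "ddb UNIV (4 * 1 + 2 * (2 * 1 / 1) / 1) Z" unfolding Z_def by (rule ddb_avg3_v) simp_all
  have "(\<lambda>n. \<integral>z. indicator UNIV z * dd Z z (Y n) \<partial>N) \<longlonglongrightarrow> (\<integral>z. 0 \<partial>N)"
  proof (rule integral_dominated_convergence)
    show "integrable N (\<lambda>z. (4 * 1 + 2 * (2 * 1 / 1) / 1) * kern z)" using integrable_kern by simp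
    show "AE z in N. norm (indicator UNIV z * dd Z z (Y n)) \<le> (4 * 1 + 2 * (2 * 1 / 1) / 1) * kern z" for n
      unfolding real_norm_def using ddbD[OF ddZ] by (intro AE_I2)
    show "AE z in N. (\<lambda>n. indicator UNIV z * dd Z z (Y n)) \<longlonglongrightarrow> 0"
    proof (rule AE_I2)
      fix z
      have "(\<lambda>n. dd Z z (Y n)) \<longlonglongrightarrow> l + l - 2 * l"
        unfolding dd_def using Zl[of z] Zl[of "-z"] Zl[of 0] by (intro tendsto_intros) auto
      then show "(\<lambda>n. indicator UNIV z * dd Z z (Y n)) \<longlonglongrightarrow> 0" by simp
    qed
  qed measurable
  then have "(\<lambda>n. (\<integral>z. indicator UNIV z * dd Z z (Y n) \<partial>N) / 2) \<longlonglongrightarrow> 0 / 2"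
    by (intro tendsto_divide tendsto_const) auto
  then have JZ: "(\<lambda>n. J UNIV Z (Y n)) \<longlonglongrightarrow> 0" unfolding J_def by simp
  have "avg 1 (avg 1 (dq 1 v)) = dq 1 (avg 1 (avg 1 v))" by (simp add: avg_dq bb)
  moreover have "(\<lambda>n. dq 1 (avg 1 (avg 1 v)) (Y n)) \<longlonglongrightarrow> (l - l) / 1"
    unfolding dq_def using Z2[of 1] Z2[of 0] by (intro tendsto_intros) auto
  ultimately have D: "(\<lambda>n. avg 1 (avg 1 (dq 1 v)) (Y n)) \<longlonglongrightarrow> 0" by simp
  have "isCont f l" using cont_f by (simp add: continuous_on_eq_continuous_at)
  then have fl: "(\<lambda>n. f (v (Y n + a))) \<longlonglongrightarrow> f l" for a by (rule isCont_tendsto_compose[OF _ lim])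
  have "(\<lambda>n. avg 1 (avg 1 (avg 1 (\<lambda>x. f (v x)))) (Y n + 0)) \<longlonglongrightarrow> f l"
    by (intro avg_tendsto_shifts bb fl one_neq_zero)
  then have "(\<lambda>n. J UNIV Z (Y n) + c * avg 1 (avg 1 (dq 1 v)) (Y n)
      + avg 1 (avg 1 (avg 1 (\<lambda>x. f (v x)))) (Y n)) \<longlonglongrightarrow> 0 + c * 0 + f l"
    by (intro tendsto_intros JZ D) simp
  then have "(\<lambda>n. 0) \<longlonglongrightarrow> 0 + c * 0 + f l" unfolding Z_def eq[OF zero_less_one] .
  then show ?thesis using LIMSEQ_unique[OF tendsto_const] by force
qed

end


subsection \<open>Limits of approximate fronts\<close>

lemma avg3_tendsto:
  assumes b: "\<And>n. bounded_borel (u n)" "\<And>n x. \<bar>u n x\<bar> \<le> C" "bounded_borel w"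
    and lim: "\<And>y. y \<notin> D \<Longrightarrow> (\<lambda>n. u n y) \<longlonglongrightarrow> w y" and "countable D" "h \<noteq> 0"
  shows "(\<lambda>n. avg h (avg h (u n)) x) \<longlonglongrightarrow> avg h (avg h w) x"
    "(\<lambda>n. avg h (avg h (avg h (u n))) x) \<longlonglongrightarrow> avg h (avg h (avg h w)) x"
proof -
  have 1: "(\<lambda>n. avg h (u n) y) \<longlonglongrightarrow> avg h w y" for y
    by (rule avg_tendsto[OF b lim assms(5,6)])
  have 2: "(\<lambda>n. avg h (avg h (u n)) y) \<longlonglongrightarrow> avg h (avg h w) y" for y
    by (rule avg_tendsto[where D="{}" and C=C]) (auto intro!: bounded_borel_avg avg_abs_le b 1 assms)
  then show "(\<lambda>n. avg h (avg h (u n)) x) \<longlonglongrightarrow> avg h (avg h w) x" .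
  show "(\<lambda>n. avg h (avg h (avg h (u n))) x) \<longlonglongrightarrow> avg h (avg h (avg h w)) x"
    by (rule avg_tendsto[where D="{}" and C=C]) (auto intro!: bounded_borel_avg avg_abs_le b 2 assms)
qed

lemma continuous_bounded_unit_interval:
  fixes f :: "real \<Rightarrow> real"
  assumes "continuous_on UNIV f"
  obtains F where "\<And>s. s \<in> {0..1} \<Longrightarrow> \<bar>f s\<bar> \<le> F"
proof -
  have "compact (f ` {0..1})"
    using assms by (intro compact_continuous_image) (auto intro: continuous_on_subset)
  then show ?thesis using that compact_imp_bounded bounded_iff by (metis image_eqI real_norm_def)
qed

context jump_measure
begin

text \<open>Averaging moves the truncated jumps and the difference quotient onto \<open>Z n\<close>,
  whose second derivatives are bounded in terms of \<open>e\<close> alone. Dominated convergence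
  then removes the truncation, while the quotient converges to the derivative and the averaged
  residual to 0.\<close>

lemma mollified_equation_of_limit:
  fixes v :: "nat \<Rightarrow> real \<Rightarrow> real" and h \<delta> :: "nat \<Rightarrow> real"
  assumes v: "\<And>n. antimono (v n)" "\<And>n x. 0 \<le> v n x" "\<And>n x. v n x \<le> 1"
    and h: "\<And>n. h n > 0" "h \<longlonglongrightarrow> 0" and \<delta>: "\<And>n. \<delta> n > 0" "\<delta> \<longlonglongrightarrow> 0"
    and f: "continuous_on UNIV f"
    and approx: "\<And>n x. x < real n \<Longrightarrow>
      \<bar>J (far (\<delta> n)) (v n) x + c * dq (h n) (v n) x + f (v n x)\<bar> \<le> inverse (real (Suc n))"
    and w: "antimono w" "\<And>x. 0 \<le> w x" "\<And>x. w x \<le> 1"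
    and lim: "\<And>x. isCont w x \<Longrightarrow> (\<lambda>n. v n x) \<longlonglongrightarrow> w x"
    and e: "e > 0"
  shows "J UNIV (avg e (avg e (avg e w))) x + c * avg e (avg e (dq e w)) x
               + avg e (avg e (avg e (\<lambda>x. f (w x)))) x = 0"
proof -
  define D where "D = {y. \<not> isCont w y}"
  have cD: "countable D"
    unfolding D_def by (rule countable_discontinuities_antimono[OF w(1)])
  have e0: "e \<noteq> 0" using e by simp
  have bv: "bounded_borel (v n)" and bw: "bounded_borel w" for n
    by (rule bounded_borel_antimono[OF v] bounded_borel_antimono[OF w])+
  have av: "\<bar>v n x\<bar> \<le> 1" and aw: "\<bar>w x\<bar> \<le> 1" for n x
    using v(2,3)[of n x] w(2,3)[of x] by simp_all
  have bfv: "bounded_borel (\<lambda>x. f (v n x))" and bfw: "bounded_borel (\<lambda>x. f (w x))" for n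
    by (rule bounded_borel_comp[OF bv f] bounded_borel_comp[OF bw f])+
  note bb = bounded_borel_avg bounded_borel_dq bv bw bfv bfw
  have vlim: "y \<notin> D \<Longrightarrow> (\<lambda>n. v n y) \<longlonglongrightarrow> w y" for y using lim by (simp add: D_def)
  define Z where "Z n = avg e (avg e (avg e (v n)))" for n
  define Zw where "Zw = avg e (avg e (avg e w))"
  define Z' where "Z' n = avg e (avg e (dq e (v n)))" for n
  define Z'' where "Z'' n = avg e (dq e (dq e (v n)))" for n
  define A where "A = 4 * 1 + 2 * (2 * 1 / e) / e"
  define S where "S n = (far (\<delta> n))" for n
  have mS[measurable]: "S n \<in> sets borel" for n unfolding S_def by measurable
  have bZ: "bounded_borel (Z n)" "bounded_borel (Z' n)" "bounded_borel Zw" "bounded_borel (Z'' n)" for n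
    unfolding Z_def Z'_def Zw_def Z''_def by (intro bb)+
  have [measurable]: "Z n \<in> borel_measurable borel" "Zw \<in> borel_measurable borel" for n
    using bZ by (auto intro: bounded_borel_measurable)
  have cv: "continuous_on UNIV (avg e (v n))" for n by (rule continuous_on_avg_antimono[OF v(1) bv e0])
  note d = avg3_derivs[OF bv cv e0, folded Z_def Z'_def Z''_def]
  have Z''b: "\<bar>Z'' n y\<bar> \<le> 2 * (2 * 1 / e) / e" for n y
    unfolding Z''_def by (intro avg_abs_le dq_abs_le bb av e)
  have ddZ: "ddb UNIV A (Z n)" for n
    unfolding A_def
  proof (rule ddb_C2[OF d(1,2,4) bZ(1) _ Z''b])
    show "\<bar>Z n y\<bar> \<le> 1" for y unfolding Z_def by (intro avg_abs_le bb av)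
  qed simp
  have Zlim: "(\<lambda>n. Z n y) \<longlonglongrightarrow> Zw y" for y
    unfolding Z_def Zw_def by (rule avg3_tendsto(2)[OF bv av bw vlim cD e0])
  have JZ: "(\<lambda>n. J (S n) (Z n) x) \<longlonglongrightarrow> J UNIV Zw x"
  proof -
    have "(\<lambda>n. \<integral>z. indicator (S n) z * dd (Z n) z x \<partial>N) \<longlonglongrightarrow> (\<integral>z. indicator UNIV z * dd Zw z x \<partial>N)"
    proof (rule integral_dominated_convergence)
      show "integrable N (\<lambda>z. A * kern z)" using integrable_kern by simp
      show "AE z in N. norm (indicator (S n) z * dd (Z n) z x) \<le> A * kern z" for n
        using ddbD[OF ddb_subset[OF ddZ], of "S n"] by auto
      show "AE z in N. (\<lambda>n. indicator (S n) z * dd (Z n) z x) \<longlonglongrightarrow> indicator UNIV z * dd Zw z x"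
        using AE_N_nonzero
      proof eventually_elim
        case (elim z)
        then have "\<forall>\<^sub>F n in sequentially. \<delta> n < \<bar>z\<bar>" using \<delta>(2) by (intro order_tendstoD) auto
        then have "\<forall>\<^sub>F n in sequentially. indicator (S n) z = (indicator UNIV z :: real)"
          by eventually_elim (simp add: S_def)
        then have "(\<lambda>n. indicator (S n) z :: real) \<longlonglongrightarrow> indicator UNIV z" by (rule tendsto_eventually)
        then show ?case unfolding dd_def by (intro tendsto_intros Zlim)
      qed
    qed measurable
    then show ?thesis unfolding J_def by (intro tendsto_intros) auto
  qed
  have Z'lim: "(\<lambda>n. Z' n x) \<longlonglongrightarrow> avg e (avg e (dq e w)) x"
  proof -
    have "(\<lambda>n. avg e (avg e (v n)) y) \<longlonglongrightarrow> avg e (avg e w) y" for y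
      by (rule avg3_tendsto(1)[OF bv av bw vlim cD e0])
    then have "(\<lambda>n. dq e (avg e (avg e (v n))) x) \<longlonglongrightarrow> dq e (avg e (avg e w)) x"
      unfolding dq_def by (intro tendsto_intros e0)
    then show ?thesis unfolding Z'_def by (simp add: avg_dq bb)
  qed
  have Dlim: "(\<lambda>n. dq (h n) (Z n) x) \<longlonglongrightarrow> avg e (avg e (dq e w)) x"
  proof -
    \<comment> \<open>A difference quotient of \<open>Z n\<close> is an average of
      \<open>Z' n\<close> over the step, and \<open>Z' n\<close> is Lipschitz with the bound of
      \<open>Z'' n\<close> as constant; hence an error linear in \<open>h n\<close>.\<close>
    have close: "\<bar>dq (h n) (Z n) x - Z' n x\<bar> \<le> 2 * (2 * 1 / e) / e * h n" for n
    proof -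
      define B where "B = 2 * (2 * 1 / e) / e"
      have B: "B \<ge> 0" using e by (simp add: B_def)
      have "Z' n x - B * h n \<le> Z' n y \<and> Z' n y \<le> Z' n x + B * h n" if y: "x \<le> y" "y \<le> x + h n" for y
      proof (cases "y = x")
        case True then show ?thesis using B h(1)[of n] by simp
      next
        case False
        then have yx: "y - x \<noteq> 0" by simp
        have "\<bar>dq (y - x) (Z' n) x\<bar> \<le> B"
          unfolding dq_eq_avg_deriv[OF d(2,4) yx] B_def by (intro avg_abs_le bZ Z''b)
        then have "\<bar>Z' n y - Z' n x\<bar> \<le> B * (y - x)"
          using y False by (simp add: dq_def abs_divide divide_le_eq)
        also have "\<dots> \<le> B * h n" using y B by (intro mult_left_mono) auto
        finally show ?thesis unfolding abs_le_iff by linarith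
      qed
      from avg_bounds_interval[where x=x and h="h n", OF bZ(2) this less_imp_le[OF h(1)]]
      have "\<bar>avg (h n) (Z' n) x - Z' n x\<bar> \<le> B * h n" unfolding abs_le_iff by linarith
      moreover have "h n \<noteq> 0" using h(1)[of n] by simp
      ultimately show ?thesis using dq_eq_avg_deriv[OF d(1,3), of "h n" n x] by (simp add: B_def)
    qed
    have "(\<lambda>n. dq (h n) (Z n) x - Z' n x) \<longlonglongrightarrow> 0"
    proof (rule Lim_null_comparison)
      show "\<forall>\<^sub>F n in sequentially. norm (dq (h n) (Z n) x - Z' n x) \<le> 2 * (2 * 1 / e) / e * h n"
        unfolding real_norm_def by (rule always_eventually) (intro allI close)
      have "(\<lambda>n. 2 * (2 * 1 / e) / e * h n) \<longlonglongrightarrow> 2 * (2 * 1 / e) / e * 0" by (rule tendsto_mult_left[OF h(2)])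
      then show "(\<lambda>n. 2 * (2 * 1 / e) / e * h n) \<longlonglongrightarrow> 0" by (simp only: mult_zero_right)
    qed
    from tendsto_add[OF this Z'lim] show ?thesis by simp
  qed
  obtain F where F: "\<And>s. s \<in> {0..1} \<Longrightarrow> \<bar>f s\<bar> \<le> F"
    using continuous_bounded_unit_interval[OF f] by blast
  have flim: "(\<lambda>n. avg e (avg e (avg e (\<lambda>x. f (v n x)))) x) \<longlonglongrightarrow> avg e (avg e (avg e (\<lambda>x. f (w x)))) x"
  proof (rule avg3_tendsto(2)[OF bfv _ bfw _ cD e0])
    show "\<bar>f (v n x)\<bar> \<le> F" for n x using v(2,3) by (intro F) simp
    show "(\<lambda>n. f (v n y)) \<longlonglongrightarrow> f (w y)" if "y \<notin> D" for y
      using f vlim[OF that] by (intro isCont_tendsto_compose[of _ f]) (auto simp: continuous_on_eq_continuous_at)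
  qed
  define R where "R n y = J (S n) (v n) y + c * dq (h n) (v n) y + f (v n y)" for n y
  have ddv: "ddb (S n) (4 * 1 / min 1 ((\<delta> n)\<^sup>2)) (v n)" for n
    unfolding S_def by (rule ddb_far[OF bv av \<delta>(1)])
  have bJ: "bounded_borel (J (S n) (v n))" for n by (rule bounded_borel_J[OF ddv])
  have bR: "bounded_borel (R n)" for n
    unfolding R_def[abs_def] by (intro bounded_borel_add bJ bounded_borel_cmult bb)
  have b2: "bounded_borel (J (S n) (avg e (v n)))" "bounded_borel (J (S n) (avg e (avg e (v n))))" for n
    by (intro bounded_borel_J[OF ddb_avg[OF ddv]] bounded_borel_J[OF ddb_avg[OF ddb_avg[OF ddv]]])+
  have AR: "avg e (avg e (avg e (R n))) y = J (S n) (Z n) y + c * dq (h n) (Z n) y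
      + avg e (avg e (avg e (\<lambda>x. f (v n x)))) y" for n y
  proof -
    note bi = bounded_borel_add bounded_borel_cmult bJ b2 bb
    have 1: "avg e (R n) = (\<lambda>y. J (S n) (avg e (v n)) y + c * dq (h n) (avg e (v n)) y + avg e (\<lambda>x. f (v n x)) y)"
      unfolding R_def[abs_def] 
      by (rule ext, subst avg_add, intro bi, intro bi, subst avg_add, intro bi, intro bi)
        (simp add: avg_J[OF ddv] avg_cmult avg_dq bb)
    have 2: "avg e (avg e (R n)) = (\<lambda>y. J (S n) (avg e (avg e (v n))) y + c * dq (h n) (avg e (avg e (v n))) y
        + avg e (avg e (\<lambda>x. f (v n x))) y)"
      unfolding 1
      by (rule ext, subst avg_add, intro bi, intro bi, subst avg_add, intro bi, intro bi)
        (simp add: avg_J[OF ddb_avg[OF ddv]] avg_cmult avg_dq bb)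
    show ?thesis
      unfolding 2 Z_def
      by (subst avg_add, intro bi, intro bi, subst avg_add, intro bi, intro bi)
        (simp add: avg_J[OF ddb_avg[OF ddb_avg[OF ddv]]] avg_cmult avg_dq bb)
  qed
  \<comment> \<open>The averages at \<open>x\<close> read the residual within
    \<open>{x..x + 4 * e}\<close>, which lies left of \<open>n\<close> for large \<open>n\<close>,
    where the residual is controlled.\<close>
  have "(\<lambda>n. avg e (avg e (avg e (R n))) x) \<longlonglongrightarrow> 0"
  proof (rule Lim_null_comparison)
    show "(\<lambda>n. inverse (real (Suc n))) \<longlonglongrightarrow> 0" by (rule LIMSEQ_inverse_real_of_nat)
    have "\<forall>\<^sub>F n in sequentially. x + 4 * e < real n"
      using eventually_gt_at_top[of "nat \<lceil>x + 4 * e\<rceil>"] by eventually_elim linarith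
    then show "\<forall>\<^sub>F n in sequentially. norm (avg e (avg e (avg e (R n))) x) \<le> inverse (real (Suc n))"
    proof eventually_elim
      case (elim n)
      have "- inverse (real (Suc n)) \<le> R n y \<and> R n y \<le> inverse (real (Suc n))" if "x \<le> y" "y \<le> x + 4 * e" for y
      proof -
        have "y < real n" using that elim by linarith
        from approx[OF this] show ?thesis unfolding R_def S_def abs_le_iff by (intro conjI; linarith)
      qed
      from avg4_bounds(2)[of "R n" x e, OF bR this less_imp_le[OF e]] show ?case by (simp add: abs_le_iff)
    qed
  qed
  moreover have "(\<lambda>n. avg e (avg e (avg e (R n))) x) \<longlonglongrightarrow> J UNIV Zw x + c * avg e (avg e (dq e w)) x
               + avg e (avg e (avg e (\<lambda>x. f (w x)))) x"
    unfolding AR by (intro tendsto_intros JZ Dlim flim)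
  ultimately show ?thesis unfolding Zw_def using LIMSEQ_unique by blast
qed

end


subsection \<open>A monotone scheme\<close>

lemma right_continuous_sequentially:
  fixes u :: "real \<Rightarrow> real"
  assumes "continuous (at_right (x + a)) u" "\<And>i. X i > x" "X \<longlonglongrightarrow> x"
  shows "(\<lambda>i. u (X i + a)) \<longlonglongrightarrow> u (x + a)"
proof -
  have "(u \<longlongrightarrow> u (x + a)) (at_right (x + a))" using assms(1) by (simp add: continuous_within)
  moreover have "(\<lambda>i. X i + a) \<longlonglongrightarrow> x + a" by (intro tendsto_intros assms)
  moreover have "\<forall>i. X i + a \<in> {x + a<..} - {x + a}" using assms(2) by (auto simp: less_imp_neq[symmetric])
  ultimately show ?thesis unfolding tendsto_at_iff_sequentially comp_def
    by (auto dest!: spec[of _ "\<lambda>i. X i + a"])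
qed

lemma right_continuousI:
  fixes u :: "real \<Rightarrow> real"
  assumes "\<And>X. (\<And>i. X i > x) \<Longrightarrow> X \<longlonglongrightarrow> x \<Longrightarrow> (\<lambda>i. u (X i)) \<longlonglongrightarrow> u x"
  shows "continuous (at_right x) u"
  unfolding continuous_within tendsto_at_iff_sequentially comp_def
  using assms by simp

text \<open>A value below \<open>U x\<close> is exceeded by some \<open>u n x\<close>, hence by
  \<open>u n\<close> and then by \<open>U\<close> just right of \<open>x\<close>; monotonicity of
  \<open>U\<close> gives the other inequality. Two-sided continuity need not survive such increasing
  limits.\<close>

lemma right_continuous_SUP_antimono:
  fixes u :: "nat \<Rightarrow> real \<Rightarrow> real"
  assumes u: "\<And>n. antimono (u n)" "\<And>n. continuous (at_right x) (u n)"
    and le: "\<And>n y. u n y \<le> U y" and U: "antimono U" and lim: "(\<lambda>n. u n x) \<longlonglongrightarrow> U x"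
  shows "continuous (at_right x) U"
proof (rule right_continuousI)
  fix X assume X: "\<And>i. X i > x" "X \<longlonglongrightarrow> x"
  show "(\<lambda>i. U (X i)) \<longlonglongrightarrow> U x"
  proof (rule increasing_tendsto)
    show "\<forall>\<^sub>F i in sequentially. U (X i) \<le> U x"
      using antimonoD[OF U less_imp_le[OF X(1)]] by simp
    fix y assume "y < U x"
    then have "\<forall>\<^sub>F n in sequentially. y < u n x" by (rule order_tendstoD(1)[OF lim])
    then obtain n where n: "y < u n x" by (auto dest: eventually_happens)
    have "continuous (at_right (x + 0)) (u n)" using u(2) by simp
    then have "(\<lambda>i. u n (X i)) \<longlonglongrightarrow> u n x"
      using right_continuous_sequentially[of x 0 "u n" X, OF _ X] by simp
    then have "\<forall>\<^sub>F i in sequentially. y < u n (X i)" by (rule order_tendstoD(1)) (rule n)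
    then show "\<forall>\<^sub>F i in sequentially. y < U (X i)"
      by eventually_elim (rule less_le_trans[OF _ le])
  qed
qed

context jump_measure
begin

lemma integrable_indicator_far:
  assumes "\<delta> > 0" shows "integrable N (indicator (far \<delta>) :: real \<Rightarrow> real)"
  using emeasure_far[OF assms] by (intro integrable_real_indicator) auto

lemma J_diff:
  assumes "ddb S C u" "ddb S C' w"
  shows "J S (\<lambda>x. u x - w x) x = J S u x - J S w x"
proof -
  have "(\<integral>z. indicator S z * dd (\<lambda>x. u x - w x) z x \<partial>N) = (\<integral>z. indicator S z * dd u z x - indicator S z * dd w z x \<partial>N)"
    by (intro Bochner_Integration.integral_cong) (auto simp: dd_def algebra_simps)
  also have "\<dots> = (\<integral>z. indicator S z * dd u z x \<partial>N) - (\<integral>z. indicator S z * dd w z x \<partial>N)"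
    by (intro Bochner_Integration.integral_diff integrable_J[OF assms(1)] integrable_J[OF assms(2)])
  finally show ?thesis by (simp add: J_def diff_divide_distrib)
qed

lemma J_nonneg_ge:
  assumes "ddb (far \<delta>) C d" "\<And>x. 0 \<le> d x" "\<delta> > 0"
  shows "- measure N (far \<delta>) * d x \<le> J (far \<delta>) d x"
proof -
  define S where "S = (far \<delta>)"
  have i: "integrable N (indicator S :: real \<Rightarrow> real)" unfolding S_def by (rule integrable_indicator_far[OF assms(3)])
  have "- 2 * measure N S * d x = (\<integral>z. - 2 * d x * indicator S z \<partial>N)"
    by (simp add: S_def)
  also have "\<dots> \<le> (\<integral>z. indicator S z * dd d z x \<partial>N)"
  proof (rule integral_mono)
    show "integrable N (\<lambda>z. indicator S z * dd d z x)" using integrable_J[OF assms(1)] by (simp add: S_def)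
    show "- 2 * d x * indicator S z \<le> indicator S z * dd d z x" for z
      using assms(2)[of "x + z"] assms(2)[of "x - z"] by (auto simp: indicator_def dd_def)
  qed (use i in simp)
  finally show ?thesis by (simp add: J_def S_def)
qed

end

text \<open>\<open>cfl\<close> adds up the rates at which a value can be lost in one Euler step:
  jumps, drift and reaction. The Lipschitz range extends to \<open>B\<close> because the barrier
  \<open>wt\<close> may exceed 1. The barrier is a supersolution on \<open>{- a..R}\<close> and for
  speed \<open>\<kappa>\<close>; left of \<open>- a\<close>, being at least 1 takes over.\<close>

locale monotone_scheme = jump_measure +
  fixes f wt :: "real \<Rightarrow> real" and L B c \<kappa> \<delta> h \<tau> k a R :: real
  assumes f0: "f 0 = 0" and f1: "f 1 = 0"
    and cont_f: "continuous_on UNIV f"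
    and lip_f: "\<And>s t. s \<in> {0..B} \<Longrightarrow> t \<in> {0..B} \<Longrightarrow> \<bar>f s - f t\<bar> \<le> L * \<bar>s - t\<bar>" and L_nonneg: "0 \<le> L"
    and B: "1 \<le> B" and \<kappa>: "0 < \<kappa>" "\<kappa> \<le> c" and \<delta>: "0 < \<delta>" and h: "0 < h" and \<tau>: "0 < \<tau>"
    and cfl: "\<tau> * (measure N (far \<delta>) + c / h + L) \<le> 1"
    and k: "0 < k" "k < 1" and aR: "- a \<le> R"
    and wt: "bounded_borel wt" "\<And>x. 0 \<le> wt x" "\<And>x. wt x \<le> B" "\<And>x. x \<le> - a \<Longrightarrow> 1 \<le> wt x"
    and super: "\<And>x. - a \<le> x \<Longrightarrow> x \<le> R \<Longrightarrow> J (far \<delta>) wt x + \<kappa> * dq h wt x + f (wt x) \<le> 0"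
begin

definition S :: "real set" where "S = (far \<delta>)"

text \<open>The speed is an argument because the iteration runs at \<open>c\<close> while the
  barrier is tested at \<open>\<kappa>\<close>. The forward quotient is the upwind one:
  \<open>u (x + h)\<close> enters with a nonnegative weight when \<open>b \<ge> 0\<close>.\<close>

definition Q :: "real \<Rightarrow> (real \<Rightarrow> real) \<Rightarrow> real \<Rightarrow> real" where
  "Q b u x = u x + \<tau> * (J S u x + b * dq h u x + f (u x))"

lemma ddb_S: "bounded_borel u \<Longrightarrow> \<exists>C. ddb S C u"
  unfolding S_def using ddb_far[OF _ _ \<delta>] by (meson bounded_borelE)

text \<open>For \<open>d = w - u\<close> the neighbouring values contribute nonnegatively, so one
  step loses at most \<open>\<tau> * (m + c / h + L) * d x\<close>, and \<open>cfl\<close> bounds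
  this by \<open>d x\<close>.\<close>

lemma Q_mono:
  assumes u: "bounded_borel u" "bounded_borel w" "\<And>x. u x \<le> w x" "\<And>x. 0 \<le> u x" "\<And>x. w x \<le> B"
    and b: "0 \<le> b" "b \<le> c"
  shows "Q b u x \<le> Q b w x"
proof -
  define m where "m = measure N S"
  define d where "d = (\<lambda>x. w x - u x)"
  have d0: "0 \<le> d x" for x using u(3) by (simp add: d_def)
  have bd: "bounded_borel d" unfolding d_def by (intro bounded_borel_diff u)
  obtain C where C: "ddb S C d" using ddb_S[OF bd] by blast
  obtain C1 C2 where C12: "ddb S C1 w" "ddb S C2 u" using ddb_S u by metis
  have J: "- m * d x \<le> J S w x - J S u x"
    using J_nonneg_ge[OF C[unfolded S_def] d0 \<delta>, of x] J_diff[OF C12, of x] by (simp add: d_def S_def m_def)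
  have "dq h w x - dq h u x = (d (x + h) - d x) / h" by (simp add: dq_def d_def diff_divide_distrib)
  also have "\<dots> \<ge> - d x / h" using d0[of "x + h"] h by (intro divide_right_mono) auto
  finally have "b * (- d x / h) \<le> b * (dq h w x - dq h u x)" using b by (intro mult_left_mono)
  moreover have "b * d x / h \<le> c * d x / h" using b h d0 by (intro divide_right_mono mult_right_mono) auto
  ultimately have D: "- (c / h) * d x \<le> b * dq h w x - b * dq h u x" by (simp add: algebra_simps)
  have "\<bar>f (w x) - f (u x)\<bar> \<le> L * \<bar>w x - u x\<bar>"
    using u(3)[of x] u(4)[of x] u(5)[of x] by (intro lip_f) auto
  then have Fd: "- L * d x \<le> f (w x) - f (u x)" using d0[of x] by (simp add: d_def)
  have "\<tau> * (- ((m + c / h + L) * d x)) \<le> \<tau> * ((J S w x + b * dq h w x + f (w x)) - (J S u x + b * dq h u x + f (u x)))"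
    using J D Fd \<tau> by (intro mult_left_mono) (simp_all add: algebra_simps)
  moreover have "\<tau> * (m + c / h + L) * d x \<le> 1 * d x"
    using cfl d0[of x] by (intro mult_right_mono) (simp_all add: m_def S_def)
  moreover have "d x = w x - u x" by (simp add: d_def)
  ultimately show ?thesis
    unfolding Q_def right_diff_distrib[of \<tau>] mult_minus_right mult.assoc[of \<tau>, symmetric] by linarith
qed

lemma Q_shift: "Q b (\<lambda>x. u (x + y)) x = Q b u (x + y)"
  by (simp add: Q_def J_shift dq_def algebra_simps)

lemma Q_const_01: "Q b (\<lambda>_. 0) x = 0" "Q b (\<lambda>_. 1) x = 1"
  by (simp_all add: Q_def J_def dd_def dq_def f0 f1)

definition good :: "(real \<Rightarrow> real) \<Rightarrow> bool" where
  "good u \<longleftrightarrow> antimono u \<and> (\<forall>x. 0 \<le> u x) \<and> (\<forall>x. u x \<le> 1) \<and> (\<forall>x. u x \<le> wt x)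
     \<and> (\<forall>x. continuous (at_right x) u)"

lemma good_bounded_borel: "good u \<Longrightarrow> bounded_borel u"
  unfolding good_def by (intro bounded_borel_antimono) auto

text \<open>The plateau \<open>k\<close> keeps the iteration started at 0 away from the zero
  solution; the cutoff at \<open>R\<close> matches the bounded range of the barrier inequality. Both
  act on open left half-lines, so decreasing right-continuous functions stay such.\<close>

definition T :: "(real \<Rightarrow> real) \<Rightarrow> real \<Rightarrow> real" where
  "T u x = max (if x < - a then k else 0) (if x < R then Q c u x else 0)"

lemma Q_range:
  assumes "good u" shows "0 \<le> Q c u x" "Q c u x \<le> 1"
  using Q_mono[of "\<lambda>_. 0" u c x] Q_mono[of u "\<lambda>_. 1" c x] good_bounded_borel[OF assms] assms B \<kappa>
  by (auto simp: good_def Q_const_01 bounded_borel_const intro: order_trans)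

lemma Q_antimono:
  assumes "good u" shows "antimono (Q c u)"
proof (rule antimonoI)
  fix x y :: real assume xy: "x \<le> y"
  have b: "bounded_borel u" by (rule good_bounded_borel[OF assms])
  have u: "antimono u" "\<And>x. 0 \<le> u x" "\<And>x. u x \<le> 1" using assms by (auto simp: good_def)
  have "Q c (\<lambda>z. u (z + (y - x))) x \<le> Q c u x"
  proof (rule Q_mono[OF bounded_borel_shift[OF b] b])
    show "u (z + (y - x)) \<le> u z" for z using xy by (intro antimonoD[OF u(1)]) simp
    show "u z \<le> B" for z using u(3)[of z] B by simp
  qed (use u \<kappa> in auto)
  then show "Q c u y \<le> Q c u x" by (simp add: Q_shift)
qed

text \<open>Letting function and base point vary together serves three purposes: right continuity of
  \<open>T u\<close>, passage to the limit in the iteration, and the behaviour of a fixed point at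
  \<open>-\<infinity>\<close>.\<close>

lemma Q_tendsto:
  assumes u: "\<And>n. bounded_borel (u n)" "\<And>n x. \<bar>u n x\<bar> \<le> 1" "bounded_borel w"
    and X: "\<And>y. (\<lambda>n. u n (X n + y)) \<longlonglongrightarrow> w (x + y)"
  shows "(\<lambda>n. Q c (u n) (X n)) \<longlonglongrightarrow> Q c w x"
proof -
  define un where "un n y = u n (X n - x + y)" for n y
  have un: "bounded_borel (un n)" for n
    using bounded_borel_shift[OF u(1), of n "X n - x"] by (simp add: un_def[abs_def] add.commute)
  have lim: "(\<lambda>n. un n y) \<longlonglongrightarrow> w y" for y
    using X[of "y - x"] by (simp add: un_def algebra_simps)
  have "isCont f (w x)" using cont_f by (simp add: continuous_on_eq_continuous_at)
  then have "(\<lambda>n. f (un n x)) \<longlonglongrightarrow> f (w x)" by (rule isCont_tendsto_compose[OF _ lim])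
  moreover have "(\<lambda>n. J S (un n) x) \<longlonglongrightarrow> J S w x"
    unfolding S_def by (rule J_far_tendsto[OF un _ u(3) lim \<delta>]) (simp add: un_def u(2))
  moreover have "h \<noteq> 0" using h by simp
  ultimately have "(\<lambda>n. Q c (un n) x) \<longlonglongrightarrow> Q c w x"
    unfolding Q_def dq_def by (intro tendsto_intros lim)
  moreover have "Q c (un n) x = Q c (u n) (X n)" for n
    using Q_shift[of c "u n" "X n - x" x] by (simp add: un_def[abs_def] add.commute)
  ultimately show ?thesis by simp
qed

lemma good_T:
  assumes g: "good u" shows "good (T u)"
proof -
  have b: "bounded_borel u" by (rule good_bounded_borel[OF g])
  have u: "antimono u" "\<And>x. 0 \<le> u x" "\<And>x. u x \<le> 1" "\<And>x. u x \<le> wt x" "\<And>x. continuous (at_right x) u"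
    using g by (auto simp: good_def)
  have T0: "0 \<le> T u x" for x using k by (auto simp: T_def le_max_iff_disj)
  have T1: "T u x \<le> 1" for x using k Q_range[OF g] by (simp add: T_def)
  have "T u x \<le> wt x" for x
  proof (cases "x < - a")
    case True
    then show ?thesis using T1[of x] wt(4)[of x] by linarith
  next
    case xa: False
    show ?thesis
    proof (cases "x < R")
      case True
      \<comment> \<open>For decreasing \<open>u\<close> a larger speed lowers the step, so the step
        at speed \<open>c\<close> lies below the one at speed \<open>\<kappa>\<close>, where the
        barrier can be compared.\<close>
      have "dq h u x \<le> 0"
        using antimonoD[OF u(1), of x "x + h"] h by (simp add: dq_def divide_nonpos_pos)
      then have "c * dq h u x \<le> \<kappa> * dq h u x" using \<kappa> by (intro mult_right_mono_neg)
      then have "Q c u x \<le> Q \<kappa> u x" using \<tau> by (simp add: Q_def)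
      also have "\<dots> \<le> Q \<kappa> wt x" by (rule Q_mono[OF b wt(1) u(4,2) wt(3)]) (use \<kappa> in auto)
      also have "\<dots> \<le> wt x"
        using super[of x] True xa \<tau> by (auto simp: Q_def S_def mult_nonneg_nonpos)
      finally show ?thesis using True xa wt(2)[of x] by (simp add: T_def)
    next
      case False
      then show ?thesis using xa wt(2)[of x] by (simp add: T_def)
    qed
  qed
  moreover have "antimono (T u)"
  proof (rule antimonoI)
    fix x y :: real assume "x \<le> y"
    then show "T u y \<le> T u x"
      using antimonoD[OF Q_antimono[OF g], of x y] Q_range[OF g] k
      unfolding T_def by (intro max.mono) auto
  qed
  moreover have "continuous (at_right x) (T u)" for x
  proof (rule right_continuousI)
    fix X assume X: "\<And>i. X i > x" "X \<longlonglongrightarrow> x"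
    have "(\<lambda>i. Q c u (X i)) \<longlonglongrightarrow> Q c u x"
      by (rule Q_tendsto[of "\<lambda>_. u", OF b _ b]) (use u in \<open>auto intro!: right_continuous_sequentially X\<close>)
    moreover have ind: "(\<lambda>i. if X i < r then s i else 0) \<longlonglongrightarrow> (if x < r then l else 0)"
      if s: "s \<longlonglongrightarrow> l" for r l :: real and s
    proof (cases "x < r")
      case True
      then have "\<forall>\<^sub>F i in sequentially. X i < r" by (rule order_tendstoD(2)[OF X(2)])
      then have "\<forall>\<^sub>F i in sequentially. s i = (if X i < r then s i else 0)" by eventually_elim simp
      from Lim_transform_eventually[OF s this] True show ?thesis by simp
    next
      case False
      then have "\<not> X i < r" for i using X(1)[of i] by linarith
      then show ?thesis using False by simp
    qed
    ultimately show "(\<lambda>i. T u (X i)) \<longlonglongrightarrow> T u x"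
      unfolding T_def by (intro tendsto_max ind tendsto_const)
  qed
  ultimately show ?thesis using T0 T1 by (auto simp: good_def)
qed

lemma T_mono:
  assumes "good u" "good w" "\<And>x. u x \<le> w x" shows "T u x \<le> T w x"
proof -
  have "Q c u x \<le> Q c w x"
  proof (rule Q_mono)
    show "w x \<le> B" for x using assms(2) B by (auto simp: good_def intro: order_trans)
  qed (use assms good_bounded_borel \<kappa> in \<open>auto simp: good_def\<close>)
  then show ?thesis unfolding T_def by (intro max.mono) auto
qed

lemma T_fixpoint: "\<exists>U. good U \<and> (\<forall>x. U x = T U x)"
proof -
  define u where "u n = (T ^^ n) (\<lambda>_. 0)" for n
  have g0: "good (\<lambda>_. 0)" by (auto simp: good_def antimono_def wt)
  have g: "good (u n)" for n
    unfolding u_def by (induction n) (auto intro: g0 good_T)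
  have u_Suc: "u (Suc n) = T (u n)" for n by (simp add: u_def)
  have inc: "u n x \<le> u (Suc n) x" for n x
  proof (induction n arbitrary: x)
    case 0 show ?case using g[of 1] by (simp add: u_def good_def)
  next
    case (Suc n) show ?case using T_mono[OF g g Suc.IH] by (simp add: u_Suc)
  qed
  have b: "0 \<le> u n x" "u n x \<le> 1" "u n x \<le> wt x" for n x using g[of n] by (auto simp: good_def)
  define U where "U x = (SUP n. u n x)" for x
  have bdd: "bdd_above (range (\<lambda>n. u n x))" for x using b(2) by (auto intro: bdd_aboveI[of _ 1])
  have lim: "(\<lambda>n. u n x) \<longlonglongrightarrow> U x" for x
    unfolding U_def using inc bdd by (intro LIMSEQ_incseq_SUP incseq_SucI)
  have le: "u n x \<le> U x" for n x unfolding U_def using bdd by (intro cSUP_upper) auto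
  have "antimono U"
  proof (rule antimonoI)
    fix x y :: real assume "x \<le> y"
    then have "u n y \<le> u n x" for n using g[of n] by (auto simp: good_def dest: antimonoD)
    then show "U y \<le> U x" by (intro LIMSEQ_le[OF lim lim]) auto
  qed
  moreover have "continuous (at_right x) U" for x
    by (rule right_continuous_SUP_antimono[OF _ _ le \<open>antimono U\<close> lim]) (use g in \<open>auto simp: good_def\<close>)
  moreover have "0 \<le> U x" for x using b(1)[of 0 x] le[of 0 x] by linarith
  moreover have "U x \<le> 1" "U x \<le> wt x" for x unfolding U_def by (intro cSUP_least b; simp)+
  ultimately have gU: "good U" by (simp add: good_def)
  show ?thesis
  proof (intro exI[of _ U] conjI allI gU)
    fix x
    have "(\<lambda>n. Q c (u n) x) \<longlonglongrightarrow> Q c U x"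
      by (rule Q_tendsto[of u U "\<lambda>_. x"]) (use b lim good_bounded_borel g gU in auto)
    then have "(\<lambda>n. T (u n) x) \<longlonglongrightarrow> T U x"
      unfolding T_def by (cases "x < R") (auto intro!: tendsto_max)
    then have "(\<lambda>n. u (Suc n) x) \<longlonglongrightarrow> T U x" by (simp add: u_Suc)
    with lim show "U x = T U x" using LIMSEQ_unique LIMSEQ_Suc by blast
  qed
qed

text \<open>A fixed point satisfies the discrete equation up to the plateau, so the residual lies
  between \<open>- k / \<tau>\<close> and 0. The front is centred where it crosses
  \<open>\<theta>\<close>. As \<open>wt x1 \<le> \<theta>\<close>, this happens no further right
  than \<open>x1\<close>, so the centred front satisfies the equation up to
  \<open>R - x1\<close>.\<close>

lemma approximate_front:
  assumes f_pos: "\<And>s. s \<in> {0<..<1} \<Longrightarrow> 0 < f s" and \<theta>: "0 < \<theta>" "\<theta> < 1" and x1: "wt x1 \<le> \<theta>"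
  obtains v where "antimono v" "\<And>x. 0 \<le> v x" "\<And>x. v x \<le> 1" "\<And>x. continuous (at_right x) v"
    "\<And>x. x < 0 \<Longrightarrow> \<theta> \<le> v x" "\<And>x. 0 < x \<Longrightarrow> v x \<le> \<theta>"
    "\<And>x. x < R - x1 \<Longrightarrow> \<bar>J (far \<delta>) v x + c * dq h v x + f (v x)\<bar> \<le> k / \<tau>"
proof -
  obtain U where U: "good U" "\<And>x. U x = T U x" using T_fixpoint by blast
  have u: "antimono U" "\<And>x. 0 \<le> U x" "\<And>x. U x \<le> 1" "\<And>x. U x \<le> wt x" "\<And>x. continuous (at_right x) U"
    using U(1) by (auto simp: good_def)
  have bU: "bounded_borel U" by (rule good_bounded_borel[OF U(1)])
  define E where "E x = J S U x + c * dq h U x + f (U x)" for x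
  have QE: "Q c U x = U x + \<tau> * E x" for x by (simp add: Q_def E_def)
  have fix_R: "U x = max (if x < - a then k else 0) (Q c U x)" if "x < R" for x
    using U(2)[of x] that by (simp add: T_def)
  have E_le: "E x \<le> 0" if "x < R" for x
  proof -
    have "U x + \<tau> * E x \<le> U x" using fix_R[OF that] unfolding QE by (metis max.cobounded2)
    then show ?thesis using \<tau> by (simp add: mult_le_0_iff)
  qed
  have E_ge: "\<bar>E x\<bar> \<le> k / \<tau>" if "x < R" for x
  proof -
    have "U x \<le> Q c U x + k" using fix_R[OF that] Q_range(1)[OF U(1), of x] k by (auto simp: max_def split: if_splits)
    then have "- (\<tau> * E x) \<le> k" by (simp add: QE)
    then have "- E x \<le> k / \<tau>" using \<tau> by (simp add: field_simps)
    moreover have "0 \<le> k / \<tau>" using k \<tau> by simp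
    ultimately show ?thesis using E_le[OF that] by simp
  qed
  \<comment> \<open>Otherwise the limit \<open>l\<close> at \<open>-\<infinity>\<close> lies between
    0 and \<open>\<theta>\<close>, and is positive thanks to the plateau. Constants are moved by
    \<open>Q\<close> through the reaction alone, so \<open>Q c U \<le> U\<close> would give
    \<open>f l \<le> 0\<close> in the limit.\<close>
  have "\<exists>x0. \<theta> < U x0"
  proof (rule ccontr)
    assume "\<not> ?thesis"
    then have le: "U x \<le> \<theta>" for x by (simp add: not_less)
    obtain l l2 where l: "(U \<longlongrightarrow> l) at_bot" "\<And>x. U x \<le> l"
      using antimono_limits[OF u(1-3)] by metis
    have "l \<le> \<theta>" using l(1) le by (intro tendsto_upperbound[OF l(1)]) auto
    have "min (- a) R - 1 < R" "min (- a) R - 1 < - a" by linarith+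
    then have "U (min (- a) R - 1) \<ge> k" using fix_R[of "min (- a) R - 1"] by simp
    then have "0 < l" using k l(2)[of "min (- a) R - 1"] by linarith
    have "(\<lambda>n. Q c U (- real n)) \<longlonglongrightarrow> Q c (\<lambda>_. l) 0"
    proof (rule Q_tendsto[of "\<lambda>_. U" "\<lambda>_. l" _ 0])
      show "(\<lambda>n. U (- real n + y)) \<longlonglongrightarrow> l" for y by (rule filterlim_compose[OF l(1) filterlim_real_shift(1)])
      show "\<bar>U x\<bar> \<le> 1" for x using u(2,3)[of x] by simp
    qed (intro bU bounded_borel_const)+
    moreover have "Q c (\<lambda>_. l) 0 = l + \<tau> * f l" by (simp add: Q_def J_def dd_def dq_def)
    moreover have "\<forall>\<^sub>F n in sequentially. Q c U (- real n) \<le> l"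
    proof -
      have "\<forall>\<^sub>F n in sequentially. - real n < R"
        using eventually_gt_at_top[of "nat \<lceil>- R\<rceil>"] by eventually_elim linarith
      then show ?thesis
      proof eventually_elim
        case (elim n)
        have "Q c U (- real n) \<le> U (- real n)" unfolding QE using E_le[OF elim] \<tau> by (simp add: mult_nonneg_nonpos)
        also have "\<dots> \<le> l" by (rule l(2))
        finally show ?case .
      qed
    qed
    ultimately have "l + \<tau> * f l \<le> l" by (metis tendsto_upperbound sequentially_bot)
    moreover have "0 < f l" using \<open>0 < l\<close> \<open>l \<le> \<theta>\<close> \<theta> by (intro f_pos) auto
    ultimately show False using \<tau> by (simp add: mult_le_0_iff)
  qed
  then obtain x0 where x0: "\<theta> < U x0" by blast
  define A where "A = {x. \<theta> < U x}"
  define s where "s = Sup A"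
  have A_le: "x \<le> x1" if "x \<in> A" for x
  proof (rule ccontr)
    assume "\<not> x \<le> x1"
    then have "U x \<le> U x1" by (intro antimonoD[OF u(1)]) simp
    also have "\<dots> \<le> \<theta>" using u(4)[of x1] x1 by linarith
    finally show False using that by (simp add: A_def)
  qed
  have A: "A \<noteq> {}" "bdd_above A" using x0 A_le by (auto simp: A_def intro: bdd_aboveI[of _ x1])
  have s: "s \<le> x1" unfolding s_def using A A_le by (intro cSup_least) auto
  define v where "v x = U (x + s)" for x
  have bv: "bounded_borel v" unfolding v_def[abs_def] by (rule bounded_borel_shift[OF bU])
  show ?thesis
  proof (rule that[of v])
    show "antimono v" by (rule antimonoI) (auto simp: v_def intro!: antimonoD[OF u(1)])
    show "0 \<le> v x" "v x \<le> 1" for x using u by (auto simp: v_def)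
    show "continuous (at_right x) v" for x
      unfolding v_def by (rule right_continuousI) (auto intro!: right_continuous_sequentially u(5))
    show "\<theta> \<le> v x" if "x < 0" for x
    proof -
      have "x + s < Sup A" using that by (simp add: s_def)
      then obtain y where "y \<in> A" "x + s < y" using A by (auto simp: less_cSup_iff)
      then have "\<theta> < U y" "U y \<le> U (x + s)" by (auto simp: A_def intro: antimonoD[OF u(1)])
      then show ?thesis by (simp add: v_def)
    qed
    show "v x \<le> \<theta>" if "0 < x" for x
    proof (rule ccontr)
      assume "\<not> v x \<le> \<theta>"
      then have "x + s \<in> A" by (simp add: A_def v_def)
      then have "x + s \<le> s" unfolding s_def using A by (intro cSup_upper) auto
      then show False using that by simp
    qed
    show "\<bar>J (far \<delta>) v x + c * dq h v x + f (v x)\<bar> \<le> k / \<tau>" if "x < R - x1" for x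
    proof -
      have "J (far \<delta>) v x = J S U (x + s)" unfolding v_def[abs_def] S_def by (rule J_shift)
      then have "J (far \<delta>) v x + c * dq h v x + f (v x) = E (x + s)"
        by (simp add: E_def v_def dq_def algebra_simps)
      then show ?thesis using E_ge[of "x + s"] that s by simp
    qed
  qed
qed

end


subsection \<open>Discretizing the supersolution\<close>

text \<open>The intermediate point stays within \<open>\<bar>z\<bar>\<close> of \<open>x\<close>, so
  local bounds on \<open>q''\<close> suffice, as for the supersolution.\<close>

lemma dd_mean_value:
  fixes q :: "real \<Rightarrow> real"
  assumes q: "\<And>x. (q has_real_derivative q' x) (at x)" "\<And>x. (q' has_real_derivative q'' x) (at x)"
  obtains \<eta> where "\<bar>\<eta> - x\<bar> \<le> \<bar>z\<bar>" "dd q z x = z\<^sup>2 * q'' \<eta>"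
proof -
  have pos: "\<exists>\<eta>. \<bar>\<eta> - x\<bar> \<le> z \<and> dd q z x = z\<^sup>2 * q'' \<eta>" if z: "z > 0" for z
  proof -
    define r where "r y = q (y + z) - q y" for y
    have "(r has_real_derivative (q' (y + z) - q' y)) (at y)" for y
      unfolding r_def by (auto intro!: derivative_eq_intros q DERIV_chain2[OF q(1)])
    then obtain \<xi> where \<xi>: "x - z < \<xi>" "\<xi> < x" "r x - r (x - z) = (x - (x - z)) * (q' (\<xi> + z) - q' \<xi>)"
      using MVT2[of "x - z" x r "\<lambda>y. q' (y + z) - q' y"] z by auto
    obtain \<eta> where \<eta>: "\<xi> < \<eta>" "\<eta> < \<xi> + z" "q' (\<xi> + z) - q' \<xi> = (\<xi> + z - \<xi>) * q'' \<eta>"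
      using MVT2[of \<xi> "\<xi> + z" q' q''] z q by auto
    show ?thesis
      using \<xi> \<eta> by (intro exI[of _ \<eta>]) (auto simp: r_def dd_def power2_eq_square abs_le_iff)
  qed
  have "\<exists>\<eta>. \<bar>\<eta> - x\<bar> \<le> \<bar>z\<bar> \<and> dd q z x = z\<^sup>2 * q'' \<eta>"
  proof (cases z "0::real" rule: linorder_cases)
    case less
    have "dd q z x = dd q (- z) x" by (simp add: dd_def)
    then show ?thesis using pos[of "- z"] less by simp
  next
    case equal
    then show ?thesis by (intro exI[of _ x]) (simp add: dd_def)
  next
    case greater then show ?thesis using pos[of z] by simp
  qed
  then show ?thesis using that by blast
qed

lemma continuous_negative_margin:
  fixes H :: "real \<Rightarrow> real"
  assumes "continuous_on {a..b} H" "\<And>x. x \<in> {a..b} \<Longrightarrow> H x < 0"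
  obtains m where "m > 0" "\<And>x. x \<in> {a..b} \<Longrightarrow> H x \<le> - m"
proof (cases "{a..b} = {}")
  case True then show ?thesis using that[of 1] by simp
next
  case False
  then obtain y where y: "y \<in> {a..b}" "\<And>x. x \<in> {a..b} \<Longrightarrow> H x \<le> H y"
    using continuous_attains_sup[OF compact_Icc False assms(1)] by blast
  show ?thesis by (rule that[of "- H y"]) (use y assms(2) in auto)
qed

lemma C1_lipschitz:
  fixes f :: "real \<Rightarrow> real"
  assumes f: "\<And>x. (f has_real_derivative f' x) (at x)" "continuous_on UNIV f'"
  obtains L where "0 \<le> L" "\<And>s t. s \<in> {a..b} \<Longrightarrow> t \<in> {a..b} \<Longrightarrow> \<bar>f s - f t\<bar> \<le> L * \<bar>s - t\<bar>"
proof -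
  have "compact (f' ` {a..b})"
    using f(2) by (intro compact_continuous_image) (auto intro: continuous_on_subset)
  then obtain L where L: "\<And>s. s \<in> {a..b} \<Longrightarrow> \<bar>f' s\<bar> \<le> L"
    using compact_imp_bounded bounded_iff by (metis image_eqI real_norm_def)
  show ?thesis
  proof (rule that[of "\<bar>L\<bar>"])
    fix s t assume st: "s \<in> {a..b}" "t \<in> {a..b}"
    have "norm (f s - f t) \<le> \<bar>L\<bar> * norm (s - t)"
    proof (rule field_differentiable_bound[of "{a..b}" f f'])
      show "norm (f' x) \<le> \<bar>L\<bar>" if "x \<in> {a..b}" for x using L[OF that] by simp
    qed (use st f(1) in \<open>auto intro: has_field_derivative_at_within\<close>)
    then show "\<bar>f s - f t\<bar> \<le> \<bar>L\<bar> * \<bar>s - t\<bar>" by simp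
  qed simp
qed

text \<open>This is where \<open>f' 1 < 0\<close> enters: near \<open>s = 1\<close>, multiplication by \<open>1 + \<eta>\<close> preserves
  supersolutions.\<close>

lemma scaling_near_stable_zero:
  fixes f :: "real \<Rightarrow> real"
  assumes f: "\<And>x. (f has_real_derivative f' x) (at x)" "continuous_on UNIV f'" and "f 1 = 0" "f' 1 < 0"
  obtains \<epsilon> where "0 < \<epsilon>" "\<epsilon> < 1"
    "\<And>s \<eta>. \<bar>s - 1\<bar> \<le> \<epsilon> \<Longrightarrow> 0 \<le> \<eta> \<Longrightarrow> \<eta> \<le> \<epsilon> \<Longrightarrow> f ((1 + \<eta>) * s) - (1 + \<eta>) * f s \<le> 0"
proof -
  define \<beta> where "\<beta> = - f' 1 / 2"
  have \<beta>: "\<beta> > 0" using assms(4) by (simp add: \<beta>_def)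
  have "isCont f' 1" using f(2) by (simp add: continuous_on_eq_continuous_at)
  then obtain d1 where d1: "d1 > 0" "\<And>y. \<bar>y - 1\<bar> < d1 \<Longrightarrow> \<bar>f' y - f' 1\<bar> < \<beta>"
    using \<beta> unfolding continuous_at_eps_delta dist_real_def by (metis)
  have "isCont f 1" using f(1) DERIV_isCont by blast
  then obtain d2 where d2: "d2 > 0" "\<And>y. \<bar>y - 1\<bar> < d2 \<Longrightarrow> \<bar>f y - f 1\<bar> < \<beta> / 2"
    using \<beta> unfolding continuous_at_eps_delta dist_real_def by (metis half_gt_zero)
  \<comment> \<open>The mean value point below lies within \<open>5/2 * \<epsilon>\<close> of 1,
    hence within \<open>d1\<close>, where \<open>f' \<le> - \<beta>\<close>. With
    \<open>s \<ge> 1/2\<close> the gain is at least \<open>\<eta> * \<beta> / 2\<close>, which pays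
    for \<open>- f s \<le> \<beta> / 2\<close>.\<close>
  define \<epsilon> where "\<epsilon> = min (1/2) (min (d1 / 4) (d2 / 2))"
  have \<epsilon>: "\<epsilon> > 0" "\<epsilon> \<le> 1/2" "4 * \<epsilon> \<le> d1" "2 * \<epsilon> \<le> d2" using d1 d2 by (auto simp: \<epsilon>_def)
  show ?thesis
  proof (rule that[of \<epsilon>])
    fix s \<eta> :: real assume s: "\<bar>s - 1\<bar> \<le> \<epsilon>" and \<eta>: "0 \<le> \<eta>" "\<eta> \<le> \<epsilon>"
    have s2: "1/2 \<le> s" "s \<le> 3/2" using s \<epsilon> by (auto simp: abs_le_iff)
    have fs: "- f s \<le> \<beta> / 2" using d2(2)[of s] s \<epsilon> \<open>f 1 = 0\<close> by auto
    show "f ((1 + \<eta>) * s) - (1 + \<eta>) * f s \<le> 0"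
    proof (cases "\<eta> = 0")
      case False
      then have "s < (1 + \<eta>) * s" using \<eta> s2 by (simp add: algebra_simps)
      then obtain \<xi> where \<xi>: "s < \<xi>" "\<xi> < (1 + \<eta>) * s" "f ((1 + \<eta>) * s) - f s = ((1 + \<eta>) * s - s) * f' \<xi>"
        using MVT2[of s "(1 + \<eta>) * s" f f'] f(1) by auto
      have "\<eta> * s \<le> \<epsilon> * (3/2)" using \<eta> s2 \<epsilon> by (intro mult_mono) auto
      then have "\<bar>\<xi> - 1\<bar> < d1" using \<xi> s \<epsilon> by (auto simp: abs_less_iff abs_le_iff algebra_simps)
      then have f'\<xi>: "f' \<xi> \<le> - \<beta>" using d1(2)[of \<xi>] by (auto simp: \<beta>_def abs_less_iff)
      have "\<eta> * (s * f' \<xi>) \<le> \<eta> * (s * - \<beta>)" using \<eta> s2 f'\<xi> by (intro mult_left_mono) auto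
      moreover have "\<eta> * (s * - \<beta>) \<le> \<eta> * (1/2 * - \<beta>)"
        using \<eta> s2 \<beta> by (intro mult_left_mono mult_right_mono_neg) auto
      moreover have "\<eta> * - f s \<le> \<eta> * (\<beta> / 2)" using \<eta> fs by (intro mult_left_mono) auto
      ultimately show ?thesis using \<xi>(3) by (simp add: algebra_simps)
    qed simp
  qed (use \<epsilon> in auto)
qed

context jump_measure
begin

text \<open>Jumps up to 1 are controlled by \<open>q''\<close> on the enlarged interval, longer ones
  by the bound on \<open>q\<close>. The same \<open>C\<close> also bounds \<open>q''\<close>, for
  the error of the forward quotient in \<open>discretize_supersolution\<close>.\<close>

lemma dd_local_bound:
  assumes q: "\<And>x. (q has_real_derivative q' x) (at x)" "\<And>x. (q' has_real_derivative q'' x) (at x)"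
    "continuous_on UNIV q''" and b: "\<And>x. \<bar>q x\<bar> \<le> C0"
  shows "\<exists>C\<ge>0. (\<forall>x\<in>{a..b}. \<forall>z. \<bar>dd q z x\<bar> \<le> C * kern z) \<and> (\<forall>y\<in>{a - 1..b + 1}. \<bar>q'' y\<bar> \<le> C)"
proof -
  have "compact (q'' ` {a - 1..b + 1})"
    using q(3) by (intro compact_continuous_image) (auto intro: continuous_on_subset)
  then obtain M where M: "\<And>y. y \<in> {a - 1..b + 1} \<Longrightarrow> \<bar>q'' y\<bar> \<le> M"
    using compact_imp_bounded bounded_iff by (metis image_eqI real_norm_def)
  have C0: "0 \<le> C0" using b[of 0] by linarith
  show ?thesis
  proof (intro exI[of _ "4 * C0 + \<bar>M\<bar>"] conjI ballI allI)
    show "0 \<le> 4 * C0 + \<bar>M\<bar>" using C0 by simp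
    show "\<bar>q'' y\<bar> \<le> 4 * C0 + \<bar>M\<bar>" if "y \<in> {a - 1..b + 1}" for y using M[OF that] C0 by linarith
    fix x z assume x: "x \<in> {a..b}"
    show "\<bar>dd q z x\<bar> \<le> (4 * C0 + \<bar>M\<bar>) * kern z"
    proof (cases "\<bar>z\<bar> \<le> 1")
      case True
      obtain \<eta> where \<eta>: "\<bar>\<eta> - x\<bar> \<le> \<bar>z\<bar>" "dd q z x = z\<^sup>2 * q'' \<eta>" by (rule dd_mean_value[OF q(1,2)])
      have "\<bar>q'' \<eta>\<bar> \<le> 4 * C0 + \<bar>M\<bar>"
      proof -
        have "\<eta> \<in> {a - 1..b + 1}" using \<eta>(1) True x by auto
        then show ?thesis using M[of \<eta>] C0 by linarith
      qed
      then have "z\<^sup>2 * \<bar>q'' \<eta>\<bar> \<le> z\<^sup>2 * (4 * C0 + \<bar>M\<bar>)" by (rule mult_left_mono) simp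
      moreover have "kern z = z\<^sup>2" using True by (simp add: kern_def abs_square_le_1)
      ultimately show ?thesis by (simp add: \<eta>(2) abs_mult mult.commute)
    next
      case False
      then have "1 \<le> z\<^sup>2" by (metis abs_square_less_1 not_le linorder_not_less abs_square_le_1 less_imp_le)
      then have "kern z = 1" by (simp add: kern_def)
      then show ?thesis using dd_abs_le[of q, OF b, of z x] by simp
    qed
  qed
qed

lemma J_local_split:
  assumes "q \<in> borel_measurable borel" "\<And>z. \<bar>dd q z x\<bar> \<le> C * kern z"
  shows "\<bar>J UNIV q x - J (far \<delta>) q x\<bar> \<le> C / 2 * small_mass \<delta>"
proof -
  have [measurable]: "q \<in> borel_measurable borel" by fact
  have mS: "(far \<delta>) \<in> sets borel" "(near \<delta>) \<in> sets borel" by measurable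
  have i: "integrable N (\<lambda>z. indicator S z * dd q z x)" if [measurable]: "S \<in> sets borel" for S
  proof (rule Bochner_Integration.integrable_bound)
    show "integrable N (\<lambda>z. C * kern z)" using integrable_kern by simp
    show "AE z in N. norm (indicator S z * dd q z x) \<le> norm (C * kern z)"
    proof (rule AE_I2)
      fix z show "norm (indicator S z * dd q z x) \<le> norm (C * kern z)"
        using order_trans[OF assms(2) abs_ge_self, of z] by (simp add: indicator_def)
    qed
  qed measurable
  have ik: "integrable N (\<lambda>z. C * (indicator (near \<delta>) z * kern z))"
    using integrable_real_mult_indicator[of "(near \<delta>)" N kern] integrable_kern mS
    by (auto simp: mult.commute)
  have "J UNIV q x - J (far \<delta>) q x =
      (\<integral>z. indicator UNIV z * dd q z x - indicator (far \<delta>) z * dd q z x \<partial>N) / 2"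
    unfolding J_def using i[of UNIV] i mS by (subst Bochner_Integration.integral_diff) (auto simp: diff_divide_distrib)
  also have "(\<integral>z. indicator UNIV z * dd q z x - indicator (far \<delta>) z * dd q z x \<partial>N)
      = (\<integral>z. indicator (near \<delta>) z * dd q z x \<partial>N)"
    by (intro Bochner_Integration.integral_cong) (auto simp: indicator_def)
  finally have eq: "J UNIV q x - J (far \<delta>) q x = (\<integral>z. indicator (near \<delta>) z * dd q z x \<partial>N) / 2" .
  have "\<bar>\<integral>z. indicator (near \<delta>) z * dd q z x \<partial>N\<bar> \<le> (\<integral>z. C * (indicator (near \<delta>) z * kern z) \<partial>N)"
  proof (rule order_trans[OF integral_abs_bound], rule integral_mono[OF _ ik])
    show "integrable N (\<lambda>z. \<bar>indicator (near \<delta>) z * dd q z x\<bar>)" using i[OF mS(2)] by simp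
    show "\<bar>indicator (near \<delta>) z * dd q z x\<bar> \<le> C * (indicator (near \<delta>) z * kern z)" for z
      using assms(2)[of z] by (auto simp: indicator_def)
  qed
  then show ?thesis unfolding eq by (simp add: small_mass_def)
qed

lemma continuous_on_operator:
  assumes q: "\<And>x. (q has_real_derivative q' x) (at x)" "\<And>x. (q' has_real_derivative q'' x) (at x)"
    "continuous_on UNIV q''" and b: "\<And>x. \<bar>q x\<bar> \<le> C0" and f: "continuous_on UNIV f"
  shows "continuous_on {a..b} (\<lambda>x. J UNIV q x + \<kappa> * q' x + f (q x))"
proof -
  obtain C where C: "0 \<le> C" "\<And>x z. x \<in> {a..b} \<Longrightarrow> \<bar>dd q z x\<bar> \<le> C * kern z"
    "\<And>y. y \<in> {a - 1..b + 1} \<Longrightarrow> \<bar>q'' y\<bar> \<le> C"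
    using dd_local_bound[OF q b, where a=a and b=b] by blast
  have cq: "continuous_on A q" "continuous_on A q'" for A
    using q by (intro DERIV_continuous_on; blast intro: has_field_derivative_at_within)+
  have 1: "continuous_on {a..b} (J UNIV q)" by (rule continuous_on_J[OF cq(1) _ C(1,2)]) simp_all
  have 2: "continuous_on {a..b} (\<lambda>x. f (q x))" by (rule continuous_on_compose2[OF f cq(1)]) simp
  show ?thesis by (intro continuous_on_add continuous_on_mult_left 1 2 cq(2))
qed

text \<open>Strict inequality on a compact interval leaves a margin \<open>m\<close>. One half pays
  for the omitted near jumps, the other for the forward quotient, whose error is at most
  \<open>C * h\<close>.\<close>

lemma discretize_supersolution:
  assumes q: "\<And>x. (q has_real_derivative q' x) (at x)" "\<And>x. (q' has_real_derivative q'' x) (at x)"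
    "continuous_on UNIV q''" and b: "\<And>x. \<bar>q x\<bar> \<le> C0" and f: "continuous_on UNIV f" and "0 < \<kappa>" "0 < r"
    and super: "\<And>x. x \<in> {a..b} \<Longrightarrow> J UNIV q x + \<kappa> * q' x + f (q x) < 0"
  obtains \<delta> h where "0 < \<delta>" "\<delta> \<le> r" "0 < h" "h \<le> r"
    "\<And>x. x \<in> {a..b} \<Longrightarrow> J (far \<delta>) q x + \<kappa> * dq h q x + f (q x) \<le> 0"
proof -
  obtain C where C: "0 \<le> C" "\<And>x z. x \<in> {a..b} \<Longrightarrow> \<bar>dd q z x\<bar> \<le> C * kern z"
    "\<And>y. y \<in> {a - 1..b + 1} \<Longrightarrow> \<bar>q'' y\<bar> \<le> C"
    using dd_local_bound[OF q b, where a=a and b=b] by blast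
  obtain m where m: "m > 0" "\<And>x. x \<in> {a..b} \<Longrightarrow> J UNIV q x + \<kappa> * q' x + f (q x) \<le> - m"
    using continuous_negative_margin[OF continuous_on_operator[OF q b f] super] by blast
  have qm: "q \<in> borel_measurable borel"
    using q(1) by (intro borel_measurable_continuous_onI DERIV_continuous_on) (auto intro: has_field_derivative_at_within)
  have "((\<lambda>\<delta>. C / 2 * small_mass \<delta>) \<longlongrightarrow> C / 2 * 0) (at_right 0)"
    by (intro tendsto_intros small_mass_tendsto)
  then have "\<forall>\<^sub>F \<delta> in at_right 0. C / 2 * small_mass \<delta> < m / 2"
    using m by (intro order_tendstoD) auto
  moreover have "\<forall>\<^sub>F \<delta> in at_right 0. \<delta> \<in> {0<..<r}"
    using \<open>0 < r\<close> by (rule eventually_at_right_real)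
  ultimately have "\<forall>\<^sub>F \<delta> in at_right 0. C / 2 * small_mass \<delta> < m / 2 \<and> \<delta> \<in> {0<..<r}"
    by (rule eventually_conj)
  then obtain \<delta> where \<delta>: "C / 2 * small_mass \<delta> < m / 2" "0 < \<delta>" "\<delta> < r"
    by (auto dest!: eventually_happens)
  \<comment> \<open>The cap 1 keeps the mean value points inside \<open>{a - 1..b + 1}\<close>; the
    last entry makes the quotient error at most \<open>m / 2\<close>.\<close>
  define h where "h = min 1 (min r (m / (2 * (\<kappa> * C + 1))))"
  have kC: "0 \<le> \<kappa> * C" using C \<open>0 < \<kappa>\<close> by simp
  have h: "0 < h" "h \<le> 1" "h \<le> r" using m kC \<open>0 < r\<close> by (auto simp: h_def)
  have kh: "\<kappa> * (C * h) \<le> m / 2"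
  proof -
    have "\<kappa> * C * h \<le> \<kappa> * C * (m / (2 * (\<kappa> * C + 1)))" using kC by (intro mult_left_mono) (auto simp: h_def)
    also have "\<dots> = (\<kappa> * C / (\<kappa> * C + 1)) * (m / 2)" by simp
    also have "\<dots> \<le> 1 * (m / 2)" using kC m by (intro mult_right_mono) auto
    finally show ?thesis by (simp add: mult.assoc)
  qed
  show ?thesis
  proof (rule that[of \<delta> h])
    fix x assume x: "x \<in> {a..b}"
    have 1: "J (far \<delta>) q x \<le> J UNIV q x + m / 2"
      using J_local_split[OF qm C(2)[OF x], of \<delta>] \<delta>(1) by linarith
    obtain \<xi> where \<xi>: "x < \<xi>" "\<xi> < x + h" "q (x + h) - q x = (x + h - x) * q' \<xi>"
      using MVT2[of x "x + h" q q'] q(1) h by auto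
    obtain \<eta> where \<eta>: "x < \<eta>" "\<eta> < \<xi>" "q' \<xi> - q' x = (\<xi> - x) * q'' \<eta>"
      using MVT2[of x \<xi> q' q''] q(2) \<xi>(1) by auto
    have "dq h q x - q' x = (\<xi> - x) * q'' \<eta>" using \<xi>(3) \<eta>(3) h by (simp add: dq_def)
    also have "\<dots> \<le> (\<xi> - x) * C" using C(3)[of \<eta>] x \<xi> \<eta> h by (intro mult_left_mono) auto
    also have "\<dots> \<le> h * C" using \<xi> C by (intro mult_right_mono) auto
    finally have "\<kappa> * (dq h q x - q' x) \<le> \<kappa> * (C * h)" using \<open>0 < \<kappa>\<close> by (simp add: mult.commute)
    then have "\<kappa> * dq h q x \<le> \<kappa> * q' x + m / 2" using kh by (simp add: algebra_simps)
    then show "J (far \<delta>) q x + \<kappa> * dq h q x + f (q x) \<le> 0" using 1 m(2)[OF x] by linarith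
  qed (use \<delta> h in auto)
qed

lemma J_cmult: "J S (\<lambda>x. s * q x) x = s * J S q x"
proof -
  have eq: "indicator S z * dd (\<lambda>x. s * q x) z x = s * (indicator S z * dd q z x)" for z
    by (simp add: dd_def algebra_simps)
  show ?thesis by (simp only: J_def eq integral_mult_right_zero times_divide_eq_right)
qed

text \<open>If the limit of \<open>w\<close> at \<open>-\<infinity>\<close> exceeds 1, then
  \<open>w\<close> itself exceeds 1 far to the left and \<open>\<eta> = 0\<close> works. If it
  equals 1, \<open>w\<close> may approach it from below, and a factor \<open>1 + \<eta>\<close>
  lifts it. Far left the factor is harmless by \<open>scaling_near_stable_zero\<close>; on the
  remaining compact interval the strict margin absorbs it.\<close>

lemma truncated_supersolution:
  fixes f w :: "real \<Rightarrow> real"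
  assumes f: "\<And>x. (f has_real_derivative f' x) (at x)" "continuous_on UNIV f'" and f1: "f 1 = 0" "f' 1 < 0"
    and w: "\<And>x. (w has_real_derivative w' x) (at x)" "\<And>x. (w' has_real_derivative w'' x) (at x)" "continuous_on UNIV w''"
    and wb: "\<And>x. 0 < w x" "\<And>x. w x \<le> C0"
    and super: "\<And>x. J UNIV w x + \<kappa> * w' x + f (w x) < 0"
    and lim: "(w \<longlongrightarrow> l) at_bot" "1 \<le> l" and \<theta>: "w x1 < \<theta>" and "0 < \<kappa>" "0 < r"
  obtains a \<delta> h wt where "- a \<le> R" "0 < \<delta>" "\<delta> \<le> r" "0 < h" "h \<le> r" "bounded_borel wt"
    "\<And>x. 0 \<le> wt x" "\<And>x. wt x \<le> 2 * C0" "\<And>x. x \<le> - a \<Longrightarrow> 1 \<le> wt x" "wt x1 \<le> \<theta>"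
    "\<And>x. - a \<le> x \<Longrightarrow> x \<le> R \<Longrightarrow> J (far \<delta>) wt x + \<kappa> * dq h wt x + f (wt x) \<le> 0"
proof -
  have cf: "continuous_on UNIV f" using f(1) by (intro DERIV_continuous_on) (auto intro: has_field_derivative_at_within)
  have cw: "continuous_on UNIV w" using w(1) by (intro DERIV_continuous_on) (auto intro: has_field_derivative_at_within)
  have C0: "0 < C0" using wb(1)[of 0] wb(2)[of 0] by linarith
  have wa: "\<bar>w x\<bar> \<le> C0" for x using wb(1)[of x] wb(2)[of x] by simp
  define H where "H x = J UNIV w x + \<kappa> * w' x + f (w x)" for x
  have cH: "continuous_on {a..b} H" for a b
    unfolding H_def by (rule continuous_on_operator[OF w wa cf])
  have bot: "\<exists>a. - a \<le> R \<and> (\<forall>x\<le>- a. P x)" if ev: "eventually P at_bot" for P :: "real \<Rightarrow> bool"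
  proof -
    obtain M where "\<forall>x\<le>M. P x" using ev by (auto simp: eventually_at_bot_linorder)
    then show ?thesis by (intro exI[of _ "- min M R"]) auto
  qed
  have "\<exists>\<eta> a. 0 \<le> \<eta> \<and> \<eta> \<le> 1 \<and> - a \<le> R \<and> (\<forall>x\<le>- a. 1 \<le> (1 + \<eta>) * w x) \<and> (1 + \<eta>) * w x1 \<le> \<theta> \<and>
      (\<forall>x\<in>{- a..R}. (1 + \<eta>) * (J UNIV w x + \<kappa> * w' x) + f ((1 + \<eta>) * w x) < 0)"
  proof (cases "l = 1")
    case False
    then have "\<forall>\<^sub>F x in at_bot. 1 < w x" using lim by (intro order_tendstoD(1)[OF lim(1)]) auto
    then obtain a where "- a \<le> R" "\<forall>x\<le>- a. 1 < w x" using bot by blast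
    then show ?thesis using super \<theta> by (intro exI[of _ 0] exI[of _ a]) (auto simp: less_imp_le)
  next
    case True
    obtain \<epsilon> where \<epsilon>: "0 < \<epsilon>" "\<epsilon> < 1"
      "\<And>s \<eta>. \<bar>s - 1\<bar> \<le> \<epsilon> \<Longrightarrow> 0 \<le> \<eta> \<Longrightarrow> \<eta> \<le> \<epsilon> \<Longrightarrow> f ((1 + \<eta>) * s) - (1 + \<eta>) * f s \<le> 0"
      using scaling_near_stable_zero[OF f f1] by blast
    have "\<forall>\<^sub>F x in at_bot. dist (w x) 1 < \<epsilon>" using lim(1) \<epsilon>(1) True by (auto dest: tendstoD)
    then obtain a0 where a0: "- a0 \<le> R" "\<forall>x\<le>- a0. dist (w x) 1 < \<epsilon>" using bot by blast
    obtain m where m: "m > 0" "\<And>x. x \<in> {- a0..R} \<Longrightarrow> H x \<le> - m"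
      using continuous_negative_margin[OF cH] super unfolding H_def by blast
    obtain L where L: "0 \<le> L" "\<And>s t. s \<in> {0..2 * C0} \<Longrightarrow> t \<in> {0..2 * C0} \<Longrightarrow> \<bar>f s - f t\<bar> \<le> L * \<bar>s - t\<bar>"
      using C1_lipschitz[OF f, where a=0 and b="2 * C0"] by blast
    \<comment> \<open>The change of the reaction is below \<open>\<eta> * D\<close>: one
      \<open>L * C0\<close> for moving the argument of \<open>f\<close>, and
      \<open>L * C0 + \<bar>f 0\<bar>\<close> for the factor in front of it. The summand 1 makes
      \<open>D\<close> positive.\<close>
    define D where "D = 2 * L * C0 + \<bar>f 0\<bar> + 1"
    have D: "D > 0" using L(1) C0 by (auto simp: D_def intro: add_nonneg_pos)
    \<comment> \<open>The three caps serve the scaling lemma, half of the margin \<open>m\<close>,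
      and the level \<open>\<theta>\<close> at \<open>x1\<close>.\<close>
    define \<eta> where "\<eta> = min \<epsilon> (min (m / (2 * D)) ((\<theta> - w x1) / w x1))"
    have \<eta>: "0 < \<eta>" "\<eta> \<le> \<epsilon>" "\<eta> * D \<le> m / 2" "(1 + \<eta>) * w x1 \<le> \<theta>"
    proof -
      show "0 < \<eta>" using \<epsilon> m D \<theta> wb(1)[of x1] by (auto simp: \<eta>_def)
      show "\<eta> \<le> \<epsilon>" by (simp add: \<eta>_def)
      have "\<eta> * D \<le> m / (2 * D) * D" using D by (intro mult_right_mono) (auto simp: \<eta>_def)
      then show "\<eta> * D \<le> m / 2" using D by simp
      have "\<eta> * w x1 \<le> (\<theta> - w x1) / w x1 * w x1" using wb(1)[of x1] by (intro mult_right_mono) (auto simp: \<eta>_def)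
      also have "\<dots> = \<theta> - w x1" using wb(1)[of x1] by simp
      finally show "(1 + \<eta>) * w x1 \<le> \<theta>" by (simp add: algebra_simps)
    qed
    have neg: "(1 + \<eta>) * (J UNIV w x + \<kappa> * w' x) + f ((1 + \<eta>) * w x) < 0" if xR: "x \<le> R" for x
    proof -
      have eq: "(1 + \<eta>) * (J UNIV w x + \<kappa> * w' x) + f ((1 + \<eta>) * w x) =
          (1 + \<eta>) * H x + (f ((1 + \<eta>) * w x) - (1 + \<eta>) * f (w x))"
        by (simp add: H_def algebra_simps)
      have Hneg: "(1 + \<eta>) * H x < 0" using super[of x] \<eta>(1) by (simp add: H_def mult_pos_neg)
      show ?thesis
      proof (cases "x \<le> - a0")
        case True
        then have "\<bar>w x - 1\<bar> \<le> \<epsilon>" using a0(2) by (auto simp: dist_real_def less_imp_le)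
        then have "f ((1 + \<eta>) * w x) - (1 + \<eta>) * f (w x) \<le> 0" using \<eta> by (intro \<epsilon>(3)) auto
        then show ?thesis unfolding eq using Hneg by linarith
      next
        case False
        have "(1 + \<eta>) * H x \<le> 1 * H x" using super[of x] \<eta>(1) by (intro mult_right_mono_neg) (auto simp: H_def)
        also have "\<dots> \<le> - m" using m(2)[of x] False xR by simp
        finally have 1: "(1 + \<eta>) * H x \<le> - m" .
        have r1: "w x \<in> {0..2 * C0}" "0 \<in> {0..2 * C0}" using wb(1)[of x] wb(2)[of x] C0 by auto
        have "(1 + \<eta>) * w x \<le> 2 * C0" using wb(1)[of x] wb(2)[of x] \<eta>(1,2) \<epsilon>(2) by (intro mult_mono) auto
        then have r2: "(1 + \<eta>) * w x \<in> {0..2 * C0}" using wb(1)[of x] \<eta>(1) by (simp add: mult_nonneg_nonneg less_imp_le)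
        have "\<bar>f ((1 + \<eta>) * w x) - f (w x)\<bar> \<le> L * \<bar>(1 + \<eta>) * w x - w x\<bar>" by (rule L(2)[OF r2 r1(1)])
        also have "\<dots> = \<eta> * (L * w x)" using \<eta>(1) wb(1)[of x] by (simp add: algebra_simps)
        also have "\<dots> \<le> \<eta> * (L * C0)" using \<eta>(1) L wb(2) by (intro mult_left_mono) auto
        finally have 2: "f ((1 + \<eta>) * w x) - f (w x) \<le> \<eta> * (L * C0)" by linarith
        have "\<bar>f (w x) - f 0\<bar> \<le> L * \<bar>w x - 0\<bar>" by (rule L(2)[OF r1])
        also have "\<dots> \<le> L * C0" using wb(1)[of x] wb(2)[of x] L by (intro mult_left_mono) auto
        finally have "- f (w x) \<le> L * C0 + \<bar>f 0\<bar>" by linarith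
        then have "\<eta> * - f (w x) \<le> \<eta> * (L * C0 + \<bar>f 0\<bar>)" using \<eta>(1) by (intro mult_left_mono) auto
        then have "f ((1 + \<eta>) * w x) - (1 + \<eta>) * f (w x) \<le> \<eta> * D - \<eta>" using 2 by (simp add: D_def algebra_simps)
        then show ?thesis unfolding eq using 1 \<eta>(1,3) m(1) by linarith
      qed
    qed
    \<comment> \<open>The final \<open>a\<close> can only be chosen now, since it depends on
      \<open>\<eta>\<close>; \<open>a0\<close> depends on \<open>\<epsilon>\<close> alone.\<close>
    have "1 / (1 + \<eta>) < l" using \<eta>(1) True by simp
    then have "\<forall>\<^sub>F x in at_bot. 1 / (1 + \<eta>) < w x" by (rule order_tendstoD(1)[OF lim(1)])
    then obtain a where a: "- a \<le> R" "\<forall>x\<le>- a. 1 / (1 + \<eta>) < w x" using bot by blast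
    have "\<forall>x\<le>- a. 1 \<le> (1 + \<eta>) * w x" using a(2) \<eta>(1) by (auto simp: field_simps less_imp_le)
    then show ?thesis using a(1) \<eta> neg \<epsilon>(2) by (intro exI[of _ \<eta>] exI[of _ a]) auto
  qed
  then obtain \<eta> a where \<eta>: "0 \<le> \<eta>" "\<eta> \<le> 1" and a: "- a \<le> R" "\<And>x. x \<le> - a \<Longrightarrow> 1 \<le> (1 + \<eta>) * w x"
    "(1 + \<eta>) * w x1 \<le> \<theta>"
    "\<And>x. x \<in> {- a..R} \<Longrightarrow> (1 + \<eta>) * (J UNIV w x + \<kappa> * w' x) + f ((1 + \<eta>) * w x) < 0"
    by blast
  define wt where "wt x = (1 + \<eta>) * w x" for x
  have wt0: "0 \<le> wt x" for x using \<eta> wb(1)[of x] by (simp add: wt_def)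
  have wt2: "wt x \<le> 2 * C0" for x unfolding wt_def using \<eta> wb(1)[of x] wb(2)[of x] by (intro mult_mono) auto
  have d: "(wt has_real_derivative (1 + \<eta>) * w' x) (at x)" "((\<lambda>x. (1 + \<eta>) * w' x) has_real_derivative (1 + \<eta>) * w'' x) (at x)" for x
    unfolding wt_def[abs_def] by (auto intro!: derivative_eq_intros w)
  have c: "continuous_on UNIV (\<lambda>x. (1 + \<eta>) * w'' x)" by (intro continuous_intros w)
  have s: "J UNIV wt x + \<kappa> * ((1 + \<eta>) * w' x) + f (wt x) < 0" if "x \<in> {- a..R}" for x
    using a(4)[OF that] unfolding wt_def[abs_def] J_cmult by (simp add: algebra_simps)
  have abs_wt: "\<bar>wt x\<bar> \<le> 2 * C0" for x using wt0[of x] wt2[of x] by simp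
  obtain \<delta> h where "0 < \<delta>" "\<delta> \<le> r" "0 < h" "h \<le> r"
    "\<And>x. x \<in> {- a..R} \<Longrightarrow> J (far \<delta>) wt x + \<kappa> * dq h wt x + f (wt x) \<le> 0"
    using discretize_supersolution[OF d c abs_wt cf \<open>0 < \<kappa>\<close> \<open>0 < r\<close> s] by blast
  moreover have "bounded_borel wt"
    unfolding wt_def using cw wa
    by (intro bounded_borel_cmult bounded_borelI[of w C0] borel_measurable_continuous_onI)
  ultimately show ?thesis
    using a wt0 wt2 by (intro that[of a \<delta> h wt]) (auto simp: wt_def)
qed

end


subsection \<open>Existence of the front\<close>

lemma ex_isCont_between:
  fixes F :: "real \<Rightarrow> real"
  assumes "mono F" "a < b"
  obtains y where "a < y" "y < b" "isCont F y"
proof -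
  have "countable {y. \<not> isCont F y}" by (rule mono_ctble_discont[OF assms(1)])
  then have "\<not> {a<..<b} \<subseteq> {y. \<not> isCont F y}"
    using assms(2) countable_subset uncountable_open_interval by blast
  then show ?thesis using that by auto
qed

context jump_measure
begin

text \<open>A strong maximum principle at the leftmost zero \<open>x0\<close>. Derivative and
  reaction vanish there, so the truncated operators tend to 0; they grow as \<open>\<delta>\<close>
  decreases, because second differences at a zero of \<open>v\<close> are nonnegative, hence all of
  them vanish. But one of \<open>x0 + z\<close>, \<open>x0 - z\<close> lies left of
  \<open>x0\<close>, so these differences are positive for \<open>z \<noteq> 0\<close> and
  \<open>N\<close> would be null.\<close>

lemma front_positive:
  assumes v: "\<And>x. 0 \<le> v x" "antimono v" "(v \<longlongrightarrow> 1) at_bot" "bounded_borel v"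
    and v': "\<And>x. (v has_real_derivative v' x) (at x)" and "f 0 = 0"
    and J: "\<And>x. ((\<lambda>\<delta>. J (far \<delta>) v x) \<longlongrightarrow> - (c * v' x + f (v x))) (at_right 0)"
    and nz: "emeasure N UNIV \<noteq> 0"
  shows "0 < v x"
proof (rule ccontr)
  assume "\<not> 0 < v x"
  then have x: "v x = 0" using v(1)[of x] by simp
  define A where "A = {y. v y = 0}"
  define x0 where "x0 = Inf A"
  have cont: "continuous_on UNIV v" using v' by (intro DERIV_continuous_on) (auto intro: has_field_derivative_at_within)
  have "closed A" unfolding A_def using cont by (intro closed_Collect_eq continuous_intros)
  have "\<forall>\<^sub>F y in at_bot. 0 < v y" by (rule order_tendstoD(1)[OF v(3)]) simp
  then obtain M where M: "\<And>y. y \<le> M \<Longrightarrow> 0 < v y" by (auto simp: eventually_at_bot_linorder)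
  have bdd: "bdd_below A"
  proof (rule bdd_belowI[of _ M])
    fix y assume "y \<in> A"
    then show "M \<le> y" using M[of y] by (cases "y \<le> M") (auto simp: A_def)
  qed
  have "A \<noteq> {}" using x by (auto simp: A_def)
  then have "x0 \<in> A" unfolding x0_def using bdd \<open>closed A\<close> by (intro closed_contains_Inf)
  then have v0: "v x0 = 0" by (simp add: A_def)
  have pos: "0 < v y" if "y < x0" for y
  proof -
    have "y \<notin> A" using that cInf_lower[OF _ bdd, of y] by (auto simp: x0_def)
    then show ?thesis using v(1)[of y] by (auto simp: A_def less_le)
  qed
  have "v' x0 = 0" by (rule DERIV_local_min[OF v', of 1]) (use v(1) v0 in auto)
  then have J0: "((\<lambda>\<delta>. J (far \<delta>) v x0) \<longlongrightarrow> 0) (at_right 0)"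
    using J[of x0] v0 \<open>f 0 = 0\<close> by simp
  have dd0: "0 \<le> dd v z x0" "z \<noteq> 0 \<Longrightarrow> 0 < dd v z x0" for z
  proof -
    show "0 \<le> dd v z x0" using v(1)[of "x0 + z"] v(1)[of "x0 - z"] v0 by (simp add: dd_def)
    assume "z \<noteq> 0"
    then consider "z < 0" | "z > 0" by linarith
    then show "0 < dd v z x0"
      using v(1)[of "x0 + z"] v(1)[of "x0 - z"] v0 pos[of "x0 + z"] pos[of "x0 - z"]
      by cases (auto simp: dd_def intro: add_pos_nonneg add_nonneg_pos)
  qed
  obtain C where C: "\<And>x. \<bar>v x\<bar> \<le> C" using bounded_borelE[OF v(4)] by blast
  have i: "integrable N (\<lambda>z. indicator (far \<delta>) z * dd v z x0)" if "\<delta> > 0" for \<delta>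
    by (rule integrable_J[OF ddb_far[OF v(4) C that]])
  have null: "emeasure N (far \<delta>) = 0" if \<delta>: "\<delta> > 0" for \<delta>
  proof -
    have "J (far \<delta>) v x0 \<le> 0"
    proof (rule tendsto_lowerbound[OF J0])
      have "\<forall>\<^sub>F \<delta>' in at_right 0. \<delta>' \<in> {0<..<\<delta>}" using \<delta> by (rule eventually_at_right_real)
      then show "\<forall>\<^sub>F \<delta>' in at_right 0. J (far \<delta>) v x0 \<le> J (far \<delta>') v x0"
      proof eventually_elim
        case (elim \<delta>')
        then show ?case unfolding J_def
          using dd0(1) \<delta> by (intro divide_right_mono integral_mono i) (auto simp: indicator_def)
      qed
    qed simp
    moreover have "0 \<le> (\<integral>z. indicator (far \<delta>) z * dd v z x0 \<partial>N)"
      by (rule Bochner_Integration.integral_nonneg) (simp add: dd0)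
    ultimately have "(\<integral>z. indicator (far \<delta>) z * dd v z x0 \<partial>N) = 0" by (simp add: J_def)
    then have "AE z in N. indicator (far \<delta>) z * dd v z x0 = 0"
      using integral_nonneg_eq_0_iff_AE[OF i[OF \<delta>]] dd0(1) by simp
    then have "AE z in N. z \<notin> (far \<delta>)"
    proof eventually_elim
      case (elim z) then show ?case using dd0(2)[of z] \<delta> by (cases "z = 0") (auto simp: indicator_def)
    qed
    then show ?thesis using AE_iff_measurable[of "far \<delta>" N "\<lambda>z. z \<notin> (far \<delta>)"] by simp
  qed
  have "(UNIV :: real set) = {0} \<union> (\<Union>n. (far (inverse (real (Suc n)))))"
  proof -
    have "\<exists>n. inverse (real (Suc n)) \<le> \<bar>z\<bar>" if "z \<noteq> 0" for z :: real
      using reals_Archimedean[of "\<bar>z\<bar>"] that by (meson less_imp_le zero_less_abs_iff)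
    then show ?thesis by auto
  qed
  moreover have "{0} \<union> (\<Union>n. (far (inverse (real (Suc n))))) \<in> null_sets N"
    using null emeasure_N_0 by (intro null_sets.Un null_sets_UN null_setsI) auto
  ultimately have "emeasure N UNIV = 0" by auto
  then show False using nz by simp
qed

theorem front_exists:
  fixes f w :: "real \<Rightarrow> real"
  assumes f: "\<And>x. (f has_real_derivative f' x) (at x)" "continuous_on UNIV f'"
    and f0: "f 0 = 0" and f1: "f 1 = 0" "f' 1 < 0" and f_pos: "\<And>s. s \<in> {0<..<1} \<Longrightarrow> 0 < f s"
    and w: "\<And>x. (w has_real_derivative w' x) (at x)" "\<And>x. (w' has_real_derivative w'' x) (at x)" "continuous_on UNIV w''"
    and wb: "\<And>x. 0 < w x" "\<And>x. w x \<le> C0"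
    and super: "\<And>x. J UNIV w x + \<kappa> * w' x + f (w x) < 0"
    and lim: "(w \<longlongrightarrow> l) at_bot" "1 \<le> l" and x1: "w x1 < 1" and \<kappa>: "0 < \<kappa>" "\<kappa> \<le> c"
    and nz: "emeasure N UNIV \<noteq> 0"
  shows "\<exists>u u'. antimono u \<and> (\<forall>x. 0 < u x) \<and> (\<forall>x. u x \<le> 1) \<and> (\<forall>x. (u has_real_derivative u' x) (at x))
    \<and> continuous_on UNIV u' \<and> (u \<longlongrightarrow> 1) at_bot \<and> (u \<longlongrightarrow> 0) at_top
    \<and> (\<forall>x. ((\<lambda>\<delta>. J (far \<delta>) u x) \<longlongrightarrow> - (c * u' x + f (u x))) (at_right 0))"
proof -
  have cf: "continuous_on UNIV f" using f(1) by (intro DERIV_continuous_on) (auto intro: has_field_derivative_at_within)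
  \<comment> \<open>Above \<open>w x1\<close>, to leave room for scaling the barrier; below 1, so
    that a front centred at this level is not constant 1.\<close>
  define \<theta> where "\<theta> = (w x1 + 1) / 2"
  have \<theta>: "w x1 < \<theta>" "0 < \<theta>" "\<theta> < 1" using x1 wb(1)[of x1] by (auto simp: \<theta>_def)
  have C0: "0 < C0" using wb(1)[of 0] wb(2)[of 0] by linarith
  define B where "B = 2 * C0 + 1"
  obtain L where L: "0 \<le> L" "\<And>s t. s \<in> {0..B} \<Longrightarrow> t \<in> {0..B} \<Longrightarrow> \<bar>f s - f t\<bar> \<le> L * \<bar>s - t\<bar>"
    using C1_lipschitz[OF f, where a=0 and b=B] by blast
  define P where "P n v \<delta> h \<longleftrightarrow> antimono v \<and> (\<forall>x. 0 \<le> v x) \<and> (\<forall>x. v x \<le> 1) \<and> (\<forall>x. continuous (at_right x) v)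
    \<and> (\<forall>x<0. \<theta> \<le> v x) \<and> (\<forall>x>0. v x \<le> \<theta>) \<and> 0 < \<delta> \<and> \<delta> \<le> inverse (real (Suc n)) \<and> 0 < h \<and> h \<le> inverse (real (Suc n))
    \<and> (\<forall>x<real n. \<bar>J (far \<delta>) v x + c * dq h v x + f (v x)\<bar> \<le> inverse (real (Suc n)))"
    for n :: nat and v :: "real \<Rightarrow> real" and \<delta> h :: real
  have "\<exists>v \<delta> h. P n v \<delta> h" for n
  proof -
    have r: "0 < inverse (real (Suc n))" by simp
    show ?thesis
    \<comment> \<open>Centring can cost the offset \<open>x1\<close>; with this cutoff the equation
      still holds for all \<open>x < n\<close>.\<close>
    proof (rule truncated_supersolution[OF f f1 w wb super lim \<theta>(1) \<kappa>(1) r, where R = "x1 + real n"])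
      fix a \<delta> h wt
      assume a: "- a \<le> x1 + real n" and \<delta>: "0 < \<delta>" "\<delta> \<le> inverse (real (Suc n))" and h: "0 < h" "h \<le> inverse (real (Suc n))"
        and wt: "bounded_borel wt" "\<And>x. 0 \<le> wt x" "\<And>x. wt x \<le> 2 * C0" "\<And>x. x \<le> - a \<Longrightarrow> 1 \<le> wt x" "wt x1 \<le> \<theta>"
        and sup: "\<And>x. - a \<le> x \<Longrightarrow> x \<le> x1 + real n \<Longrightarrow> J (far \<delta>) wt x + \<kappa> * dq h wt x + f (wt x) \<le> 0"
      define s where "s = measure N (far \<delta>) + c / h + L"
      have "0 < c / h" using \<kappa> h by simp
      then have s: "0 < s" using L(1) measure_nonneg[of N "far \<delta>"] unfolding s_def by linarith
      \<comment> \<open>Equality in the CFL condition. The plateau \<open>k\<close> is chosen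
        afterwards, relative to \<open>\<tau>\<close>, because the residual is
        \<open>k / \<tau>\<close>.\<close>
      define \<tau> where "\<tau> = 1 / s"
      define k where "k = min (1 / 2) (\<tau> * inverse (real (Suc n)))"
      have \<tau>: "0 < \<tau>" "\<tau> * s \<le> 1" using s by (auto simp: \<tau>_def)
      have k: "0 < k" "k < 1" "k / \<tau> \<le> inverse (real (Suc n))"
      proof -
        show "0 < k" "k < 1" using \<tau> r by (auto simp: k_def)
        have "k \<le> \<tau> * inverse (real (Suc n))" by (simp add: k_def)
        then show "k / \<tau> \<le> inverse (real (Suc n))" by (subst pos_divide_le_eq[OF \<tau>(1)]) (simp only: mult.commute)
      qed
      interpret S: monotone_scheme N f wt L B c \<kappa> \<delta> h \<tau> k a "x1 + real n"
      proof (unfold_locales, goal_cases)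
        case (4 s t) then show ?case by (rule L(2))
      next
        case 12 show ?case using \<tau>(2) by (simp add: s_def)
      next
        case (18 x) show ?case using wt(3)[of x] by (simp add: B_def)
      qed (use f0 f1 cf L C0 \<kappa> \<delta> h \<tau> k a wt sup in \<open>auto simp: B_def\<close>)
      show ?thesis
      proof (rule S.approximate_front[OF f_pos \<theta>(2,3) wt(5)])
        fix v
        assume v: "antimono v" "\<And>x. 0 \<le> v x" "\<And>x. v x \<le> 1" "\<And>x. continuous (at_right x) v"
          "\<And>x. x < 0 \<Longrightarrow> \<theta> \<le> v x" "\<And>x. 0 < x \<Longrightarrow> v x \<le> \<theta>"
          and app: "\<And>x. x < x1 + real n - x1 \<Longrightarrow> \<bar>J (far \<delta>) v x + c * dq h v x + f (v x)\<bar> \<le> k / \<tau>"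
        have "\<bar>J (far \<delta>) v x + c * dq h v x + f (v x)\<bar> \<le> inverse (real (Suc n))" if "x < real n" for x
          by (rule order_trans[OF app k(3)]) (use that in simp)
        then have "P n v \<delta> h" unfolding P_def using v \<delta> h by blast
        then show ?thesis by blast
      qed
    qed
  qed
  then obtain v \<delta> h where "\<And>n. P n (v n) (\<delta> n) (h n)" by metis
  then have v: "\<And>n. antimono (v n)" "\<And>n x. 0 \<le> v n x" "\<And>n x. v n x \<le> 1" "\<And>n x. continuous (at_right x) (v n)"
    "\<And>n x. x < 0 \<Longrightarrow> \<theta> \<le> v n x" "\<And>n x. 0 < x \<Longrightarrow> v n x \<le> \<theta>"
    and \<delta>: "\<And>n. 0 < \<delta> n" "\<And>n. \<delta> n \<le> inverse (real (Suc n))" and h: "\<And>n. 0 < h n" "\<And>n. h n \<le> inverse (real (Suc n))"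
    and app: "\<And>n x. x < real n \<Longrightarrow> \<bar>J (far (\<delta> n)) (v n) x + c * dq (h n) (v n) x + f (v n x)\<bar> \<le> inverse (real (Suc n))"
    unfolding P_def by blast+
  \<comment> \<open>Helly's theorem is stated for increasing functions, hence the sign.\<close>
  have "\<exists>s. strict_mono (s :: nat \<Rightarrow> nat) \<and> (\<exists>F. (\<forall>x. continuous (at_right x) F) \<and> mono F \<and> (\<forall>x. \<bar>F x\<bar> \<le> 1) \<and>
    (\<forall>x. continuous (at x) F \<longrightarrow> (\<lambda>n. - v (s n) x) \<longlonglongrightarrow> F x))"
  proof (rule Helly_selection[where f = "\<lambda>n x. - v n x"])
    show "continuous (at_right x) (\<lambda>x. - v n x)" for n x by (rule continuous_minus[OF v(4)])
    show "mono (\<lambda>x. - v n x)" for n using v(1)[of n] by (simp add: mono_def antimono_def)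
    show "\<bar>- v n x\<bar> \<le> 1" for n x using v(2,3)[of n x] by simp
  qed
  then obtain s F where s: "strict_mono (s :: nat \<Rightarrow> nat)" and F: "\<And>x. continuous (at_right x) F" "mono F" "\<And>x. \<bar>F x\<bar> \<le> 1"
    "\<And>x. isCont F x \<Longrightarrow> (\<lambda>n. - v (s n) x) \<longlonglongrightarrow> F x" by blast
  define u where "u x = - F x" for x
  have u_anti: "antimono u" using F(2) by (simp add: u_def mono_def antimono_def)
  have u1: "u x \<le> 1" for x using F(3)[of x] by (simp add: u_def abs_le_iff)
  have u_rc: "continuous (at_right x) u" for x unfolding u_def by (rule continuous_minus[OF F(1)])
  have u_lim: "(\<lambda>n. v (s n) x) \<longlonglongrightarrow> u x" if "isCont u x" for x
  proof -
    have "isCont F x" using continuous_minus[OF that] by (simp add: u_def)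
    from tendsto_minus[OF F(4)[OF this]] show ?thesis by (simp add: u_def)
  qed
  \<comment> \<open>Convergence is available at continuity points, which are dense; monotonicity
    carries the bounds from there to all points.\<close>
  have between: "\<exists>y. a < y \<and> y < b \<and> isCont u y" if ab: "a < b" for a b
  proof -
    obtain y where "a < y" "y < b" "isCont F y" by (rule ex_isCont_between[OF F(2) ab])
    then show ?thesis unfolding u_def by (intro exI[of _ y] conjI continuous_minus)
  qed
  have u0: "0 \<le> u x" for x
  proof -
    obtain y where y: "x < y" "isCont u y" using between[of x "x + 1"] by auto
    have "0 \<le> u y" by (rule tendsto_lowerbound[OF u_lim[OF y(2)]]) (simp_all add: v)
    also have "\<dots> \<le> u x" using y by (intro antimonoD[OF u_anti]) simp
    finally show ?thesis .
  qed
  have u_left: "\<theta> \<le> u x" if "x < 0" for x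
  proof -
    obtain y where y: "x < y" "y < 0" "isCont u y" using between[OF \<open>x < 0\<close>] by blast
    have "\<theta> \<le> u y" by (rule tendsto_lowerbound[OF u_lim[OF y(3)]]) (simp_all add: v(5)[OF y(2)])
    also have "\<dots> \<le> u x" using y by (intro antimonoD[OF u_anti]) simp
    finally show ?thesis .
  qed
  have u_right: "u x \<le> \<theta>" if "0 < x" for x
  proof -
    obtain y where y: "0 < y" "y < x" "isCont u y" using between[OF \<open>0 < x\<close>] by blast
    have "u x \<le> u y" using y by (intro antimonoD[OF u_anti]) simp
    also have "\<dots> \<le> \<theta>" by (rule tendsto_upperbound[OF u_lim[OF y(3)]]) (simp_all add: v(6)[OF y(1)])
    finally show ?thesis .
  qed
  have to0: "X \<longlonglongrightarrow> 0" if "\<And>n. 0 < X n" "\<And>n. X n \<le> inverse (real (Suc n))" for X :: "nat \<Rightarrow> real"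
    by (rule tendsto_sandwich[OF _ _ tendsto_const LIMSEQ_inverse_real_of_nat])
      (use that in \<open>auto intro: always_eventually less_imp_le\<close>)
  have s_ge: "n \<le> s n" for n using s by (rule seq_suble)
  have inv_s: "inverse (real (Suc (s n))) \<le> inverse (real (Suc n))" for n using s_ge[of n] by (simp add: le_imp_inverse_le)
  have eq: "J UNIV (avg e (avg e (avg e u))) x + c * avg e (avg e (dq e u)) x
               + avg e (avg e (avg e (\<lambda>x. f (u x)))) x = 0" if "e > 0" for e x
  proof (rule mollified_equation_of_limit[where v = "\<lambda>n. v (s n)" and h = "\<lambda>n. h (s n)" and \<delta> = "\<lambda>n. \<delta> (s n)"])
    show "(\<lambda>n. h (s n)) \<longlonglongrightarrow> 0" by (rule to0) (use h order_trans[OF _ inv_s] in auto)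
    show "(\<lambda>n. \<delta> (s n)) \<longlonglongrightarrow> 0" by (rule to0) (use \<delta> order_trans[OF _ inv_s] in auto)
    show "\<bar>J (far (\<delta> (s n))) (v (s n)) x + c * dq (h (s n)) (v (s n)) x + f (v (s n) x)\<bar> \<le> inverse (real (Suc n))"
      if "x < real n" for n x
      by (rule order_trans[OF app inv_s]) (use that s_ge[of n] in linarith)
  qed (fact v \<delta> h cf u_anti u0 u1 u_lim that)+
  obtain Fb where Fb: "\<And>s. s \<in> {0..1} \<Longrightarrow> \<bar>f s\<bar> \<le> Fb" using continuous_bounded_unit_interval[OF cf] by blast
  interpret M: mollified_front N u f c L Fb
  proof (unfold_locales, goal_cases)
    case (6 s t) then show ?case using C0 by (intro L(2)) (auto simp: B_def)
  qed (use u_anti u0 u1 u_rc cf Fb L \<kappa> eq in auto)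
  obtain u' where u': "\<And>x. (u has_real_derivative u' x) (at x)" "continuous_on UNIV u'"
    "\<And>x. ((\<lambda>\<delta>. J (far \<delta>) u x) \<longlongrightarrow> - (c * u' x + f (u x))) (at_right 0)"
    using M.classical_solution by blast
  obtain l1 l2 where l: "(u \<longlongrightarrow> l1) at_bot" "(u \<longlongrightarrow> l2) at_top" "\<And>x. u x \<le> l1" "\<And>x. l2 \<le> u x" "l1 \<le> 1" "0 \<le> l2"
    using antimono_limits[OF u_anti u0 u1] by blast
  \<comment> \<open>Positivity of \<open>f\<close> inside the unit interval leaves 0 and 1 as
    possible limits, and the centring at \<open>\<theta>\<close> decides which one occurs at which
    end.\<close>
  have "f l1 = 0"
  proof (rule M.limit_is_zero_of_f)
    show "(\<lambda>n. u (- real n + a)) \<longlonglongrightarrow> l1" for a by (rule filterlim_compose[OF l(1) filterlim_real_shift(1)])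
  qed
  moreover have "\<theta> \<le> l1" using u_left[of "-1"] l(3)[of "-1"] by simp
  ultimately have l1: "l1 = 1" using f_pos[of l1] \<theta> l(5) by force
  have "f l2 = 0"
  proof (rule M.limit_is_zero_of_f)
    show "(\<lambda>n. u (real n + a)) \<longlonglongrightarrow> l2" for a by (rule filterlim_compose[OF l(2) filterlim_real_shift(2)])
  qed
  moreover have "l2 \<le> \<theta>" using u_right[of 1] l(4)[of 1] by simp
  ultimately have l2: "l2 = 0" using f_pos[of l2] \<theta> l(6) by force
  have "0 < u x" for x
    by (rule front_positive[OF u0 u_anti _ _ u'(1) f0 u'(3) nz]) (use l(1) l1 M.bounded_borel_v in auto)
  then show ?thesis
    using u_anti u1 u' l(1,2) unfolding l1 l2 by blast
qed

end


subsection \<open>Measures on the punctured line\<close>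

text \<open>Pushing forward along the inclusion replaces the sigma-algebra of the punctured line by
  the Borel sets of the line; the puncture survives as a null set.\<close>

lemma symmetric_extension:
  fixes \<mu> :: "real measure"
  assumes "radon_measure_on (UNIV - {0}) \<mu>" "symmetric_measure \<mu>"
    and fin: "(\<integral>\<^sup>+z. ennreal (min \<bar>z\<bar> (z\<^sup>2)) \<partial>\<mu>) < \<infinity>"
  defines "N \<equiv> distr \<mu> borel (\<lambda>x. x)"
  shows "(\<lambda>x. x) \<in> measurable \<mu> borel" "jump_measure N" "distr N borel uminus = N"
    "emeasure N UNIV = emeasure \<mu> (space \<mu>)"
proof -
  have sets: "sets \<mu> = sets (restrict_space borel (UNIV - {0}))"
    using assms(1) by (simp add: radon_measure_on_def)
  have sp: "space \<mu> = UNIV - {0}"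
    using sets_eq_imp_space_eq[OF sets] by (simp add: space_restrict_space)
  show id: "(\<lambda>x. x) \<in> measurable \<mu> borel"
    unfolding measurable_cong_sets[OF sets refl] by (rule measurable_restrict_space1) simp
  have em: "emeasure N A = emeasure \<mu> (A - {0})" if "A \<in> sets borel" for A
  proof -
    have "emeasure N A = emeasure \<mu> ((\<lambda>x. x) -` A \<inter> space \<mu>)"
      unfolding N_def by (rule emeasure_distr[OF id that])
    also have "(\<lambda>x. x) -` A \<inter> space \<mu> = A - {0}" by (auto simp: sp)
    finally show ?thesis .
  qed
  have mem: "A - {0} \<in> sets \<mu>" if "A \<in> sets borel" for A
  proof -
    have "(\<lambda>x. x) -` A \<inter> space \<mu> \<in> sets \<mu>" by (rule measurable_sets[OF id that])
    moreover have "(\<lambda>x. x) -` A \<inter> space \<mu> = A - {0}" by (auto simp: sp)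
    ultimately show ?thesis by simp
  qed
  show "jump_measure N"
  proof
    show "sets N = sets borel" by (simp add: N_def)
    show "emeasure N {0} = 0" using em[of "{0}"] by simp
    have "(\<integral>\<^sup>+z. ennreal (kern z) \<partial>N) = (\<integral>\<^sup>+z. ennreal (kern z) \<partial>\<mu>)"
      unfolding N_def by (rule nn_integral_distr[OF id]) measurable
    also have "\<dots> \<le> (\<integral>\<^sup>+z. ennreal (min \<bar>z\<bar> (z\<^sup>2)) \<partial>\<mu>)"
    proof (rule nn_integral_mono, rule ennreal_leI)
      fix z :: real
      show "kern z \<le> min \<bar>z\<bar> (z\<^sup>2)"
      proof (cases "\<bar>z\<bar> \<le> 1")
        case True
        then have "\<bar>z\<bar> * \<bar>z\<bar> \<le> 1 * \<bar>z\<bar>" by (intro mult_right_mono) auto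
        then have "z\<^sup>2 \<le> \<bar>z\<bar>" by (simp add: power2_eq_square)
        then show ?thesis by (simp add: kern_def)
      next
        case False
        then have "1 * \<bar>z\<bar> \<le> \<bar>z\<bar> * \<bar>z\<bar>" by (intro mult_right_mono) auto
        then have "\<bar>z\<bar> \<le> z\<^sup>2" by (simp add: power2_eq_square)
        then show ?thesis using False by (simp add: kern_def)
      qed
    qed
    also note fin
    finally show "(\<integral>\<^sup>+z. ennreal (kern z) \<partial>N) < \<infinity>" .
  qed
  show "distr N borel uminus = N"
  proof (rule measure_eqI)
    fix A assume "A \<in> sets (distr N borel uminus)"
    then have A: "A \<in> sets borel" by simp
    then have A': "uminus -` A \<in> sets borel"
      using measurable_sets[of "uminus :: real \<Rightarrow> real" borel borel A] by simp
    have "emeasure (distr N borel uminus) A = emeasure N (uminus -` A)"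
      using emeasure_distr[of uminus N borel A] A by (simp add: N_def)
    also have "\<dots> = emeasure \<mu> (uminus -` A - {0})" by (rule em[OF A'])
    also have "uminus -` A - {0} = uminus ` (A - {0})"
    proof (intro set_eqI iffI)
      fix x :: real assume "x \<in> uminus -` A - {0}"
      then have "- (- x) \<in> uminus ` (A - {0})" by (intro imageI) auto
      then show "x \<in> uminus ` (A - {0})" by simp
    qed auto
    also have "emeasure \<mu> (uminus ` (A - {0})) = emeasure \<mu> (A - {0})"
      using assms(2) mem[OF A] by (simp add: symmetric_measure_def)
    also have "\<dots> = emeasure N A" by (rule em[OF A, symmetric])
    finally show "emeasure (distr N borel uminus) A = emeasure N A" .
  qed (simp add: N_def)
  show "emeasure N UNIV = emeasure \<mu> (space \<mu>)"
    using em[of UNIV] by (simp add: sp)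
qed

text \<open>On far jumps \<open>N\<close> is finite, so the increments are integrable one by one.
  Reflection gives \<open>z\<close> and \<open>- z\<close> equal integrals, whose mean is half the
  second difference.\<close>

lemma (in jump_measure) symmetric_truncation:
  assumes sym: "distr N borel uminus = N" and u: "bounded_borel u" and \<delta>: "\<delta> > 0"
  shows "integrable N (\<lambda>z. indicator (far \<delta>) z * (u (x + z) - u x))"
    "(\<integral>z. indicator (far \<delta>) z * (u (x + z) - u x) \<partial>N) = J (far \<delta>) u x"
proof -
  define g where "g z = indicator (far \<delta>) z * (u (x + z) - u x)" for z :: real
  have [measurable]: "u \<in> borel_measurable borel" using u by (rule bounded_borel_measurable)
  obtain C where C: "C \<ge> 0" "\<And>x. \<bar>u x\<bar> \<le> C" using bounded_borelE[OF u] by blast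
  have gm[measurable]: "g \<in> borel_measurable borel" unfolding g_def by measurable
  have ig: "integrable N g"
  proof (rule Bochner_Integration.integrable_bound)
    show "integrable N (\<lambda>z. 2 * C * indicator (far \<delta>) z)"
    proof (rule integrable_mult_right)
      show "integrable N (indicator (far \<delta>) :: real \<Rightarrow> real)"
        using emeasure_far[OF \<delta>] by (intro integrable_real_indicator) auto
    qed
    show "AE z in N. norm (g z) \<le> norm (2 * C * indicator (far \<delta>) z :: real)"
    proof (rule AE_I2)
      fix z
      have "\<bar>u (x + z) - u x\<bar> \<le> 2 * C" using C(2)[of "x + z"] C(2)[of x] by linarith
      then show "norm (g z) \<le> norm (2 * C * indicator (far \<delta>) z :: real)"
        using C(1) by (simp add: g_def indicator_def)
    qed
  qed measurable
  then show "integrable N (\<lambda>z. indicator (far \<delta>) z * (u (x + z) - u x))" by (simp add: g_def[abs_def])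
  have um: "uminus \<in> measurable N borel" by measurable
  have sg: "(\<integral>z. g (- z) \<partial>N) = (\<integral>z. g z \<partial>N)"
    using integral_distr[OF um gm] sym by simp
  have "integrable (distr N borel uminus) g" using ig by (simp add: sym)
  then have ig': "integrable N (\<lambda>z. g (- z))" using integrable_distr[OF um, of g] by simp
  have "(\<integral>z. indicator (far \<delta>) z * dd u z x \<partial>N) = (\<integral>z. g z + g (- z) \<partial>N)"
    by (intro Bochner_Integration.integral_cong) (auto simp: g_def dd_def indicator_def)
  also have "\<dots> = 2 * (\<integral>z. g z \<partial>N)" using ig ig' sg by simp
  finally show "(\<integral>z. indicator (far \<delta>) z * (u (x + z) - u x) \<partial>N) = J (far \<delta>) u x"
    by (simp add: J_def g_def)
qed

lemma C1_iff: "u \<in> C1 \<longleftrightarrow> (\<forall>x. (u has_real_derivative deriv u x) (at x)) \<and> continuous_on UNIV (deriv u)"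
proof
  assume "u \<in> C1"
  then obtain D where D: "\<And>x. (u has_real_derivative D x) (at x)" "continuous_on UNIV D"
    by (auto simp: C1_def C1_differentiable_on_def has_real_derivative_iff_has_vector_derivative)
  then have "deriv u = D" by (auto intro: DERIV_imp_deriv)
  then show "(\<forall>x. (u has_real_derivative deriv u x) (at x)) \<and> continuous_on UNIV (deriv u)" using D by simp
next
  assume "(\<forall>x. (u has_real_derivative deriv u x) (at x)) \<and> continuous_on UNIV (deriv u)"
  then show "u \<in> C1"
    by (auto simp: C1_def C1_differentiable_on_def has_real_derivative_iff_has_vector_derivative)
qed

text \<open>The set where the bound fails is open, hence of positive measure unless empty.\<close>

lemma continuous_AE_bounded:
  fixes w :: "real \<Rightarrow> real"
  assumes w: "continuous_on UNIV w" and "AE x in lebesgue. \<bar>w x\<bar> \<le> C"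
  shows "\<bar>w x\<bar> \<le> C"
proof (rule ccontr)
  assume x: "\<not> \<bar>w x\<bar> \<le> C"
  define S where "S = {x. C < \<bar>w x\<bar>}"
  have "open S" unfolding S_def using w by (intro open_Collect_less continuous_intros)
  moreover have "x \<in> S" using x by (simp add: S_def)
  ultimately obtain e where e: "e > 0" "ball x e \<subseteq> S" by (auto simp: open_contains_ball)
  have "AE y in lebesgue. y \<notin> ball x e"
    using assms(2) by eventually_elim (use e(2) in \<open>auto simp: S_def\<close>)
  then have "negligible (ball x e)"
    by (simp add: AE_iff_null_sets negligible_iff_null_sets)
  then show False using e(1) open_not_negligible[of "ball x e"] by simp
qed


theorem theorem1p3:
  fixes \<mu> :: "real measure" and f w :: "real \<Rightarrow> real" and \<kappa> :: real
  assumes "radon_measure_on (UNIV - {0}) \<mu>"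
    and "emeasure \<mu> (space \<mu>) \<noteq> 0"
    and "symmetric_measure \<mu>"
    and "\<And>x. x \<noteq> 0 \<Longrightarrow> emeasure \<mu> {x} = 0"
    and "(\<integral>\<^sup>+z. ennreal (min \<bar>z\<bar> (z\<^sup>2)) \<partial>\<mu>) < \<infinity>"
    and "f \<in> C1" and "f 0 = 0" and "f 1 = 0" and "deriv f 1 < 0"
    and "\<And>s. s \<in> {0<..<1} \<Longrightarrow> f s > 0"
    and "\<kappa> > 0"
    and "w \<in> C2 \<inter> Linfty \<inter> jump_dom \<mu>" and "\<And>x. w x > 0"
    and "\<And>x. jump_op \<mu> w x + \<kappa> * deriv w x + f (w x) < 0"
    and "\<exists>L\<ge>1. (w \<longlongrightarrow> L) at_bot"
    and "(INF x. w x) < 1"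
  shows "\<exists>c_star. 0 < c_star \<and> c_star \<le> \<kappa> \<and>
    (\<forall>c\<ge>c_star. \<exists>u \<in> Linfty \<inter> C1 \<inter> jump_dom \<mu>.
       (\<forall>x. u x > 0) \<and> antimono u \<and>
       (\<forall>x. jump_op \<mu> u x + c * deriv u x + f (u x) = 0) \<and>
       (u \<longlongrightarrow> 1) at_bot \<and> (u \<longlongrightarrow> 0) at_top)"
proof -
  define N where "N = distr \<mu> borel (\<lambda>x. x)"
  note ext = symmetric_extension[OF assms(1,3,5), folded N_def]
  interpret jump_measure N by (rule ext(2))
  have nz: "emeasure N UNIV \<noteq> 0" using ext(4) assms(2) by simp
  have trunc: "set_integrable \<mu> (far \<delta>) (\<lambda>z. u (x + z) - u x)"
    "truncated_jump \<mu> u x \<delta> = J (far \<delta>) u x" if u: "bounded_borel u" and \<delta>: "0 < \<delta>" for u x \<delta>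
  proof -
    have [measurable]: "u \<in> borel_measurable borel" using u by (rule bounded_borel_measurable)
    define g where "g = (\<lambda>z. indicator (far \<delta>) z * (u (x + z) - u x))"
    have gm: "g \<in> borel_measurable borel" unfolding g_def by measurable
    note sym = symmetric_truncation[OF ext(3) u \<delta>, of x, folded g_def]
    have "integrable \<mu> g" using sym(1) integrable_distr[OF ext(1), of g] by (simp add: N_def)
    then show "set_integrable \<mu> (far \<delta>) (\<lambda>z. u (x + z) - u x)"
      by (simp add: set_integrable_def g_def)
    have "truncated_jump \<mu> u x \<delta> = (\<integral>z. g z \<partial>\<mu>)"
      by (simp add: truncated_jump_def set_lebesgue_integral_def g_def)
    also have "\<dots> = (\<integral>z. g z \<partial>N)" unfolding N_def by (rule integral_distr[OF ext(1) gm, symmetric])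
    finally show "truncated_jump \<mu> u x \<delta> = J (far \<delta>) u x" using sym(2) by (simp add: g_def)
  qed
  have trunc_lim: "(truncated_jump \<mu> u x \<longlongrightarrow> l) (at_right 0)"
    if u: "bounded_borel u" and l: "((\<lambda>\<delta>. J (far \<delta>) u x) \<longlongrightarrow> l) (at_right 0)" for u x l
  proof (rule Lim_transform_eventually[OF l])
    show "\<forall>\<^sub>F \<delta> in at_right 0. J (far \<delta>) u x = truncated_jump \<mu> u x \<delta>"
      using eventually_at_right_less[of "0 :: real"] by eventually_elim (simp add: trunc(2)[OF u])
  qed
  have jump: "jump_op \<mu> u x = l"
    if "bounded_borel u" "((\<lambda>\<delta>. J (far \<delta>) u x) \<longlongrightarrow> l) (at_right 0)" for u x l
    unfolding jump_op_def by (rule tendsto_Lim[OF _ trunc_lim[OF that]]) simp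
  have f: "\<And>x. (f has_real_derivative deriv f x) (at x)" "continuous_on UNIV (deriv f)"
    using assms(6) by (auto simp: C1_iff)
  have w: "\<And>x. (w has_real_derivative deriv w x) (at x)"
    "\<And>x. (deriv w has_real_derivative deriv (deriv w) x) (at x)" "continuous_on UNIV (deriv (deriv w))"
    using assms(12) by (auto simp: C2_def C1_iff)
  have cw: "continuous_on UNIV w" using w(1) by (intro DERIV_continuous_on) (auto intro: has_field_derivative_at_within)
  obtain C0 where "AE x in lebesgue. \<bar>w x\<bar> \<le> C0" using assms(12) by (auto simp: Linfty_def)
  then have wb: "\<bar>w x\<bar> \<le> C0" for x by (rule continuous_AE_bounded[OF cw])
  have bw: "bounded_borel w" using cw wb by (intro bounded_borelI borel_measurable_continuous_onI)
  \<comment> \<open>For the \<open>C^2\<close> supersolution second differences are dominated by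
    \<open>kern\<close> at each point, so the principal value is the absolutely convergent
    \<open>J UNIV w\<close>. The front is treated through its limit of truncations instead.\<close>
  have Jw: "jump_op \<mu> w x = J UNIV w x" for x
  proof (rule jump[OF bw])
    obtain C where C: "\<forall>z. \<bar>dd w z x\<bar> \<le> C * kern z"
      using dd_local_bound[OF w wb, where a=x and b=x] by auto
    have "((\<lambda>\<delta>. C / 2 * small_mass \<delta>) \<longlongrightarrow> C / 2 * 0) (at_right 0)"
      by (intro tendsto_intros small_mass_tendsto)
    then have "((\<lambda>\<delta>. C / 2 * small_mass \<delta>) \<longlongrightarrow> 0) (at_right 0)" by simp
    then have "((\<lambda>\<delta>. J (far \<delta>) w x - J UNIV w x) \<longlongrightarrow> 0) (at_right 0)"
    proof (rule Lim_null_comparison[rotated])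
      show "\<forall>\<^sub>F \<delta> in at_right 0. norm (J (far \<delta>) w x - J UNIV w x) \<le> C / 2 * small_mass \<delta>"
        using J_local_split[OF bounded_borel_measurable[OF bw] spec[OF C]]
        by (intro always_eventually allI) (simp only: real_norm_def abs_minus_commute)
    qed
    then show "((\<lambda>\<delta>. J (far \<delta>) w x) \<longlongrightarrow> J UNIV w x) (at_right 0)" by (rule LIM_zero_cancel)
  qed
  have super: "J UNIV w x + \<kappa> * deriv w x + f (w x) < 0" for x using assms(14)[of x] by (simp add: Jw)
  obtain l where l: "(w \<longlongrightarrow> l) at_bot" "1 \<le> l" using assms(15) by blast
  have "bdd_below (range w)" using assms(13) by (auto intro!: bdd_belowI[of _ 0] less_imp_le)
  then obtain x1 where x1: "w x1 < 1" using assms(16) by (auto simp: cINF_less_iff)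
  have w_le: "w x \<le> C0" for x using wb[of x] by simp
  show ?thesis
  proof (intro exI[of _ \<kappa>] conjI allI impI assms(11) order_refl)
    fix c assume c: "\<kappa> \<le> c"
    obtain u u' where u: "antimono u" "\<And>x. 0 < u x" "\<And>x. u x \<le> 1"
      and u': "\<And>x. (u has_real_derivative u' x) (at x)" "continuous_on UNIV u'"
      and lim: "(u \<longlongrightarrow> 1) at_bot" "(u \<longlongrightarrow> 0) at_top"
      and Ju: "\<And>x. ((\<lambda>\<delta>. J (far \<delta>) u x) \<longlongrightarrow> - (c * u' x + f (u x))) (at_right 0)"
      using front_exists[OF f assms(7,8,9,10) w assms(13) w_le super l x1 assms(11) c nz] by blast
    have bu: "bounded_borel u" by (rule bounded_borel_antimono[OF u(1) less_imp_le[OF u(2)] u(3)])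
    have du: "deriv u x = u' x" for x by (rule DERIV_imp_deriv[OF u'(1)])
    have "u \<in> C1" using u' by (simp add: C1_iff du[abs_def])
    moreover have "u \<in> Linfty"
    proof -
      have "u \<in> borel_measurable lebesgue"
        using bounded_borel_measurable[OF bu] by (intro measurable_completion) simp
      moreover have "\<bar>u x\<bar> \<le> 1" for x using u(2,3)[of x] by simp
      ultimately show ?thesis unfolding Linfty_def by (auto intro!: exI[of _ 1])
    qed
    moreover have "u \<in> jump_dom \<mu>"
      unfolding jump_dom_def using trunc(1)[OF bu] trunc_lim[OF bu Ju] by blast
    moreover have "jump_op \<mu> u x + c * deriv u x + f (u x) = 0" for x
      using jump[OF bu Ju, of x] by (simp add: du)
    ultimately show "\<exists>u \<in> Linfty \<inter> C1 \<inter> jump_dom \<mu>.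
       (\<forall>x. u x > 0) \<and> antimono u \<and>
       (\<forall>x. jump_op \<mu> u x + c * deriv u x + f (u x) = 0) \<and>
       (u \<longlongrightarrow> 1) at_bot \<and> (u \<longlongrightarrow> 0) at_top"
      using u lim by (intro bexI[of _ u]) auto
  qed
qed

end
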